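(* Let $D\subset\overline{\mathbb{C}}$ be a domain possessing a Green function $g(z,\zeta)$, let $K\subset D\setminus\{\infty\}$ be compact, let $R>0$, $I=[0,R]$, and let $f:K\to\mathbb{R}\cup\{+\infty\}$ be lower semicontinuous with $\mathrm{cap}(\{z\in K: f(z)<+\infty\})>0$. Let $\mu^*\in\mathcal{B}_R(K)$ be the minimizer of $J_f$ in $\mathcal{B}_R(K)$, $v_f=J_f(\mu^* )$, $\beta=\min_{z\in K}f(z)$, and $e_N=\min_{K^N\times I^N}E_{N,f}$ for $N\ge2$. The following properties hold: i) $\mu^*=0$ is the zero measure if and only if $f\ge0$ q.e. on $K$. ii) If $\|\mu^*\|<R$, then $v_f=\int f\,d\mu^*=-\iint g(z,\zeta)\,d\mu^*(z)\,d\mu^*(\zeta)$. iii) If $\|\mu^*\|>0$, then $v_f<0$. iv) If $f\le0$ on $K$, then $e_{N+1}\le e_N$ for all $N\ge2$. v) Let $(z_{1,N},\ldots,z_{N,N},m_{1,N},\ldots,m_{N,N})\in K^N\times I^N$ be a minimizer of $E_{N,f}$ for some $N\ge2$. If $m_{i,N}>0$ and $m_{j,N}>0$ for a pair of indices $i\ne j$, then $z_{i,N}\ne z_{j,N}$. vi) Let $N\geq 2$. If $\beta<0$ and $e_{N+1}<e_N+2RN\beta$, then for any minimizer $(z_{1,N+1},\ldots,z_{N+1,N+1},m_{1,N+1},\ldots,m_{N+1,N+1})$ of $E_{N+1,f}$ we must have $m_{j,N+1}>0$ for all $1\le j\le N+1$. vii) Let $N\ge 2$. If $(z_{1,N},\ldots,z_{N,N},m_{1,N},\ldots,m_{N,N})$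 is a minimizer of $E_{N,f}$ and $0<m_{i,N}<R$ for some $1\le i\le N$, then $f(z_{i,N})$ is finite and $$\sum_{\substack{j=1\\ j\ne i}}^N m_{j,N}\,g(z_{i,N},z_{j,N})=-N f(z_{i,N}).$$
   Context: $g(z,\zeta)$ is the Green function of $D$ with logarithmic pole ($g(z,z)=+\infty$). $\mathrm{cap}$ is logarithmic capacity; "q.e. on $K$" means except for a set of logarithmic capacity zero. $\mathcal{B}_R(K)$ is the set of positive Borel measures $\mu$ supported on $K$ with $\|\mu\|=\mu(K)\le R$. $J_f(\mu)=\iint g(z,\zeta)\,d\mu(z)\,d\mu(\zeta)+2\int f\,d\mu$; it is known to have a unique minimizer on $\mathcal{B}_R(K)$. For $N\ge2$, $$E_{N,f}(z_1,\ldots,z_N,m_1,\ldots,m_N)=\sum_{1\le i\ne j\le N}m_im_j\,g(z_i,z_j)+2N\sum_{j=1}^N m_jf(z_j)$$ on $K^N\times I^N$, with the convention $0\cdot\infty=0$; the infimum $e_N$ over $K^N\times I^N$ is attained. *)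

theory Defs
  imports "HOL-Analysis.Analysis"
begin

section \<open>Integrals of extended real valued functions\<close>

text \<open>
  The integral of the positive part minus that of the negative part (\<^const>\<open>e2ennreal\<close> sends
  negative values to 0). All integrands used below are bounded below on the (compact) support
  of a finite measure, so the form \<open>\<infinity> - \<infinity>\<close> does not occur.
\<close>

definition ereal_integral :: "'a measure \<Rightarrow> ('a \<Rightarrow> ereal) \<Rightarrow> ereal" where
  "ereal_integral M h =
     enn2ereal (\<integral>\<^sup>+x. e2ennreal (h x) \<partial>M) - enn2ereal (\<integral>\<^sup>+x. e2ennreal (- h x) \<partial>M)"


section \<open>Logarithmic capacity\<close>

definition log_kernel :: "complex \<Rightarrow> complex \<Rightarrow> ereal" where
  "log_kernel z w = (if z = w then \<infinity> else ereal (- ln (cmod (z - w))))"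

definition log_energy :: "complex measure \<Rightarrow> ereal" where
  "log_energy \<mu> = ereal_integral \<mu> (\<lambda>w. ereal_integral \<mu> (\<lambda>z. log_kernel z w))"

definition exp_minus :: "ereal \<Rightarrow> ennreal" where
  "exp_minus x = (case x of ereal r \<Rightarrow> ennreal (exp (- r)) | PInfty \<Rightarrow> 0 | MInfty \<Rightarrow> \<infinity>)"

text \<open>
  The supremum runs over the Borel probability measures with compact support contained in \<open>E\<close>
  (inner capacity). On Borel sets, the only ones that occur below, its null sets are the Borel
  polar sets.
\<close>

definition log_capacity :: "complex set \<Rightarrow> ennreal" where
  "log_capacity E =
     (SUP \<mu> \<in> {\<mu>. sets \<mu> = sets borel \<and> emeasure \<mu> UNIV = 1 \<and>
                   (\<exists>C. compact C \<and> C \<subseteq> E \<and> emeasure \<mu> (- C) = 0)}.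
        exp_minus (log_energy \<mu>))"

definition quasi_everywhere_on :: "complex set \<Rightarrow> (complex \<Rightarrow> bool) \<Rightarrow> bool" where
  "quasi_everywhere_on E P \<longleftrightarrow> log_capacity {z \<in> E. \<not> P z} = 0"


section \<open>Green functions of domains in the Riemann sphere\<close>

text \<open>Points of the sphere are \<^term>\<open>Some z\<close> for finite \<open>z\<close>, and \<^term>\<open>None\<close> for infinity.\<close>

definition riemann_sphere :: "complex option topology" where
  "riemann_sphere = Alexandroff_compactification euclidean"

definition sphere_domain :: "complex option set \<Rightarrow> bool" where
  "sphere_domain D \<longleftrightarrow>
     D \<noteq> {} \<and> openin riemann_sphere D \<and> connectedin riemann_sphere D"

text \<open>
  Twice continuously differentiable with vanishing Laplacian; \<open>ux\<close>, \<open>uy\<close>, \<open>uxx\<close>, ... are the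
  partial derivatives.
\<close>

definition harmonic_on :: "(complex \<Rightarrow> real) \<Rightarrow> complex set \<Rightarrow> bool" where
  "harmonic_on u S \<longleftrightarrow> open S \<and>
     (\<exists>ux uy uxx uxy uyx uyy :: complex \<Rightarrow> real.
        continuous_on S uxx \<and> continuous_on S uxy \<and> continuous_on S uyx \<and> continuous_on S uyy \<and>
        (\<forall>z\<in>S. (u has_derivative (\<lambda>h. Re h * ux z + Im h * uy z)) (at z) \<and>
               (ux has_derivative (\<lambda>h. Re h * uxx z + Im h * uxy z)) (at z) \<and>
               (uy has_derivative (\<lambda>h. Re h * uyx z + Im h * uyy z)) (at z) \<and>
               uxx z + uyy z = 0))"

definition chart_at_infinity :: "complex \<Rightarrow> complex option" where
  "chart_at_infinity w = (if w = 0 then None else Some (inverse w))"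

definition sphere_harmonic_on :: "(complex option \<Rightarrow> ereal) \<Rightarrow> complex option set \<Rightarrow> bool" where
  "sphere_harmonic_on u S \<longleftrightarrow>
     (\<forall>p\<in>S. \<bar>u p\<bar> \<noteq> \<infinity>) \<and>
     harmonic_on (\<lambda>z. real_of_ereal (u (Some z))) {z. Some z \<in> S} \<and>
     harmonic_on (\<lambda>w. real_of_ereal (u (chart_at_infinity w))) {w. chart_at_infinity w \<in> S}"

definition log_pole :: "(complex option \<Rightarrow> ereal) \<Rightarrow> complex option \<Rightarrow> bool" where
  "log_pole u p \<longleftrightarrow> u p = \<infinity> \<and>
     (case p of
        Some w \<Rightarrow> \<exists>B. \<forall>\<^sub>F z in at w. \<bar>real_of_ereal (u (Some z)) + ln (cmod (z - w))\<bar> \<le> B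
      | None \<Rightarrow> \<exists>B. \<forall>\<^sub>F z in at_infinity. \<bar>real_of_ereal (u (Some z)) - ln (cmod z)\<bar> \<le> B)"

text \<open>
  For each pole \<open>p\<close> in \<open>D\<close>, the function \<open>g(\<cdot>, p)\<close> is nonnegative and harmonic in \<open>D - {p}\<close>,
  bounded away from \<open>p\<close>, has a logarithmic pole at \<open>p\<close>, and tends to 0 at quasi-every boundary
  point of \<open>D\<close>. The boundary is taken in the sphere; the point at infinity, being polar, may
  always be exceptional. Such a \<open>g\<close> exists iff the boundary of \<open>D\<close> is non-polar, and its values
  on \<open>D \<times> D\<close> are then unique.
\<close>

definition green_function ::
    "complex option set \<Rightarrow> (complex option \<Rightarrow> complex option \<Rightarrow> ereal) \<Rightarrow> bool" where
  "green_function D g \<longleftrightarrow>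
     (\<forall>p\<in>D.
        (\<forall>q\<in>D. 0 \<le> g q p) \<and>
        sphere_harmonic_on (\<lambda>q. g q p) (D - {p}) \<and>
        (\<forall>U. openin riemann_sphere U \<and> p \<in> U \<longrightarrow> (\<exists>B. \<forall>q \<in> D - U. g q p \<le> ereal B)) \<and>
        log_pole (\<lambda>q. g q p) p \<and>
        quasi_everywhere_on {z. Some z \<in> riemann_sphere frontier_of D}
          (\<lambda>z. ((\<lambda>q. g q p) \<longlongrightarrow> 0) (atin_within riemann_sphere (Some z) D)))"


section \<open>The continuous energy problem\<close>

definition lower_semicontinuous_on :: "complex set \<Rightarrow> (complex \<Rightarrow> ereal) \<Rightarrow> bool" where
  "lower_semicontinuous_on K f \<longleftrightarrow> (\<forall>z\<in>K. f z \<le> Liminf (at z within K) f)"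

definition measures_upto :: "complex set \<Rightarrow> real \<Rightarrow> complex measure set" where
  "measures_upto K R =
     {\<mu>. sets \<mu> = sets borel \<and> emeasure \<mu> (- K) = 0 \<and> emeasure \<mu> K \<le> ennreal R}"

definition green_energy ::
    "(complex option \<Rightarrow> complex option \<Rightarrow> ereal) \<Rightarrow> complex measure \<Rightarrow> ereal" where
  "green_energy g \<mu> = ereal_integral \<mu> (\<lambda>w. ereal_integral \<mu> (\<lambda>z. g (Some z) (Some w)))"

definition weighted_energy ::
    "(complex option \<Rightarrow> complex option \<Rightarrow> ereal) \<Rightarrow> (complex \<Rightarrow> ereal) \<Rightarrow> complex measure \<Rightarrow> ereal"
  where "weighted_energy g f \<mu> = green_energy g \<mu> + 2 * ereal_integral \<mu> f"


section \<open>The discrete energy problem\<close>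

text \<open>
  Points and masses are indexed by \<open>1, ..., N\<close>; values at other indices are irrelevant. The
  convention \<open>0 \<cdot> \<infinity> = 0\<close> is that of type \<^typ>\<open>ereal\<close>.
\<close>

definition configurations ::
    "complex set \<Rightarrow> real \<Rightarrow> nat \<Rightarrow> ((nat \<Rightarrow> complex) \<times> (nat \<Rightarrow> real)) set" where
  "configurations K R N = ({1..N} \<rightarrow> K) \<times> ({1..N} \<rightarrow> {0..R})"

definition discrete_energy ::
    "(complex option \<Rightarrow> complex option \<Rightarrow> ereal) \<Rightarrow> (complex \<Rightarrow> ereal) \<Rightarrow> nat \<Rightarrow>
      (nat \<Rightarrow> complex) \<times> (nat \<Rightarrow> real) \<Rightarrow> ereal" where
  "discrete_energy g f N = (\<lambda>(z, m).
     (\<Sum>i\<in>{1..N}. \<Sum>j\<in>{1..N} - {i}. ereal (m i * m j) * g (Some (z i)) (Some (z j))) +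
     ereal (2 * real N) * (\<Sum>j\<in>{1..N}. ereal (m j) * f (z j)))"

definition min_discrete_energy ::
    "(complex option \<Rightarrow> complex option \<Rightarrow> ereal) \<Rightarrow> (complex \<Rightarrow> ereal) \<Rightarrow> complex set \<Rightarrow> real \<Rightarrow> nat \<Rightarrow>
      ereal" where
  "min_discrete_energy g f K R N = (INF c \<in> configurations K R N. discrete_energy g f N c)"

definition discrete_minimizer ::
    "(complex option \<Rightarrow> complex option \<Rightarrow> ereal) \<Rightarrow> (complex \<Rightarrow> ereal) \<Rightarrow> complex set \<Rightarrow> real \<Rightarrow> nat \<Rightarrow>
      (nat \<Rightarrow> complex) \<Rightarrow> (nat \<Rightarrow> real) \<Rightarrow> bool" where
  "discrete_minimizer g f K R N z m \<longleftrightarrow>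
     is_arg_min (discrete_energy g f N) (\<lambda>c. c \<in> configurations K R N) (z, m)"

end

theory Submission
  imports Defs "HOL-Complex_Analysis.Complex_Analysis" "HOL-Probability.Probability"
begin

text \<open>
  Parts i)--iii) come from scaling \<open>\<mu>\<close> and from comparing Green and logarithmic energies; parts
  iv)--vii) from the fact that the discrete energy is affine in each single mass. All of this rests on
  the symmetry \<open>g(p, q) = g(q, p)\<close>, which vii) needs literally and which makes estimates of
  \<open>g(\<cdot>, w) + log \<bar>\<cdot> - w\<bar>\<close> closed conditions on the pole \<open>w\<close>.

  For the symmetry let \<open>u = g(\<cdot>, p)\<close> and \<open>v = g(\<cdot>, q)\<close>. Subtracting a small constant and a small
  positive barrier, infinite at the exceptional boundary points, and taking the positive part turns
  \<open>u\<close> into a compactly supported \<open>\<phi>\<close>. The average \<open>A\<close> over circles of a fixed small radius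
  \<open>r\<close> is self-adjoint, \<open>v - A v\<close> is the bump \<open>log\<^sup>+ (r / \<bar>z - q\<bar>)\<close> on the support of \<open>\<phi>\<close>, and
  \<open>\<phi> - A \<phi>\<close> is at most slightly more than the corresponding bump at \<open>p\<close>. Since \<open>v \<ge> 0\<close>,
  integrating gives \<open>u(q) \<le> v(p)\<close> in the limit.

  The barriers are \<open>- log \<bar>P\<bar>\<close> for polynomials \<open>P\<close> that are small on a compact set of capacity zero.
  If there were none, one could choose a sequence of points of bounded discrete logarithmic energy; a
  weak limit of its empirical measures, obtained from Skorohod's theorem after lifting the points to
  \<open>[0, 1]\<close> along a space-filling curve, would have finite logarithmic energy.
\<close>


section \<open>Harmonic functions in the plane\<close>

text \<open>The point at infinity shapes the barrier argument. \<open>D\<close> may be unbounded in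
  the plane or contain infinity, and -log|P| tends to minus infinity there. Each barrier therefore
  also carries a small multiple of log|z - p|, which makes it nonnegative off a disc about p and
  unbounded at infinity. Infinity is thus treated as exceptional in every case, and only the planar
  part of \<open>D\<close> occurs. The price is a pole of weight 1 + \<beta> at p, the source of the
  slight excess in the comparison with the bump. Testing against bumps of one fixed radius takes the
  place of distributional Laplacians and Green's identity.

  The second obstacle is uniformity. The bound on g(z, w) + log|z - w| comes with a constant
  depending on the pole w, and neither joint continuity nor joint measurability of g is available.
  Hence \<open>K\<close> is cut into countably many compact pieces with a common constant, on each
  of which Green and logarithmic energies are comparable. Integrands not known to be measurable are
  only scaled or compared with measurable ones.\<close>

lemma has_real_derivative_along_line:
  fixes u :: "complex \<Rightarrow> real"
  assumes "(u has_derivative U) (at (c + of_real s * d))"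
  shows "((\<lambda>s. u (c + of_real s * d)) has_real_derivative U d) (at s)"
proof -
  interpret U: linear U
    using assms by (rule has_derivative_linear)
  have "((\<lambda>s. c + of_real s * d) has_derivative (\<lambda>h. of_real h * d)) (at s)"
    by (auto intro!: derivative_eq_intros)
  from has_derivative_compose[OF this assms]
  have "((\<lambda>s. u (c + of_real s * d)) has_derivative (\<lambda>h. U (of_real h * d))) (at s)" .
  moreover have "(\<lambda>h. U (of_real h * d)) = (\<lambda>h. U d * h)"
    using U.scaleR by (auto simp: scaleR_conv_of_real fun_eq_iff)
  ultimately show ?thesis
    by (simp add: has_field_derivative_def)
qed

text \<open>The mean value theorem is applied along \<open>d\<close> to the increment in direction
  \<open>e\<close>, then along \<open>e\<close>. The left-hand side is symmetric in \<open>d\<close>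
  and \<open>e\<close>, which is what forces mixed partial derivatives to agree.\<close>

lemma second_difference_mean_value:
  fixes u p q :: "complex \<Rightarrow> real"
  assumes u: "\<And>z. z \<in> S \<Longrightarrow> \<exists>U. (u has_derivative U) (at z) \<and> U d = p z"
    and p: "\<And>z. z \<in> S \<Longrightarrow> \<exists>P. (p has_derivative P) (at z) \<and> P e = q z"
    and t: "0 < t"
    and S: "\<And>s r. \<lbrakk>0 \<le> s; s \<le> t; 0 \<le> r; r \<le> t\<rbrakk> \<Longrightarrow> a + of_real s * d + of_real r * e \<in> S"
  shows "\<exists>s r. 0 \<le> s \<and> s \<le> t \<and> 0 \<le> r \<and> r \<le> t \<and>
    u (a + of_real t * d + of_real t * e) - u (a + of_real t * d) - u (a + of_real t * e) + u a
      = t * t * q (a + of_real s * d + of_real r * e)"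
proof -
  have der_u: "((\<lambda>s. u (a + of_real r * e + of_real s * d)) has_real_derivative
      p (a + of_real r * e + of_real s * d)) (at s)"
    if "0 \<le> s" "s \<le> t" "0 \<le> r" "r \<le> t" for s r
  proof -
    have "a + of_real s * d + of_real r * e = a + of_real r * e + of_real s * d"
      by simp
    then show ?thesis
      using u[OF S[OF that]] has_real_derivative_along_line by metis
  qed
  have "\<exists>s>0. s < t \<and> (u (a + of_real t * e + of_real t * d) - u (a + of_real 0 * e + of_real t * d))
      - (u (a + of_real t * e + of_real 0 * d) - u (a + of_real 0 * e + of_real 0 * d))
      = (t - 0) * (p (a + of_real t * e + of_real s * d) - p (a + of_real 0 * e + of_real s * d))"
    using t by (intro MVT2 DERIV_diff der_u) auto
  then obtain s where s: "0 < s" "s < t" and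
    1: "(u (a + of_real t * e + of_real t * d) - u (a + of_real t * d))
      - (u (a + of_real t * e) - u a)
      = t * (p (a + of_real s * d + of_real t * e) - p (a + of_real s * d))"
    by (auto simp: ac_simps)
  have der_p: "((\<lambda>r. p (a + of_real s * d + of_real r * e)) has_real_derivative
      q (a + of_real s * d + of_real r * e)) (at r)"
    if "0 \<le> r" "r \<le> t" for r
    using p[OF S[of s r]] s that has_real_derivative_along_line by (metis less_imp_le)
  have "\<exists>r>0. r < t \<and> p (a + of_real s * d + of_real t * e) - p (a + of_real s * d + of_real 0 * e)
      = (t - 0) * q (a + of_real s * d + of_real r * e)"
    using t by (intro MVT2 der_p) auto
  then obtain r where r: "0 < r" "r < t" and
    2: "p (a + of_real s * d + of_real t * e) - p (a + of_real s * d)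
      = t * q (a + of_real s * d + of_real r * e)"
    by auto
  show ?thesis
    using s r 1 unfolding 2 by (intro exI[of _ s] exI[of _ r]) (auto simp: ac_simps)
qed

text \<open>Clairaut's theorem. It is needed because \<open>harmonic_on\<close> provides the two
  mixed partials as separate functions. The second difference over a small square equals
  \<open>t * t\<close> times a value of either of them near \<open>a\<close>.\<close>

lemma mixed_partials_eq:
  fixes u ux uy uxx uxy uyx uyy :: "complex \<Rightarrow> real"
  assumes S: "open S" "a \<in> S"
    and cont: "continuous_on S uxy" "continuous_on S uyx"
    and u: "\<And>z. z \<in> S \<Longrightarrow> (u has_derivative (\<lambda>h. Re h * ux z + Im h * uy z)) (at z)"
    and ux: "\<And>z. z \<in> S \<Longrightarrow> (ux has_derivative (\<lambda>h. Re h * uxx z + Im h * uxy z)) (at z)"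
    and uy: "\<And>z. z \<in> S \<Longrightarrow> (uy has_derivative (\<lambda>h. Re h * uyx z + Im h * uyy z)) (at z)"
  shows "uxy a = uyx a"
proof (rule ccontr)
  assume ne: "uxy a \<noteq> uyx a"
  define \<epsilon> where "\<epsilon> = \<bar>uxy a - uyx a\<bar> / 2"
  have "\<epsilon> > 0"
    using ne by (simp add: \<epsilon>_def)
  obtain r0 where r0: "r0 > 0" "ball a r0 \<subseteq> S"
    using S openE by blast
  have "isCont uxy a" "isCont uyx a"
    using cont S by (auto simp: continuous_on_eq_continuous_at)
  then obtain r1 r2 where r1: "r1 > 0" "\<And>z. dist z a < r1 \<Longrightarrow> dist (uxy z) (uxy a) < \<epsilon>"
    and r2: "r2 > 0" "\<And>z. dist z a < r2 \<Longrightarrow> dist (uyx z) (uyx a) < \<epsilon>"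
    using \<open>\<epsilon> > 0\<close> unfolding continuous_at_eps_delta by metis
  \<comment> \<open>The mean value points differ from \<open>a\<close> by at most
    \<open>2 * t\<close>, so a third of the smallest radius keeps them strictly inside all three
    neighbourhoods.\<close>
  define t where "t = Min {r0, r1, r2} / 3"
  have t: "t > 0" "3 * t \<le> r0" "3 * t \<le> r1" "3 * t \<le> r2"
    using r0 r1 r2 by (auto simp: t_def)
  have near: "dist (a + (of_real s * d + of_real r * e)) a < 3 * t"
    if "0 \<le> s" "s \<le> t" "0 \<le> r" "r \<le> t" "cmod d = 1" "cmod e = 1" for s r d e
  proof -
    have "cmod (of_real s * d + of_real r * e) \<le> s + r"
      using norm_triangle_ineq[of "of_real s * d" "of_real r * e"] that by (simp add: norm_mult)
    then show ?thesis
      using that t by (simp add: dist_norm)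
  qed
  have inS: "a + (of_real s * d + of_real r * e) \<in> S"
    if "0 \<le> s" "s \<le> t" "0 \<le> r" "r \<le> t" "cmod d = 1" "cmod e = 1" for s r d e
    using near[OF that] r0(2) t(2) by (auto simp: dist_commute)
  obtain s r where sr: "0 \<le> s" "s \<le> t" "0 \<le> r" "r \<le> t" and
    1: "u (a + of_real t * 1 + of_real t * \<i>) - u (a + of_real t * 1) - u (a + of_real t * \<i>) + u a
      = t * t * uxy (a + of_real s * 1 + of_real r * \<i>)"
  proof (atomize_elim, rule second_difference_mean_value[of S u 1 ux \<i> uxy t a])
    show "\<exists>U. (u has_derivative U) (at z) \<and> U 1 = ux z" if "z \<in> S" for z
      using u[OF that] by (intro exI[of _ "\<lambda>h. Re h * ux z + Im h * uy z"]) auto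
    show "\<exists>P. (ux has_derivative P) (at z) \<and> P \<i> = uxy z" if "z \<in> S" for z
      using ux[OF that] by (intro exI[of _ "\<lambda>h. Re h * uxx z + Im h * uxy z"]) auto
  qed (use t(1) inS[of _ _ 1 \<i>] in \<open>auto simp: add.assoc\<close>)
  obtain s' r' where sr': "0 \<le> s'" "s' \<le> t" "0 \<le> r'" "r' \<le> t" and
    2: "u (a + of_real t * \<i> + of_real t * 1) - u (a + of_real t * \<i>) - u (a + of_real t * 1) + u a
      = t * t * uyx (a + of_real s' * \<i> + of_real r' * 1)"
  proof (atomize_elim, rule second_difference_mean_value[of S u \<i> uy 1 uyx t a])
    show "\<exists>U. (u has_derivative U) (at z) \<and> U \<i> = uy z" if "z \<in> S" for z
      using u[OF that] by (intro exI[of _ "\<lambda>h. Re h * ux z + Im h * uy z"]) auto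
    show "\<exists>P. (uy has_derivative P) (at z) \<and> P 1 = uyx z" if "z \<in> S" for z
      using uy[OF that] by (intro exI[of _ "\<lambda>h. Re h * uyx z + Im h * uyy z"]) auto
  qed (use t(1) inS[of _ _ \<i> 1] in \<open>auto simp: add.assoc\<close>)
  have eq: "t * t * uxy (a + of_real s * 1 + of_real r * \<i>) = t * t * uyx (a + of_real s' * \<i> + of_real r' * 1)"
  proof -
    have "a + of_real t * \<i> + of_real t * 1 = a + of_real t * 1 + of_real t * \<i>"
      by simp
    from 1 2[unfolded this] show ?thesis
      by linarith
  qed
  have "uxy (a + (of_real s * 1 + of_real r * \<i>)) = uyx (a + (of_real s' * \<i> + of_real r' * 1))"
    using t(1) eq unfolding mult.assoc[of t] by (simp add: add.assoc)
  moreover have "dist (uxy (a + (of_real s * 1 + of_real r * \<i>))) (uxy a) < \<epsilon>"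
    using near[OF sr, of 1 \<i>] t by (intro r1) simp
  moreover have "dist (uyx (a + (of_real s' * \<i> + of_real r' * 1))) (uyx a) < \<epsilon>"
    using near[OF sr', of \<i> 1] t by (intro r2) simp
  ultimately show False
    unfolding \<epsilon>_def dist_real_def by (smt (verit) field_sum_of_halves)
qed

text \<open>\<open>f\<close> is the complex gradient ux - i uy. Unlike a harmonic conjugate it is
  single-valued on every open set, and it brings in the theory of holomorphic functions: on convex
  sets \<open>H\<close> is the real part of a primitive of \<open>f\<close>.\<close>

definition harmonic_grad :: "(complex \<Rightarrow> real) \<Rightarrow> (complex \<Rightarrow> complex) \<Rightarrow> complex set \<Rightarrow> bool" where
  "harmonic_grad H f S \<longleftrightarrow>
     f holomorphic_on S \<and> (\<forall>z\<in>S. (H has_derivative (\<lambda>h. Re (f z * h))) (at z))"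

text \<open>The Cauchy-Riemann equations for ux - i uy are the vanishing of the Laplacian and the
  equality of the mixed partials.\<close>

lemma harmonic_on_imp_harmonic_grad:
  assumes "harmonic_on u S"
  shows "\<exists>f. harmonic_grad u f S"
proof -
  obtain ux uy uxx uxy uyx uyy where S: "open S"
    and cont: "continuous_on S uxy" "continuous_on S uyx"
    and d: "\<And>z. z \<in> S \<Longrightarrow> (u has_derivative (\<lambda>h. Re h * ux z + Im h * uy z)) (at z)"
       "\<And>z. z \<in> S \<Longrightarrow> (ux has_derivative (\<lambda>h. Re h * uxx z + Im h * uxy z)) (at z)"
       "\<And>z. z \<in> S \<Longrightarrow> (uy has_derivative (\<lambda>h. Re h * uyx z + Im h * uyy z)) (at z)"
       "\<And>z. z \<in> S \<Longrightarrow> uxx z + uyy z = 0"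
    using assms unfolding harmonic_on_def by blast
  define f where "f z = Complex (ux z) (- uy z)" for z
  have "(f has_field_derivative Complex (uxx z) (- uyx z)) (at z)" if z: "z \<in> S" for z
  proof -
    have "uxy z = uyx z" and [simp]: "uyy z = - uxx z"
      using mixed_partials_eq[OF S z cont d(1-3)] d(4)[OF z] by auto
    then have "(\<lambda>h. Complex (uxx z) (- uyx z) * h) =
        (\<lambda>h. of_real (Re h * uxx z + Im h * uxy z) - \<i> * of_real (Re h * uyx z + Im h * uyy z))"
      by (auto simp: complex_eq_iff fun_eq_iff algebra_simps)
    moreover have "f = (\<lambda>z. of_real (ux z) - \<i> * of_real (uy z))"
      by (auto simp: f_def complex_eq_iff)
    ultimately show ?thesis
      using d(2,3)[OF z] unfolding has_field_derivative_def
      by (auto intro!: derivative_eq_intros)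
  qed
  then have "f holomorphic_on S"
    using S by (subst holomorphic_on_open) auto
  moreover have "(\<lambda>h. Re (f z * h)) = (\<lambda>h. Re h * ux z + Im h * uy z)" for z
    by (auto simp: f_def)
  ultimately have "harmonic_grad u f S"
    using d(1) by (simp add: harmonic_grad_def)
  then show ?thesis
    by blast
qed

lemma harmonic_grad_subset: "harmonic_grad H f S \<Longrightarrow> T \<subseteq> S \<Longrightarrow> harmonic_grad H f T"
  by (auto simp: harmonic_grad_def intro: holomorphic_on_subset)

lemma harmonic_grad_continuous_on: "harmonic_grad H f S \<Longrightarrow> continuous_on S H"
  unfolding harmonic_grad_def
  by (meson continuous_at_imp_continuous_on has_derivative_continuous)

lemma harmonic_grad_const: "harmonic_grad (\<lambda>_. c) (\<lambda>_. 0) S"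
  by (auto simp: harmonic_grad_def)

lemma harmonic_grad_add:
  "harmonic_grad H f S \<Longrightarrow> harmonic_grad H' f' S \<Longrightarrow>
   harmonic_grad (\<lambda>z. H z + H' z) (\<lambda>z. f z + f' z) S"
  unfolding harmonic_grad_def distrib_right plus_complex.sel
  by (intro conjI ballI holomorphic_on_add has_derivative_add) auto

lemma Re_times_of_real: "Re (of_real c * z) = c * Re z"
  by simp

lemma harmonic_grad_cmult:
  "harmonic_grad H f S \<Longrightarrow> harmonic_grad (\<lambda>z. c * H z) (\<lambda>z. of_real c * f z) S"
  unfolding harmonic_grad_def mult.assoc Re_times_of_real
  by (intro conjI ballI holomorphic_on_mult holomorphic_on_const has_derivative_mult_right) auto

lemma harmonic_grad_sum:
  assumes "finite I" "\<And>i. i \<in> I \<Longrightarrow> harmonic_grad (H i) (f i) S"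
  shows "harmonic_grad (\<lambda>z. \<Sum>i\<in>I. H i z) (\<lambda>z. \<Sum>i\<in>I. f i z) S"
  using assms by (induction rule: finite_induct) (auto intro: harmonic_grad_const harmonic_grad_add)

lemma harmonic_grad_Re:
  assumes "open S" "F holomorphic_on S"
  shows "harmonic_grad (\<lambda>z. Re (F z)) (deriv F) S"
  unfolding harmonic_grad_def
proof (intro conjI ballI)
  show "deriv F holomorphic_on S"
    using assms by (intro holomorphic_deriv)
  fix z assume "z \<in> S"
  then have "(F has_field_derivative deriv F z) (at z)"
    using assms by (intro holomorphic_derivI)
  then have "(F has_derivative (\<lambda>h. deriv F z * h)) (at z)"
    by (simp add: has_field_derivative_def)
  then show "((\<lambda>z. Re (F z)) has_derivative (\<lambda>h. Re (deriv F z * h))) (at z)"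
    by (rule has_derivative_Re)
qed

text \<open>Differentiating the norm directly avoids a branch of the logarithm, which need not exist
  when \<open>S\<close> surrounds \<open>e\<close>.\<close>

lemma harmonic_grad_ln_norm:
  assumes "e \<notin> S"
  shows "harmonic_grad (\<lambda>z. ln (cmod (z - e))) (\<lambda>z. 1 / (z - e)) S"
  unfolding harmonic_grad_def
proof (intro conjI ballI)
  show "(\<lambda>z. 1 / (z - e)) holomorphic_on S"
    using assms by (auto intro!: holomorphic_intros)
  fix z assume "z \<in> S"
  then have ne: "z - e \<noteq> 0"
    using assms by auto
  have "((\<lambda>z. ln (cmod (z - e))) has_derivative
     (\<lambda>h. (z - e) \<bullet> h / cmod (z - e) / cmod (z - e))) (at z)"
  proof -
    have "((\<lambda>z. cmod (z - e)) has_derivative (\<lambda>h. h \<bullet> sgn (z - e))) (at z)"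
      using ne by (intro has_derivative_compose[OF _ has_derivative_norm, of "\<lambda>z. z - e", simplified])
        (auto intro!: derivative_eq_intros)
    then show ?thesis
      using ne by (auto intro!: derivative_eq_intros simp: sgn_div_norm inner_commute divide_simps)
  qed
  moreover have "(\<lambda>h. (z - e) \<bullet> h / cmod (z - e) / cmod (z - e)) = (\<lambda>h. Re (1 / (z - e) * h))"
  proof
    fix h
    have "Re (1 / (z - e) * h) = Re (h / (z - e))"
      by simp
    also have "\<dots> = (Re h * Re (z - e) + Im h * Im (z - e)) / (cmod (z - e))\<^sup>2"
      unfolding Re_divide cmod_power2 ..
    also have "\<dots> = (z - e) \<bullet> h / (cmod (z - e))\<^sup>2"
      unfolding inner_complex_def by (simp only: mult.commute)
    finally show "(z - e) \<bullet> h / cmod (z - e) / cmod (z - e) = Re (1 / (z - e) * h)"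
      by (simp add: power2_eq_square)
  qed
  ultimately show "((\<lambda>z. ln (cmod (z - e))) has_derivative (\<lambda>h. Re (1 / (z - e) * h))) (at z)"
    by simp
qed

lemma harmonic_grad_zero_imp_const:
  assumes "harmonic_grad H f S" "open S" "connected S" "\<And>z. z \<in> S \<Longrightarrow> f z = 0"
  shows "\<exists>c. \<forall>z\<in>S. H z = c"
proof -
  have "(H has_derivative (\<lambda>h. 0)) (at z)" if "z \<in> S" for z
    using assms(1,4) that by (auto simp: harmonic_grad_def)
  then have "\<exists>c. \<forall>z\<in>S. H z = c"
    using has_derivative_zero_unique_connected[OF assms(2,3)] by metis
  then show ?thesis .
qed

text \<open>If \<open>F\<close> is a primitive of \<open>f\<close>, then H - Re F has zero gradient
  and is a constant, which can be absorbed into \<open>F\<close>.\<close>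

lemma harmonic_grad_convex_Re:
  assumes H: "harmonic_grad H f S" and S: "open S" "convex S"
  obtains F where "\<And>z. z \<in> S \<Longrightarrow> (F has_field_derivative f z) (at z)" "\<And>z. z \<in> S \<Longrightarrow> H z = Re (F z)"
proof -
  have "f holomorphic_on S"
    using H by (simp add: harmonic_grad_def)
  then obtain F where F: "\<And>z. z \<in> S \<Longrightarrow> (F has_field_derivative f z) (at z within S)"
    using holomorphic_convex_primitive'[OF S(2,1)] by metis
  then have F': "\<And>z. z \<in> S \<Longrightarrow> (F has_field_derivative f z) (at z)"
    using S(1) by (metis at_within_open)
  then have "F holomorphic_on S"
    using S(1) by (subst holomorphic_on_open) auto
  then have "harmonic_grad (\<lambda>z. H z + (-1) * Re (F z)) (\<lambda>z. f z + of_real (-1) * deriv F z) S"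
    using H S(1) by (intro harmonic_grad_add harmonic_grad_cmult harmonic_grad_Re)
  moreover have "f z + of_real (-1) * deriv F z = 0" if "z \<in> S" for z
    using F'[OF that] by (simp add: DERIV_imp_deriv)
  ultimately have "\<exists>c. \<forall>z\<in>S. H z + (-1) * Re (F z) = c"
    by (rule harmonic_grad_zero_imp_const[OF _ S(1) convex_connected[OF S(2)]])
  then obtain c where c: "\<And>z. z \<in> S \<Longrightarrow> H z + (-1) * Re (F z) = c"
    by blast
  show ?thesis
  proof (rule that[of "\<lambda>z. F z + of_real c"])
    show "((\<lambda>z. F z + of_real c) has_field_derivative f z) (at z)" if "z \<in> S" for z
      using F'[OF that] by (auto intro!: derivative_eq_intros)
    show "H z = Re (F z + of_real c)" if "z \<in> S" for z
      using c[OF that] by simp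
  qed
qed

lemma harmonic_grad_transform:
  "harmonic_grad H f S \<Longrightarrow> (\<And>z. z \<in> S \<Longrightarrow> f z = f' z) \<Longrightarrow> harmonic_grad H f' S"
  unfolding harmonic_grad_def by (auto intro: holomorphic_transform)

lemma harmonic_grad_compose:
  assumes H: "harmonic_grad H f S" and T: "open T"
    and \<phi>: "\<And>z. z \<in> T \<Longrightarrow> (\<phi> has_field_derivative \<phi>' z) (at z)" "\<And>z. z \<in> T \<Longrightarrow> \<phi> z \<in> S"
  shows "harmonic_grad (\<lambda>z. H (\<phi> z)) (\<lambda>z. f (\<phi> z) * \<phi>' z) T"
  unfolding harmonic_grad_def
proof (intro conjI ballI)
  have hol: "\<phi> holomorphic_on T"
    using \<phi>(1) T by (subst holomorphic_on_open) blast+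
  then have "deriv \<phi> holomorphic_on T"
    using T by (intro holomorphic_deriv)
  then have "\<phi>' holomorphic_on T"
    by (rule holomorphic_transform) (simp add: \<phi>(1) DERIV_imp_deriv)
  moreover have "(f \<circ> \<phi>) holomorphic_on T"
    using H \<phi>(2) by (intro holomorphic_on_compose_gen[OF hol]) (auto simp: harmonic_grad_def)
  ultimately show "(\<lambda>z. f (\<phi> z) * \<phi>' z) holomorphic_on T"
    unfolding o_def by (intro holomorphic_on_mult)
  fix z assume z: "z \<in> T"
  have "(\<phi> has_derivative (\<lambda>h. \<phi>' z * h)) (at z)"
    using \<phi>(1)[OF z] by (simp add: has_field_derivative_def)
  moreover have "(H has_derivative (\<lambda>h. Re (f (\<phi> z) * h))) (at (\<phi> z))"
    using H \<phi>(2)[OF z] by (simp add: harmonic_grad_def)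
  ultimately show "((\<lambda>z. H (\<phi> z)) has_derivative (\<lambda>h. Re (f (\<phi> z) * \<phi>' z * h))) (at z)"
    using has_derivative_compose by (fastforce simp: mult.assoc)
qed

text \<open>Cauchy's inequality is applied to exp F with H = Re F: its modulus exp H is controlled
  by \<open>H\<close> alone, so no bound on the conjugate is needed. Radius \<open>t / 2\<close>
  gives the factor \<open>2 / t\<close>; the upper and lower bounds of exp H give the two factors
  \<open>exp B\<close>.\<close>

lemma harmonic_grad_bound:
  assumes H: "harmonic_grad H f (ball z t)" and t: "t > 0"
    and B: "\<And>w. w \<in> ball z t \<Longrightarrow> \<bar>H w\<bar> \<le> B"
  shows "cmod (f z) \<le> 2 * exp (2 * B) / t"
proof -
  obtain F where F: "\<And>w. w \<in> ball z t \<Longrightarrow> (F has_field_derivative f w) (at w)"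
    "\<And>w. w \<in> ball z t \<Longrightarrow> H w = Re (F w)"
    using harmonic_grad_convex_Re[OF H open_ball convex_ball] by metis
  have der: "((\<lambda>w. exp (F w)) has_field_derivative exp (F w) * f w) (at w)" if "w \<in> ball z t" for w
    using F(1)[OF that] by (auto intro!: derivative_eq_intros)
  have hol: "(\<lambda>w. exp (F w)) holomorphic_on ball z t"
    using der by (subst holomorphic_on_open) blast+
  have "cmod ((deriv ^^ 1) (\<lambda>w. exp (F w)) z) \<le> fact 1 * exp B / (t / 2) ^ 1"
  proof (rule Cauchy_inequality)
    show "(\<lambda>w. exp (F w)) holomorphic_on ball z (t / 2)"
      using t by (intro holomorphic_on_subset[OF hol]) auto
    show "continuous_on (cball z (t / 2)) (\<lambda>w. exp (F w))"
      using t by (intro continuous_on_subset[OF holomorphic_on_imp_continuous_on[OF hol]]) auto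
    fix w assume "cmod (z - w) = t / 2"
    then have "w \<in> ball z t"
      using t by (simp add: dist_norm)
    then show "cmod (exp (F w)) \<le> exp B"
      using B[of w] F(2)[of w] by (simp add: abs_le_iff)
  qed (use t in auto)
  moreover have zb: "z \<in> ball z t"
    using t by simp
  ultimately have "exp (Re (F z)) * cmod (f z) \<le> exp B * 2 / t"
    using DERIV_imp_deriv[OF der[OF zb]] by (simp add: norm_mult)
  moreover have "exp (- B) * cmod (f z) \<le> exp (Re (F z)) * cmod (f z)"
    using B[OF zb] F(2)[OF zb] by (intro mult_right_mono) auto
  ultimately have "exp B * (exp (- B) * cmod (f z)) \<le> exp B * (exp B * 2 / t)"
    by (intro mult_left_mono) auto
  then show ?thesis
    by (simp add: mult.assoc[symmetric] exp_add[symmetric] mult.commute)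
qed

text \<open>The gradient bound leaves \<open>f\<close> with at most a simple pole, of residue
  \<open>a\<close> say. Near \<open>p\<close>, \<open>H\<close> then differs from a harmonic
  function by the real part of a log(z - p). Single-valuedness of \<open>H\<close> forces Im a = 0,
  and boundedness forces Re a = 0.\<close>

lemma harmonic_grad_removable_singularity:
  assumes H: "harmonic_grad H f (S - {p})" and S: "open S" "p \<in> S"
    and bdd: "\<forall>\<^sub>F z in at p. \<bar>H z\<bar> \<le> B"
  shows "\<exists>H' f'. harmonic_grad H' f' S \<and> (\<forall>z\<in>S - {p}. H' z = H z)"
proof -
  obtain R where R: "R > 0" "ball p R \<subseteq> S" and RB: "\<And>z. z \<in> ball p R - {p} \<Longrightarrow> \<bar>H z\<bar> \<le> B"
  proof -
    obtain d where "d > 0" "\<And>z. z \<noteq> p \<Longrightarrow> dist z p < d \<Longrightarrow> \<bar>H z\<bar> \<le> B"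
      using bdd unfolding eventually_at by auto
    moreover obtain r where "r > 0" "ball p r \<subseteq> S"
      using S openE by blast
    ultimately show ?thesis
      by (intro that[of "min d r"]) (auto simp: dist_commute)
  qed
  have fhol: "f holomorphic_on S - {p}"
    using H by (simp add: harmonic_grad_def)
  \<comment> \<open>The disc about \<open>z\<close> of radius |z - p| just misses \<open>p\<close>,
    so the gradient bound there is a multiple of 1 / |z - p|.\<close>
  have "cmod ((z - p) * f z) \<le> 2 * exp (2 * B)" if z: "z \<in> ball p (R/2) - {p}" for z
  proof -
    have sub: "ball z (cmod (z - p)) \<subseteq> ball p R - {p}"
    proof
      fix w assume w: "w \<in> ball z (cmod (z - p))"
      then have "dist p w < R"
        using dist_triangle[of p w z] z by (simp add: dist_norm norm_minus_commute)
      then show "w \<in> ball p R - {p}"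
        using w by (auto simp: dist_norm)
    qed
    have "\<bar>H w\<bar> \<le> B" if "w \<in> ball z (cmod (z - p))" for w
      using RB sub that by blast
    then have "cmod (f z) \<le> 2 * exp (2 * B) / cmod (z - p)"
      using z sub R by (intro harmonic_grad_bound[where H=H and f=f] harmonic_grad_subset[OF H]) auto
    then show ?thesis
      using z unfolding norm_mult by (subst mult.commute) (simp add: pos_le_divide_eq)
  qed
  then have "\<forall>\<^sub>F z in at p. cmod ((z - p) * f z) \<le> 2 * exp (2 * B)"
    using R unfolding eventually_at by (intro exI[of _ "R/2"]) (auto simp: dist_commute)
  moreover have "(\<lambda>z. (z - p) * f z) holomorphic_on S - {p}"
    using fhol by (intro holomorphic_intros)
  ultimately obtain G where G: "G holomorphic_on S" "\<And>z. z \<in> S - {p} \<Longrightarrow> G z = (z - p) * f z"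
    using holomorphic_on_extend_bounded[of "\<lambda>z. (z - p) * f z" S p] S
    by (metis interior_open)
  define a where "a = G p"
  \<comment> \<open>\<open>f\<close> without its polar part. The value at \<open>p\<close> is the
    one that makes the quotient of G - G p by z - p holomorphic.\<close>
  define k where "k z = (if z = p then deriv G p else f z - a / (z - p))" for z
  have khol: "k holomorphic_on S"
    unfolding k_def[abs_def] a_def using G(2) by (intro pole_theorem_open[OF G(1) S(1)]) auto
  obtain K where K: "\<And>z. z \<in> ball p R \<Longrightarrow> (K has_field_derivative k z) (at z)"
    using holomorphic_convex_primitive'[OF convex_ball open_ball holomorphic_on_subset[OF khol R(2)]]
    by (metis at_within_open open_ball)
  have Khol: "K holomorphic_on ball p R"
    using K by (subst holomorphic_on_open) blast+
  \<comment> \<open>The half plane covers the punctured disc by p + exp, and there log(z - p)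
    becomes the coordinate itself.\<close>
  define T where "T = {\<zeta>. Re \<zeta> < ln R}"
  have T: "open T" "convex T"
    using open_halfspace_Re_lt convex_halfspace_Re_lt by (auto simp: T_def)
  have expT: "p + exp \<zeta> \<in> ball p R - {p}" if "\<zeta> \<in> T" for \<zeta>
    using that R by (simp add: T_def dist_norm ln_less_cancel_iff[symmetric] del: ln_less_cancel_iff)
  have dexp: "((\<lambda>\<zeta>. p + exp \<zeta>) has_field_derivative exp \<zeta>) (at \<zeta>)" for \<zeta>
    by (auto intro!: derivative_eq_intros)
  have hK: "harmonic_grad (\<lambda>z. Re (K z)) k (ball p R)"
    by (rule harmonic_grad_transform[OF harmonic_grad_Re[OF open_ball Khol]])
      (use K in \<open>simp add: DERIV_imp_deriv\<close>)
  define Q where "Q \<zeta> = (H (p + exp \<zeta>) + (-1) * Re (K (p + exp \<zeta>))) + (-1) * Re (a * \<zeta>)" for \<zeta>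
  have "harmonic_grad (\<lambda>\<zeta>. Re (a * \<zeta>)) (deriv (\<lambda>\<zeta>. a * \<zeta>)) T"
    by (intro harmonic_grad_Re T holomorphic_intros)
  moreover have "deriv (\<lambda>\<zeta>. a * \<zeta>) = (\<lambda>_. a)"
    by (auto intro!: DERIV_imp_deriv derivative_eq_intros)
  ultimately have "harmonic_grad (\<lambda>\<zeta>. Re (a * \<zeta>)) (\<lambda>_. a) T"
    by simp
  then have hQ: "harmonic_grad Q (\<lambda>\<zeta>. (f (p + exp \<zeta>) * exp \<zeta> + of_real (-1) * (k (p + exp \<zeta>) * exp \<zeta>))
      + of_real (-1) * a) T"
    unfolding Q_def using expT R
    by (intro harmonic_grad_add harmonic_grad_cmult harmonic_grad_compose[OF H T(1)]
        harmonic_grad_compose[OF hK T(1)] dexp) auto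
  have "\<exists>c. \<forall>\<zeta>\<in>T. Q \<zeta> = c"
    by (rule harmonic_grad_zero_imp_const[OF hQ T(1) convex_connected[OF T(2)]])
      (simp add: k_def field_simps)
  then obtain c where c: "\<And>\<zeta>. \<zeta> \<in> T \<Longrightarrow> Q \<zeta> = c"
    by blast
  have "Im a = 0"
  proof -
    \<comment> \<open>A point and its translate by 2 \<pi> i have the same image in the punctured
      disc; comparing \<open>Q\<close> at both leaves 2 \<pi> Im a = 0.\<close>
    define \<zeta> where "\<zeta> = of_real (ln R - 1) + of_real (2 * pi) * \<i>"
    have "\<zeta> \<in> T" "of_real (ln R - 1) \<in> T"
      by (auto simp: T_def \<zeta>_def)
    moreover have "exp \<zeta> = exp (of_real (ln R - 1))"
      unfolding \<zeta>_def exp_add by (simp add: exp_two_pi_i[unfolded mult.assoc] mult.assoc)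
    ultimately have "Re (a * \<zeta>) = Re (a * of_real (ln R - 1))"
      using c[of \<zeta>] c[of "of_real (ln R - 1)"] unfolding Q_def by simp
    then show ?thesis
      by (simp add: \<zeta>_def)
  qed
  moreover have "Re a = 0"
  proof (rule ccontr)
    assume "Re a \<noteq> 0"
    have "compact (K ` cball p (R/2))"
      using R by (intro compact_continuous_image
          continuous_on_subset[OF holomorphic_on_imp_continuous_on[OF Khol]]) auto
    then obtain C where C: "\<And>z. z \<in> cball p (R/2) \<Longrightarrow> cmod (K z) \<le> C"
      by (meson bounded_iff compact_imp_bounded image_eqI)
    \<comment> \<open>As \<open>x\<close> tends to minus infinity every other term of
      \<open>Q\<close> stays bounded, so a nonzero real part of \<open>a\<close> is
      impossible.\<close>
    have "\<bar>Re a * x\<bar> \<le> B + C + \<bar>c\<bar>" if x: "x \<le> ln (R/2)" for x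
    proof -
      have "exp x \<le> R / 2"
        using x R by (metis exp_le_cancel_iff exp_ln half_gt_zero)
      then have "p + exp (of_real x) \<in> cball p (R/2)" and xT: "of_real x \<in> T"
        using x R by (auto simp: dist_norm T_def ln_div intro: le_less_trans)
      then have "\<bar>Re (K (p + exp (of_real x)))\<bar> \<le> C"
        using C abs_Re_le_cmod order_trans by blast
      moreover have "\<bar>H (p + exp (of_real x))\<bar> \<le> B"
        using RB expT[OF xT] by blast
      ultimately show ?thesis
        using c[OF xT] unfolding Q_def by simp
    qed
    note * = this
    define y where "y = (B + C + \<bar>c\<bar> + 1) / \<bar>Re a\<bar> + \<bar>ln (R/2)\<bar>"
    have "(B + C + \<bar>c\<bar> + 1) / \<bar>Re a\<bar> \<ge> 0"
      using *[of "ln (R/2)"] abs_ge_zero[of "Re a * ln (R/2)"] by (intro divide_nonneg_nonneg) linarith+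
    then have "\<bar>Re a * (- y)\<bar> \<le> B + C + \<bar>c\<bar>"
      unfolding y_def by (intro *) linarith
    moreover have "\<bar>Re a\<bar> * y \<ge> B + C + \<bar>c\<bar> + 1"
      using \<open>Re a \<noteq> 0\<close> unfolding y_def by (subst distrib_left) simp
    moreover have "\<bar>Re a * (- y)\<bar> \<ge> \<bar>Re a\<bar> * y"
      by (simp add: abs_mult mult_left_mono)
    ultimately show False
      by linarith
  qed
  ultimately have [simp]: "a = 0"
    by (simp add: complex_eq_iff)
  have HK: "H z = Re (K z) + c" if z: "z \<in> ball p R - {p}" for z
  proof -
    have "p + exp (Ln (z - p)) = z"
      using z by simp
    moreover have "Ln (z - p) \<in> T"
      using z R by (auto simp: T_def dist_norm norm_minus_commute)
    ultimately show ?thesis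
      using c[of "Ln (z - p)"] unfolding Q_def by simp
  qed
  define H' where "H' z = (if z = p then Re (K p) + c else H z)" for z
  have "harmonic_grad H' k S"
    unfolding harmonic_grad_def
  proof (intro conjI ballI)
    fix z assume z: "z \<in> S"
    show "(H' has_derivative (\<lambda>h. Re (k z * h))) (at z)"
    proof (cases "z = p")
      case True
      have "harmonic_grad (\<lambda>z. Re (K z) + c) (\<lambda>z. k z + 0) (ball p R)"
        by (intro harmonic_grad_add hK harmonic_grad_const)
      then have "((\<lambda>z. Re (K z) + c) has_derivative (\<lambda>h. Re (k p * h))) (at p)"
        using R by (simp add: harmonic_grad_def)
      then have "(H' has_derivative (\<lambda>h. Re (k p * h))) (at p)"
        by (rule has_derivative_transform_within_open[OF _ open_ball[of p R]])
          (use R HK in \<open>auto simp: H'_def\<close>)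
      then show ?thesis
        using True by simp
    next
      case False
      then have "(H has_derivative (\<lambda>h. Re (k z * h))) (at z)"
        using H z by (simp add: harmonic_grad_def k_def)
      then show ?thesis
        by (rule has_derivative_transform_within_open[OF _ open_delete[OF S(1), of p]])
          (use z False in \<open>auto simp: H'_def\<close>)
    qed
  qed (rule khol)
  then show ?thesis
    by (intro exI[of _ H'] exI[of _ k]) (simp add: H'_def)
qed

text \<open>The real part of Cauchy's integral formula for \<open>F\<close> with H = Re F. The
  closed disc is first enlarged to an open one inside \<open>S\<close>, so that such an
  \<open>F\<close> exists up to the boundary circle.\<close>

lemma harmonic_grad_mean_value:
  assumes H: "harmonic_grad H f S" and S: "open S" "cball z r \<subseteq> S" and r: "r > 0"
  shows "((\<lambda>t. H (z + of_real r * cis (2 * pi * t))) has_integral H z) {0..1}"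
proof -
  obtain e where e: "e > 0" "(\<Union>x\<in>cball z r. ball x e) \<subseteq> S"
    using compact_subset_open_imp_ball_epsilon_subset[OF compact_cball S] by blast
  \<comment> \<open>A point \<open>w\<close> outside the closed disc is at distance |w - z| - r < e
    from its radial projection \<open>x\<close> on the circle.\<close>
  have ball: "ball z (r + e) \<subseteq> S"
  proof
    fix w assume w: "w \<in> ball z (r + e)"
    show "w \<in> S"
    proof (cases "w \<in> cball z r")
      case True
      with S show ?thesis by auto
    next
      case False
      define x where "x = z + of_real (r / cmod (w - z)) * (w - z)"
      have n: "cmod (w - z) > r" "cmod (w - z) < r + e"
        using False w by (auto simp: dist_norm norm_minus_commute)
      then have "x \<in> cball z r"
        using r by (simp add: x_def dist_norm norm_mult norm_divide)
      have "x - w = of_real (r / cmod (w - z) - 1) * (w - z)"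
        by (simp add: x_def algebra_simps)
      then have "cmod (x - w) = \<bar>r / cmod (w - z) - 1\<bar> * cmod (w - z)"
        by (simp only: norm_mult norm_of_real)
      moreover have "\<bar>r / cmod (w - z) - 1\<bar> = 1 - r / cmod (w - z)"
        using n r by (subst abs_of_neg) (auto simp: divide_less_eq)
      ultimately have "cmod (x - w) = cmod (w - z) - r"
        using n r by (cases "w = z") (auto simp: left_diff_distrib)
      with \<open>x \<in> cball z r\<close> show ?thesis
        using e(2) n by (force simp: dist_norm)
    qed
  qed
  obtain F where F: "\<And>w. w \<in> ball z (r + e) \<Longrightarrow> (F has_field_derivative f w) (at w)"
    "\<And>w. w \<in> ball z (r + e) \<Longrightarrow> H w = Re (F w)"
    using harmonic_grad_convex_Re[OF harmonic_grad_subset[OF H ball] open_ball convex_ball] by metis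
  then have "F holomorphic_on ball z (r + e)"
    by (subst holomorphic_on_open) blast+
  then have "F holomorphic_on cball z r"
    by (rule holomorphic_on_subset) (use e in auto)
  then have "((\<lambda>u. F u / (u - z)) has_contour_integral (2 * of_real pi * \<i> * F z)) (circlepath z r)"
    using r by (intro Cauchy_integral_circlepath_simple) auto
  then have "((\<lambda>x. F (circlepath z r x) / (circlepath z r x - z) * vector_derivative (circlepath z r) (at x))
      has_integral 2 * of_real pi * \<i> * F z) {0..1}"
    by (simp add: has_contour_integral)
  moreover have "circlepath z r x = z + of_real r * cis (2 * pi * x)" for x
    by (simp add: circlepath cis_conv_exp mult_ac)
  moreover have "vector_derivative (circlepath z r) (at x) = 2 * of_real pi * \<i> * (of_real r * cis (2 * pi * x))" for x
    by (simp add: vector_derivative_circlepath cis_conv_exp mult_ac)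
  ultimately have "((\<lambda>x. F (z + of_real r * cis (2 * pi * x)) * (2 * of_real pi * \<i>)) has_integral
      F z * (2 * of_real pi * \<i>)) {0..1}"
    using r by (simp add: mult_ac)
  from has_integral_divide[OF this, of "2 * of_real pi * \<i>"]
  have "((\<lambda>x. F (z + of_real r * cis (2 * pi * x))) has_integral F z) {0..1}"
    by simp
  then have "((\<lambda>x. Re (F (z + of_real r * cis (2 * pi * x)))) has_integral Re (F z)) {0..1}"
    by (rule has_integral_Re)
  moreover have "H (z + of_real r * cis (2 * pi * x)) = Re (F (z + of_real r * cis (2 * pi * x)))" for x
    using F(2) e r by (simp add: dist_norm norm_mult)
  ultimately show ?thesis
    using F(2)[of z] e r by simp
qed

text \<open>Inside the circle, \<open>\<bar>a + r u\<bar> = \<bar>r + conj a u\<bar>\<close> for \<open>\<bar>u\<bar> = 1\<close>, and the right-hand side has no zero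
  in the closed disc.\<close>

lemma circle_mean_ln_norm:
  assumes r: "r > 0" and a: "a \<noteq> 0" "cmod a \<noteq> r"
  shows "((\<lambda>t. ln (cmod (a + of_real r * cis (2 * pi * t)))) has_integral
    ln (max (cmod a) r)) {0..1}"
proof (cases "cmod a > r")
  case True
  have "((\<lambda>t. ln (cmod (a + of_real r * cis (2 * pi * t) - 0))) has_integral ln (cmod (a - 0))) {0..1}"
    using True r by (intro harmonic_grad_mean_value[OF harmonic_grad_ln_norm, of 0 "- {0}"]) (auto simp: dist_norm)
  then show ?thesis
    using True by (simp add: max_def)
next
  case False
  then have lt: "cmod a < r"
    using a by simp
  define T where "T = ball (0::complex) (r / cmod a)"
  have le1: "r / cmod a > 1"
    using lt a by (simp add: field_simps)
  have ne: "of_real r + cnj a * \<zeta> \<in> - {0}" if "\<zeta> \<in> T" for \<zeta>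
  proof -
    have "cmod (cnj a * \<zeta>) < r"
      using that a by (simp add: T_def norm_mult field_simps)
    then show ?thesis
      using norm_triangle_ineq2[of "of_real r" "- (cnj a * \<zeta>)"] r by auto
  qed
  have "harmonic_grad (\<lambda>\<zeta>. ln (cmod (of_real r + cnj a * \<zeta> - 0)))
      (\<lambda>\<zeta>. 1 / (of_real r + cnj a * \<zeta> - 0) * cnj a) T"
    using ne by (intro harmonic_grad_compose[OF harmonic_grad_ln_norm[of 0 "- {0}"]])
      (auto simp: T_def intro!: derivative_eq_intros)
  then have "((\<lambda>t. ln (cmod (of_real r + cnj a * (0 + of_real 1 * cis (2 * pi * t)) - 0))) has_integral
      ln (cmod (of_real r + cnj a * 0 - 0))) {0..1}"
    using le1 by (intro harmonic_grad_mean_value) (auto simp: T_def)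
  moreover have "cmod (a + of_real r * cis x) = cmod (of_real r + cnj a * cis x)" for x
  proof -
    have "cmod (a + of_real r * cis x) = cmod (cis x * cnj (a + of_real r * cis x))"
      by (simp only: norm_mult complex_mod_cnj norm_cis mult_1)
    also have "cis x * cnj (a + of_real r * cis x) = of_real r * (cis x * cis (- x)) + cnj a * cis x"
      by (simp add: cis_cnj algebra_simps)
    finally show ?thesis
      by (simp add: cis_mult)
  qed
  ultimately show ?thesis
    using lt r by (simp add: max_def)
qed


section \<open>Compact sets of capacity zero\<close>

text \<open>The digits are read off the orbit of \<open>x\<close> under the doubling map; after
  \<open>n\<close> digits the remainder is \<open>y n / 2 ^ n\<close>. The point 1 is kept fixed, so
  it is expanded with all digits 1.\<close>

lemma binary_expansion_exists:
  fixes x :: real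
  assumes "0 \<le> x" "x \<le> 1"
  shows "\<exists>a. (\<forall>k. a k \<in> {0, 1}) \<and> (\<lambda>k. a k / 2 ^ Suc k) sums x"
proof -
  define y where "y = rec_nat x (\<lambda>_ s. if s \<ge> 1/2 then 2 * s - 1 else 2 * s)"
  define a :: "nat \<Rightarrow> real" where "a k = (if y k \<ge> 1/2 then 1 else 0)" for k
  have y: "y 0 = x" "y (Suc k) = 2 * y k - a k" for k
    by (auto simp: y_def a_def)
  have rng: "0 \<le> y k \<and> y k \<le> 1" for k
    by (induction k) (use assms in \<open>auto simp: y a_def\<close>)
  have part: "(\<Sum>k<n. a k / 2 ^ Suc k) = x - y n / 2 ^ n" for n
    by (induction n) (auto simp: y field_simps)
  have "(\<lambda>n. y n / 2 ^ n) \<longlonglongrightarrow> 0"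
  proof (rule real_tendsto_sandwich[of "\<lambda>_. 0" _ _ "\<lambda>n. (1/2) ^ n"])
    show "(\<lambda>n. (1/2) ^ n :: real) \<longlonglongrightarrow> 0"
      by (rule LIMSEQ_power_zero) simp
  qed (use rng in \<open>auto simp: power_divide divide_right_mono\<close>)
  then have "(\<lambda>n. x - y n / 2 ^ n) \<longlonglongrightarrow> x - 0"
    by (intro tendsto_intros)
  then have "(\<lambda>k. a k / 2 ^ Suc k) sums x"
    unfolding sums_def part by simp
  then show ?thesis
    by (intro exI[of _ a]) (auto simp: a_def)
qed

text \<open>Even, of period 2, equal to 0 on [0, 1/3] and to 1 on [2/3, 1]. Clipping the cosine
  yields the exact digit together with continuity.\<close>

definition clipped_cos :: "real \<Rightarrow> real" where
  "clipped_cos x = min 1 (max 0 (1/2 - cos (pi * x)))"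

lemma continuous_on_clipped_cos [continuous_intros]:
  fixes f :: "real \<Rightarrow> real"
  shows "continuous_on S f \<Longrightarrow> continuous_on S (\<lambda>x. clipped_cos (f x))"
  unfolding clipped_cos_def by (intro continuous_intros)

lemma clipped_cos_range: "0 \<le> clipped_cos x" "clipped_cos x \<le> 1"
  by (auto simp: clipped_cos_def)

lemma clipped_cos_add_even: "clipped_cos (2 * of_int m + x) = clipped_cos x"
proof -
  have "cos (pi * (2 * of_int m + x)) = cos (pi * x + 2 * pi * of_int m)"
    by (simp add: algebra_simps)
  also have "\<dots> = cos (pi * x)"
    by (simp add: cos_add mult.assoc[symmetric] del: mult.assoc)
  finally show ?thesis
    by (simp add: clipped_cos_def)
qed

text \<open>2 a / 3 + s is a number in [0, 1] whose leading ternary digit can be taken as 2 a, and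
  the even integer is absorbed by periodicity.\<close>

lemma clipped_cos_eq_digit:
  assumes a: "a \<in> {0, 1}" and s: "0 \<le> s" "s \<le> 1 / 3"
  shows "clipped_cos (2 * of_int m + (2 * a / 3 + s)) = a"
proof -
  have half: "cos (pi * s) \<ge> 1 / 2" if "0 \<le> s" "s \<le> 1 / 3" for s
  proof -
    have "cos (pi / 3) \<le> cos (pi * s)"
      using that pi_gt_zero by (intro cos_monotone_0_pi_le) (auto simp: field_simps)
    then show ?thesis
      by (simp add: cos_60)
  qed
  show ?thesis
  proof (cases "a = 0")
    case True
    then show ?thesis
      using half[OF s] by (subst clipped_cos_add_even) (simp add: clipped_cos_def)
  next
    case False
    then have [simp]: "a = 1"
      using a by simp
    \<comment> \<open>The reflection x to 1 - x changes the sign of the cosine and reduces digit 1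
      to digit 0.\<close>
    have "cos (pi * (2 / 3 + s)) = - cos (pi * (1 / 3 - s))"
      using cos_minus_pi[of "pi * (2 / 3 + s)"] cos_minus[of "pi * (2 / 3 + s) - pi"]
      by (simp add: algebra_simps)
    then show ?thesis
      using half[of "1 / 3 - s"] s by (subst clipped_cos_add_even) (simp add: clipped_cos_def)
  qed
qed

text \<open>\<open>t\<close> is the point of the Cantor set with ternary digits 2 a k.
  Multiplication by \<open>3 ^ k\<close> shifts the expansion; the integer split off is even because
  all digits are even, so \<open>clipped_cos\<close> sees only the tail.\<close>

lemma ternary_point:
  fixes a :: "nat \<Rightarrow> real"
  assumes a: "\<And>k. a k \<in> {0, 1}"
  shows "\<exists>t\<in>{0..1}. \<forall>k. clipped_cos (3 ^ k * t) = a k"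
proof -
  have a01: "0 \<le> a k" "a k \<le> 1" for k
    using a[of k] by auto
  have geo: "(\<lambda>j. 2 / 3 ^ Suc j :: real) sums 1"
    using sums_mult[OF geometric_sums[of "1/3 :: real"], of "2/3"] by (simp add: power_divide)
  define tail where "tail k = (\<Sum>j. 2 * a (j + k) / 3 ^ Suc j)" for k
  have summ: "summable (\<lambda>j. 2 * a (j + k) / 3 ^ Suc j)" for k
    by (rule summable_comparison_test'[OF sums_summable[OF geo]])
      (use a01 in \<open>auto simp: divide_right_mono\<close>)
  have tail: "0 \<le> tail k" "tail k \<le> 1" for k
  proof -
    show "0 \<le> tail k"
      unfolding tail_def using a01 by (intro suminf_nonneg summ) auto
    have "tail k \<le> (\<Sum>j. 2 / 3 ^ Suc j)"
      unfolding tail_def using a01 geo by (intro suminf_le summ) (auto simp: divide_right_mono sums_iff)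
    then show "tail k \<le> 1"
      using geo by (simp add: sums_iff)
  qed
  have rec: "3 * tail k = 2 * a k + tail (Suc k)" for k
  proof -
    have "3 * tail k = (\<Sum>j. 3 * (2 * a (j + k) / 3 ^ Suc j))"
      unfolding tail_def by (rule suminf_mult[OF summ, symmetric])
    also have "\<dots> = (\<Sum>j. 3 * (2 * a (Suc j + k) / 3 ^ Suc (Suc j))) + 2 * a k"
      by (subst suminf_split_head[OF summable_mult[OF summ]]) simp
    finally show ?thesis
      by (simp add: tail_def)
  qed
  have "\<exists>m. 3 ^ k * tail 0 = 2 * of_int m + tail k" for k
  proof (induction k)
    case 0
    show ?case by (intro exI[of _ 0]) simp
  next
    case (Suc k)
    then obtain m where m: "3 ^ k * tail 0 = 2 * of_int m + tail k"
      by blast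
    have "a k = of_int \<lfloor>a k\<rfloor>"
      using a[of k] by auto
    then have "3 ^ Suc k * tail 0 = 2 * of_int (3 * m + \<lfloor>a k\<rfloor>) + tail (Suc k)"
      using m rec[of k] by simp
    then show ?case
      by blast
  qed
  then have "clipped_cos (3 ^ k * tail 0) = a k" for k
  proof -
    obtain m where "3 ^ k * tail 0 = 2 * of_int m + tail k"
      using \<open>\<And>k. \<exists>m. _ k m\<close> by blast
    also have "tail k = 2 * a k / 3 + tail (Suc k) / 3"
      using rec[of k] by simp
    finally show ?thesis
      using clipped_cos_eq_digit[OF a, of "tail (Suc k) / 3" m k] tail[of "Suc k"] by simp
  qed
  then show ?thesis
    using tail by (intro bexI[of _ "tail 0"]) auto
qed

text \<open>Schoenberg's curve, with a clipped cosine reading off the ternary digits.\<close>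

lemma space_filling_curve:
  "\<exists>\<phi> :: real \<Rightarrow> complex. continuous_on UNIV \<phi> \<and>
     (\<forall>z. 0 \<le> Re z \<and> Re z \<le> 1 \<and> 0 \<le> Im z \<and> Im z \<le> 1 \<longrightarrow> z \<in> \<phi> ` {0..1})"
proof -
  define S where "S i t = (\<Sum>k. clipped_cos (3 ^ (2 * k + i) * t) / 2 ^ Suc k)" for i t
  have geo: "(\<lambda>k. 1 / 2 ^ Suc k :: real) sums 1"
    using power_half_series by (simp add: power_divide)
  have cont: "continuous_on UNIV (S i)" for i
  proof (rule uniform_limit_theorem)
    show "uniform_limit UNIV (\<lambda>n t. \<Sum>k<n. clipped_cos (3 ^ (2 * k + i) * t) / 2 ^ Suc k) (S i) sequentially"
      unfolding S_def[abs_def]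
      by (rule Weierstrass_m_test[OF _ sums_summable[OF geo]])
        (auto simp: clipped_cos_range divide_right_mono)
    show "\<forall>\<^sub>F n in sequentially. continuous_on UNIV (\<lambda>t. \<Sum>k<n. clipped_cos (3 ^ (2 * k + i) * t) / 2 ^ Suc k)"
      by (intro always_eventually allI continuous_intros) simp_all
  qed simp
  define \<phi> where "\<phi> t = Complex (S 0 t) (S 1 t)" for t
  have "z \<in> \<phi> ` {0..1}" if z: "0 \<le> Re z" "Re z \<le> 1" "0 \<le> Im z" "Im z \<le> 1" for z
  proof -
    obtain a where a: "\<And>k. a k \<in> {0, 1}" "(\<lambda>k. a k / 2 ^ Suc k) sums Re z"
      using binary_expansion_exists[OF z(1,2)] by blast
    obtain b where b: "\<And>k. b k \<in> {0, 1}" "(\<lambda>k. b k / 2 ^ Suc k) sums Im z"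
      using binary_expansion_exists[OF z(3,4)] by blast
    \<comment> \<open>The binary digits of Re z and Im z are interleaved: \<open>S 0\<close> reads
      the even ternary positions and \<open>S 1\<close> the odd ones.\<close>
    have digits: "(if even k then a (k div 2) else b (k div 2)) \<in> {0, 1}" for k
      using a(1) b(1) by simp
    obtain t where t: "t \<in> {0..1}"
      "\<And>k. clipped_cos (3 ^ k * t) = (if even k then a (k div 2) else b (k div 2))"
      using ternary_point[of "\<lambda>k. if even k then a (k div 2) else b (k div 2)", OF digits] by blast
    have "S 0 t = Re z" "S 1 t = Im z"
      unfolding S_def t(2) using a(2) b(2) by (auto simp: sums_iff)
    then show ?thesis
      using t(1) by (intro image_eqI[of _ _ t]) (auto simp: \<phi>_def)
  qed
  moreover have "continuous_on UNIV \<phi>"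
    unfolding \<phi>_def[abs_def] by (intro continuous_on_Complex cont)
  ultimately show ?thesis
    by blast
qed

lemma compact_subset_curve:
  fixes C :: "complex set"
  assumes "compact C"
  shows "\<exists>\<phi> :: real \<Rightarrow> complex. continuous_on UNIV \<phi> \<and> C \<subseteq> \<phi> ` {0..1}"
proof -
  obtain \<psi> :: "real \<Rightarrow> complex" where \<psi>: "continuous_on UNIV \<psi>"
    "\<And>z. \<lbrakk>0 \<le> Re z; Re z \<le> 1; 0 \<le> Im z; Im z \<le> 1\<rbrakk> \<Longrightarrow> z \<in> \<psi> ` {0..1}"
    using space_filling_curve by blast
  obtain L where L: "L > 0" "\<And>z. z \<in> C \<Longrightarrow> cmod z \<le> L"
    using compact_imp_bounded[OF assms] bounded_pos by blast
  define \<phi> where "\<phi> t = of_real (2 * L) * \<psi> t - Complex L L" for t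
  have "z \<in> \<phi> ` {0..1}" if "z \<in> C" for z
  proof -
    define w where "w = (z + Complex L L) / of_real (2 * L)"
    have "\<bar>Re z\<bar> \<le> L" "\<bar>Im z\<bar> \<le> L"
      using L(2)[OF that] abs_Re_le_cmod abs_Im_le_cmod order_trans by blast+
    then have "w \<in> \<psi> ` {0..1}"
      using L(1) by (intro \<psi>(2)) (auto simp: w_def Re_divide_of_real Im_divide_of_real field_simps)
    then obtain t where "t \<in> {0..1}" "w = \<psi> t"
      by blast
    then show ?thesis
      using L(1) by (intro image_eqI[of _ _ t]) (auto simp: \<phi>_def w_def field_simps)
  qed
  moreover have "continuous_on UNIV \<phi>"
    unfolding \<phi>_def[abs_def] by (intro continuous_intros \<psi>(1))
  ultimately show ?thesis
    by blast
qed

text \<open>\<open>Z n\<close> is distributed as the empirical measure of \<open>zs 0\<close>, ...,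
  \<open>zs (r n)\<close>. Pointwise convergence on one probability space is preferred to weak
  convergence because Fatou's lemma then applies directly to the logarithmic kernel.\<close>

lemma empirical_weak_limit:
  fixes zs :: "nat \<Rightarrow> complex"
  assumes C: "compact C" and zs: "\<And>n. zs n \<in> C"
  shows "\<exists>(\<Omega> :: real measure) Z Z' r. strict_mono (r :: nat \<Rightarrow> nat) \<and> prob_space \<Omega> \<and>
    (\<forall>n. Z n \<in> borel_measurable \<Omega>) \<and> Z' \<in> borel_measurable \<Omega> \<and>
    (\<forall>\<omega>\<in>space \<Omega>. (\<lambda>n. Z n \<omega>) \<longlonglongrightarrow> Z' \<omega>) \<and> (AE \<omega> in \<Omega>. Z' \<omega> \<in> C) \<and>
    (\<forall>n. \<forall>F\<in>borel_measurable borel. (\<integral>\<^sup>+\<omega>. F (Z n \<omega>) \<partial>\<Omega>) = (\<Sum>k\<le>r n. F (zs k)) / ennreal (Suc (r n)))"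
proof -
  obtain \<phi> :: "real \<Rightarrow> complex" where \<phi>: "continuous_on UNIV \<phi>" "C \<subseteq> \<phi> ` {0..1}"
    using compact_subset_curve[OF C] by blast
  have [measurable]: "\<phi> \<in> borel_measurable borel"
    using \<phi>(1) by (rule borel_measurable_continuous_onI)
  have "\<exists>t. t \<in> {0..1} \<and> \<phi> t = zs n" for n
    using subsetD[OF \<phi>(2) zs[of n]] by auto
  then obtain t where t: "\<And>n. t n \<in> {0..1}" "\<And>n. \<phi> (t n) = zs n"
    using choice[of "\<lambda>n t. t \<in> {0..1} \<and> \<phi> t = zs n"] by blast
  define \<mu> where "\<mu> n = distr (measure_pmf (pmf_of_set {..n})) borel t" for n
  have rd: "real_distribution (\<mu> n)" for n
    unfolding \<mu>_def by (intro prob_space.real_distribution_distr measure_pmf.prob_space_axioms) simp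
  have "measure (\<mu> n) {-1<..1} = 1" for n
  proof -
    have "t -` {-1<..1} = UNIV"
    proof (intro UNIV_eq_I[symmetric] vimageI2)
      show "t n \<in> {-1<..1}" for n
        using t(1)[of n] by simp
    qed
    then show ?thesis
      unfolding \<mu>_def by (subst measure_distr) auto
  qed
  then have "tight \<mu>"
    unfolding tight_def using rd by (intro conjI allI impI exI[of _ "-1"] exI[of _ 1]) auto
  then obtain r M where r: "strict_mono r" "real_distribution M" "weak_conv_m (\<mu> \<circ> id \<circ> r) M"
    using tight_imp_convergent_subsubsequence[OF _ strict_mono_id] by metis
  obtain \<Omega> :: "real measure" and Y Y' where \<Omega>: "prob_space \<Omega>"
    and [measurable]: "\<And>n. Y n \<in> borel_measurable \<Omega>" "Y' \<in> measurable \<Omega> lborel"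
    and distr: "\<And>n. distr \<Omega> borel (Y n) = \<mu> (r n)"
    and lim: "\<And>\<omega>. \<omega> \<in> space \<Omega> \<Longrightarrow> (\<lambda>n. Y n \<omega>) \<longlonglongrightarrow> Y' \<omega>"
    using Skorohod[of "\<mu> \<circ> id \<circ> r" M] rd r unfolding o_def id_def by blast
  have [measurable]: "Y' \<in> borel_measurable \<Omega>"
    using \<open>Y' \<in> measurable \<Omega> lborel\<close> by simp
  have int: "(\<integral>\<^sup>+\<omega>. F (\<phi> (Y n \<omega>)) \<partial>\<Omega>) = (\<Sum>k\<le>r n. F (zs k)) / ennreal (Suc (r n))"
    if [measurable]: "F \<in> borel_measurable borel" for F n
  proof -
    have "(\<integral>\<^sup>+\<omega>. F (\<phi> (Y n \<omega>)) \<partial>\<Omega>) = (\<integral>\<^sup>+x. F (\<phi> x) \<partial>\<mu> (r n))"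
      unfolding distr[symmetric] by (subst nn_integral_distr) auto
    also have "\<dots> = (\<integral>\<^sup>+k. F (\<phi> (t k)) \<partial>measure_pmf (pmf_of_set {..r n}))"
      unfolding \<mu>_def by (subst nn_integral_distr) auto
    also have "\<dots> = (\<Sum>k\<le>r n. F (zs k)) / ennreal (Suc (r n))"
      by (subst nn_integral_pmf_of_set) (auto simp: t(2) ennreal_of_nat_eq_real_of_nat)
    finally show ?thesis .
  qed
  \<comment> \<open>The integral identity, used for the indicator of the complement, puts each
    \<open>Z n\<close> almost surely in \<open>C\<close>; closedness passes this on to the
    limit.\<close>
  have "AE \<omega> in \<Omega>. \<forall>n. \<phi> (Y n \<omega>) \<in> C"
  proof (subst AE_all_countable, intro allI)
    fix n
    have "closed C"
      using C by (rule compact_imp_closed)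
    then have [measurable]: "C \<in> sets borel"
      by simp
    have "(\<integral>\<^sup>+\<omega>. indicator (- C) (\<phi> (Y n \<omega>)) \<partial>\<Omega>) = 0"
      using zs by (subst int) auto
    then have "AE \<omega> in \<Omega>. indicator (- C) (\<phi> (Y n \<omega>)) = (0 :: ennreal)"
      by (subst (asm) nn_integral_0_iff_AE) auto
    then show "AE \<omega> in \<Omega>. \<phi> (Y n \<omega>) \<in> C"
      by eventually_elim (auto simp: indicator_def split: if_splits)
  qed
  moreover have lim': "(\<lambda>n. \<phi> (Y n \<omega>)) \<longlonglongrightarrow> \<phi> (Y' \<omega>)" if "\<omega> \<in> space \<Omega>" for \<omega>
    using \<phi>(1) lim[OF that] by (auto simp: continuous_on_def intro: tendsto_compose)
  ultimately have "AE \<omega> in \<Omega>. \<phi> (Y' \<omega>) \<in> C"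
  proof (elim AE_mp, intro AE_I2 impI)
    fix \<omega> assume "\<omega> \<in> space \<Omega>" "\<forall>n. \<phi> (Y n \<omega>) \<in> C"
    then show "\<phi> (Y' \<omega>) \<in> C"
      by (intro closed_sequentially[OF compact_imp_closed[OF C] _ lim']) auto
  qed
  then show ?thesis
    using \<Omega> r(1) int lim'
    by (intro exI[of _ \<Omega>] exI[of _ "\<lambda>n \<omega>. \<phi> (Y n \<omega>)"] exI[of _ "\<lambda>\<omega>. \<phi> (Y' \<omega>)"] exI[of _ r]) auto
qed

section \<open>Logarithmic energy on compact sets, and sets of energy points\<close>

lemma log_kernel_measurable [measurable]:
  assumes [measurable]: "f \<in> borel_measurable M" "g \<in> borel_measurable M"
  shows "(\<lambda>x. log_kernel (f x) (g x)) \<in> borel_measurable M"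
  unfolding log_kernel_def by measurable

lemma e2ennreal_add_const_le:
  assumes "0 \<le> c"
  shows "e2ennreal (x + ereal c) \<le> e2ennreal x + ennreal c"
proof (cases x rule: ereal_cases)
  case (real r)
  have "ennreal (r + c) \<le> ennreal (max r 0 + c)"
    by (intro ennreal_leI) simp
  also have "\<dots> = ennreal r + ennreal c"
    using assms by (simp add: max_def ennreal_neg)
  finally show ?thesis
    using real by (simp add: e2ennreal_ereal)
qed (auto simp: e2ennreal_neg)

lemma le_e2ennreal_diff_add:
  assumes "B \<noteq> \<infinity>"
  shows "A \<le> e2ennreal (enn2ereal A - enn2ereal B) + B"
proof (cases A)
  case (real a)
  obtain b where b: "b \<ge> 0" "B = ennreal b"
    using assms by (cases B) auto
  have "ennreal a \<le> ennreal (max (a - b) 0 + b)"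
    by (intro ennreal_leI) simp
  also have "\<dots> = ennreal (a - b) + ennreal b"
    using b by (simp add: max_def ennreal_neg)
  finally show ?thesis
    using real b by (simp add: e2ennreal_ereal)
next
  case top
  then show ?thesis
    using assms by (cases B) (auto simp: top_ereal_def)
qed

text \<open>Since exp c bounds the diameter of \<open>C\<close>, the shifted kernel is nonnegative
  on \<open>C\<close>. For a finite measure the shift changes the energy by a finite amount only, so
  infinite energy can be tested on an iterated integral of nonnegative functions, free of
  differences.\<close>

lemma log_energy_eq_top_iff:
  assumes sets: "sets \<nu> = sets borel" and fin: "emeasure \<nu> UNIV < \<infinity>"
    and C: "AE z in \<nu>. z \<in> C" and c: "c \<ge> 0" "\<And>z w. z \<in> C \<Longrightarrow> w \<in> C \<Longrightarrow> cmod (z - w) \<le> exp c"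
  shows "log_energy \<nu> = \<infinity> \<longleftrightarrow> (\<integral>\<^sup>+w. \<integral>\<^sup>+z. e2ennreal (log_kernel z w + ereal c) \<partial>\<nu> \<partial>\<nu>) = \<infinity>"
proof -
  have sp: "space \<nu> = UNIV"
    using sets_eq_imp_space_eq[OF sets] by simp
  interpret finite_measure \<nu>
    using fin sp by (intro finite_measureI) auto
  note [measurable_cong] = sets
  define A B where "A w = (\<integral>\<^sup>+z. e2ennreal (log_kernel z w) \<partial>\<nu>)"
    and "B w = (\<integral>\<^sup>+z. e2ennreal (- log_kernel z w) \<partial>\<nu>)" for w
  define K where "K w = (\<integral>\<^sup>+z. e2ennreal (log_kernel z w + ereal c) \<partial>\<nu>)" for w
  have [measurable]: "A \<in> borel_measurable \<nu>" "B \<in> borel_measurable \<nu>" "K \<in> borel_measurable \<nu>"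
    unfolding A_def[abs_def] B_def[abs_def] K_def[abs_def] by measurable
  \<comment> \<open>Bounds the negative part of the logarithmic potential at every point of
    \<open>C\<close>.\<close>
  define V where "V = ennreal c * emeasure \<nu> UNIV"
  have V: "V < \<infinity>"
    using fin by (simp add: V_def ennreal_mult_less_top)
  have neg: "- log_kernel z w \<le> ereal c" if "z \<in> C" "w \<in> C" for z w
  proof (cases "z = w")
    case False
    then have "ln (cmod (z - w)) \<le> ln (exp c)"
      using c(2)[OF that] by (subst ln_le_cancel_iff) auto
    then show ?thesis
      using False by (simp add: log_kernel_def)
  qed (simp add: log_kernel_def)
  have B: "B w \<le> V" if "w \<in> C" for w
  proof -
    have "AE z in \<nu>. e2ennreal (- log_kernel z w) \<le> ennreal c"
      using C
    proof eventually_elim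
      case (elim z)
      then show ?case
        using e2ennreal_mono[OF neg[OF elim that]] by (simp add: e2ennreal_ereal)
    qed
    then have "B w \<le> (\<integral>\<^sup>+z. ennreal c \<partial>\<nu>)"
      unfolding B_def by (rule nn_integral_mono_AE)
    then show ?thesis
      by (simp add: V_def sp)
  qed
  have AK: "A w \<le> K w" for w
    unfolding A_def K_def using c(1)
    by (intro nn_integral_mono e2ennreal_mono) (simp add: ereal_le_add_self)
  have KA: "K w \<le> A w + V" for w
  proof -
    have "K w \<le> (\<integral>\<^sup>+z. e2ennreal (log_kernel z w) + ennreal c \<partial>\<nu>)"
      unfolding K_def using c(1) by (intro nn_integral_mono e2ennreal_add_const_le)
    also have "\<dots> = A w + V"
      by (subst nn_integral_add) (auto simp: A_def V_def sp)
    finally show ?thesis .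
  qed
  define X Y where "X = (\<integral>\<^sup>+w. e2ennreal (enn2ereal (A w) - enn2ereal (B w)) \<partial>\<nu>)"
    and "Y = (\<integral>\<^sup>+w. e2ennreal (- (enn2ereal (A w) - enn2ereal (B w))) \<partial>\<nu>)"
  have E: "log_energy \<nu> = enn2ereal X - enn2ereal Y"
    unfolding log_energy_def ereal_integral_def X_def Y_def A_def B_def ..
  have XK: "X \<le> (\<integral>\<^sup>+w. K w \<partial>\<nu>)"
    unfolding X_def
  proof (intro nn_integral_mono)
    fix w
    have "enn2ereal (A w) - enn2ereal (B w) \<le> enn2ereal (A w) - 0"
      by (intro ereal_minus_mono) auto
    then have "e2ennreal (enn2ereal (A w) - enn2ereal (B w)) \<le> e2ennreal (enn2ereal (A w))"
      by (intro e2ennreal_mono) simp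
    then show "e2ennreal (enn2ereal (A w) - enn2ereal (B w)) \<le> K w"
      using AK[of w] unfolding e2ennreal_enn2ereal by (rule order_trans)
  qed
  have "(\<integral>\<^sup>+w. K w \<partial>\<nu>) \<le> (\<integral>\<^sup>+w. e2ennreal (enn2ereal (A w) - enn2ereal (B w)) + (V + V) \<partial>\<nu>)"
  proof (rule nn_integral_mono_AE)
    show "AE w in \<nu>. K w \<le> e2ennreal (enn2ereal (A w) - enn2ereal (B w)) + (V + V)"
      using C
    proof eventually_elim
      case (elim w)
      have "B w \<noteq> \<infinity>"
        using B[OF elim] V by (auto simp: top_unique)
      then have "A w \<le> e2ennreal (enn2ereal (A w) - enn2ereal (B w)) + B w"
        by (rule le_e2ennreal_diff_add)
      then have "A w + V \<le> e2ennreal (enn2ereal (A w) - enn2ereal (B w)) + V + V"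
        using B[OF elim] by (meson add_left_mono add_right_mono order_trans)
      from order_trans[OF KA this] show ?case
        by (simp only: add.assoc)
    qed
  qed
  also have "\<dots> = X + (V + V) * emeasure \<nu> UNIV"
    unfolding X_def by (subst nn_integral_add) (auto simp: sp)
  finally have KX: "(\<integral>\<^sup>+w. K w \<partial>\<nu>) \<le> X + (V + V) * emeasure \<nu> UNIV" .
  have W: "(V + V) * emeasure \<nu> UNIV < \<infinity>"
    using V fin by (simp add: ennreal_mult_less_top)
  have "(\<integral>\<^sup>+w. K w \<partial>\<nu>) = \<infinity> \<longleftrightarrow> X = \<infinity>"
  proof
    assume "(\<integral>\<^sup>+w. K w \<partial>\<nu>) = \<infinity>"
    then have "X + (V + V) * emeasure \<nu> UNIV = \<infinity>"
      using KX by (simp add: top_unique)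
    then show "X = \<infinity>"
      using W by (auto simp: ennreal_add_eq_top)
  qed (use XK in \<open>auto simp: top_unique\<close>)
  moreover have "log_energy \<nu> = \<infinity> \<longleftrightarrow> X = \<infinity>"
  proof
    assume "log_energy \<nu> = \<infinity>"
    moreover have "enn2ereal X - enn2ereal Y \<le> enn2ereal X - 0"
      by (intro ereal_minus_mono) auto
    ultimately have "enn2ereal X = \<infinity>"
      using E by simp
    then show "X = \<infinity>"
      by (metis e2ennreal_enn2ereal e2ennreal_infty infinity_ennreal_def)
  next
    assume "X = \<infinity>"
    \<comment> \<open>This includes the case that \<open>Y\<close> is infinite: on
      \<open>ereal\<close> the difference \<infinity> - \<infinity> is \<infinity>.\<close>
    then show "log_energy \<nu> = \<infinity>"
      unfolding E by (cases "enn2ereal Y") auto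
  qed
  ultimately show ?thesis
    unfolding K_def by simp
qed

lemma log_capacity_zero_imp_energy:
  assumes "log_capacity E = 0" "sets \<nu> = sets borel" "emeasure \<nu> UNIV = 1"
    "compact C" "C \<subseteq> E" "emeasure \<nu> (- C) = 0"
  shows "log_energy \<nu> = \<infinity>"
proof -
  have "exp_minus (log_energy \<nu>) \<le> log_capacity E"
    unfolding log_capacity_def using assms by (intro SUP_upper) auto
  then have "exp_minus (log_energy \<nu>) = 0"
    using assms by simp
  then show ?thesis
    by (auto simp: exp_minus_def split: ereal.splits)
qed

text \<open>Leja points maximise the product of the distances to their predecessors; a uniform lower
  bound is enough here. It says that the mean logarithmic potential of the earlier points, taken at
  the new point, is below \<open>M\<close>. At n = 0 the requirement is empty and any point of
  \<open>C\<close> will do.\<close>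

lemma leja_sequence:
  assumes C: "C \<noteq> {}"
    and step: "\<And>n e. \<lbrakk>n \<ge> 1; \<And>k. k < n \<Longrightarrow> e k \<in> C\<rbrakk> \<Longrightarrow>
      \<exists>z\<in>C. exp (- (real n * M)) < (\<Prod>k<n. cmod (z - e k))"
  shows "\<exists>zs. (\<forall>n. zs n \<in> C) \<and> (\<forall>n\<ge>1. exp (- (real n * M)) < (\<Prod>k<n. cmod (zs n - zs k)))"
proof -
  define P where "P f n z \<longleftrightarrow> z \<in> C \<and> (n \<ge> 1 \<longrightarrow> exp (- (real n * M)) < (\<Prod>k<n. cmod (z - f k)))"
    for f :: "nat \<Rightarrow> complex" and n z
  have "\<exists>f. \<forall>n. P f n (f n)"
  proof (rule dependent_wf_choice[OF wf_less_than])
    show "P f n z = P g n z" if "\<And>k. (k, n) \<in> less_than \<Longrightarrow> f k = g k" for f g n z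
      using that by (simp add: P_def)
    show "\<exists>z. P f n z" if "\<And>k. (k, n) \<in> less_than \<Longrightarrow> P f k (f k)" for n f
    proof (cases "n \<ge> 1")
      case True
      moreover have "f k \<in> C" if "k < n" for k
        using \<open>\<And>k. _ \<Longrightarrow> P f k (f k)\<close>[of k] that by (simp add: P_def)
      ultimately show ?thesis
        using step[of n f] by (auto simp: P_def)
    qed (use C in \<open>auto simp: P_def\<close>)
  qed
  then show ?thesis
    by (auto simp: P_def)
qed

text \<open>A new point with index \<open>N\<close> contributes a row and a column, each at most N M
  by the lower bound on the product, and a diagonal entry of at most \<open>T\<close>.\<close>

lemma truncated_pair_sum_bound:
  fixes zs :: "nat \<Rightarrow> complex" and T M :: real
  assumes M: "M \<ge> 0"
    and leja: "\<And>n. n \<ge> 1 \<Longrightarrow> exp (- (real n * M)) < (\<Prod>k<n. cmod (zs n - zs k))"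
    and \<kappa>: "\<And>z. \<kappa> z z \<le> T" "\<And>z w. z \<noteq> w \<Longrightarrow> \<kappa> z w \<le> - ln (cmod (z - w))" "\<And>z w. \<kappa> z w = \<kappa> w z"
  shows "(\<Sum>i<N. \<Sum>j<N. \<kappa> (zs i) (zs j)) \<le> M * (real N)\<^sup>2 + T * real N"
proof (induction N)
  case (Suc N)
  have "(\<Sum>j<N. \<kappa> (zs N) (zs j)) \<le> real N * M"
  proof (cases "N = 0")
    case False
    \<comment> \<open>A positive product forces \<open>zs N\<close> to be distinct from all earlier
      points, so only off-diagonal values of the kernel occur in the row.\<close>
    have pos: "(\<Prod>k<N. cmod (zs N - zs k)) > 0"
      using leja[of N] False exp_gt_zero[of "- (real N * M)"] by linarith
    then have ne: "zs N \<noteq> zs k" if "k < N" for k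
      using that by (auto simp: prod_pos_nat_iff dest!: less_imp_neq[of 0])
    have "(\<Sum>j<N. \<kappa> (zs N) (zs j)) \<le> (\<Sum>j<N. - ln (cmod (zs N - zs j)))"
      using ne by (intro sum_mono \<kappa>(2)) auto
    also have "\<dots> = - ln (\<Prod>k<N. cmod (zs N - zs k))"
      using ne by (subst ln_prod) (auto simp: sum_negf)
    also have "\<dots> \<le> - ln (exp (- (real N * M)))"
      using leja[of N] False pos by (subst neg_le_iff_le, subst ln_le_cancel_iff) auto
    finally show ?thesis
      by simp
  qed simp
  moreover have "(\<Sum>i<N. \<kappa> (zs i) (zs N)) = (\<Sum>j<N. \<kappa> (zs N) (zs j))"
    by (intro sum.cong \<kappa>(3)) auto
  ultimately have "(\<Sum>i<Suc N. \<Sum>j<Suc N. \<kappa> (zs i) (zs j)) \<le> M * (real N)\<^sup>2 + T * real N + real N * M + real N * M + T"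
    using Suc.IH \<kappa>(1)[of "zs N"] unfolding sum.lessThan_Suc sum.distrib by linarith
  also have "\<dots> \<le> M * (real (Suc N))\<^sup>2 + T * real (Suc N)"
    using M by (simp add: power2_eq_square algebra_simps)
  finally show ?case .
qed simp

text \<open>A compact set of capacity zero has vanishing Chebyshev constant, even for polynomials
  with all zeros in the set. The location of the zeros matters later: away from \<open>C\<close>
  such polynomials are bounded below independently of their degree, after taking n-th roots.\<close>

lemma small_product_on_polar_compact:
  assumes C: "compact C" "C \<noteq> {}" "log_capacity E = 0" "C \<subseteq> E"
  shows "\<exists>n\<ge>1. \<exists>e. (\<forall>k<n. e k \<in> C) \<and> (\<forall>z\<in>C. (\<Prod>k<n. cmod (z - e k)) \<le> exp (- (real n * M)))"
proof (rule ccontr)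
  assume contra: "\<not> ?thesis"
  \<comment> \<open>The induction for the pair sums needs a nonnegative constant; enlarging
    \<open>M\<close> only weakens the lower bound on the products.\<close>
  define M' where "M' = max M 0"
  have "M' \<ge> 0"
    by (simp add: M'_def)
  have "\<exists>zs. (\<forall>n. zs n \<in> C) \<and> (\<forall>n\<ge>1. exp (- (real n * M')) < (\<Prod>k<n. cmod (zs n - zs k)))"
  proof (rule leja_sequence[OF C(2)])
    fix n and e :: "nat \<Rightarrow> complex"
    assume "n \<ge> 1" "\<And>k. k < n \<Longrightarrow> e k \<in> C"
    then obtain z where "z \<in> C" "exp (- (real n * M)) < (\<Prod>k<n. cmod (z - e k))"
      using contra by (meson not_le)
    moreover have "exp (- (real n * M')) \<le> exp (- (real n * M))"
      by (simp add: M'_def mult_left_mono)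
    ultimately show "\<exists>z\<in>C. exp (- (real n * M')) < (\<Prod>k<n. cmod (z - e k))"
      by (meson le_less_trans)
  qed
  then obtain zs where zs: "\<And>n. zs n \<in> C"
    and leja: "\<And>n. n \<ge> 1 \<Longrightarrow> exp (- (real n * M')) < (\<Prod>k<n. cmod (zs n - zs k))"
    by blast
  obtain \<Omega> :: "real measure" and Z Z' r where r: "strict_mono (r :: nat \<Rightarrow> nat)" and \<Omega>: "prob_space \<Omega>"
    and [measurable]: "\<And>n. Z n \<in> borel_measurable \<Omega>" "Z' \<in> borel_measurable \<Omega>"
    and lim: "\<And>\<omega>. \<omega> \<in> space \<Omega> \<Longrightarrow> (\<lambda>n. Z n \<omega>) \<longlonglongrightarrow> Z' \<omega>" and Z'C: "AE \<omega> in \<Omega>. Z' \<omega> \<in> C"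
    and int: "\<And>n F. F \<in> borel_measurable borel \<Longrightarrow>
        (\<integral>\<^sup>+\<omega>. F (Z n \<omega>) \<partial>\<Omega>) = (\<Sum>k\<le>r n. F (zs k)) / ennreal (Suc (r n))"
    using empirical_weak_limit[OF C(1), of zs, OF zs] by blast
  interpret prob_space \<Omega>
    by (rule \<Omega>)
  obtain L where L: "L > 0" "\<And>z. z \<in> C \<Longrightarrow> cmod z \<le> L"
    using compact_imp_bounded[OF C(1)] bounded_pos by blast
  define c where "c = max 0 (ln (2 * L))"
  have "exp c \<ge> exp (ln (2 * L))"
    unfolding c_def by (subst exp_le_cancel_iff) simp
  then have expc: "exp c \<ge> 2 * L" and c0: "c \<ge> 0"
    using L by (auto simp: c_def)
  have diam: "cmod (z - w) \<le> exp c" if "z \<in> C" "w \<in> C" for z w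
    using norm_triangle_ineq4[of z w] L(2)[OF that(1)] L(2)[OF that(2)] expc by linarith
  \<comment> \<open>Truncation at level \<open>T\<close> gives the diagonal a finite weight. An
    empirical measure of N points charges the diagonal with mass at least 1/N, where the untruncated
    kernel is infinite.\<close>
  define \<kappa> where "\<kappa> T z w = (if z = w then T else min T (- ln (cmod (z - w))))" for T and z w :: complex
  have [measurable]: "(\<lambda>x. \<kappa> T (u x) (v x)) \<in> borel_measurable N"
    if [measurable]: "u \<in> borel_measurable N" "v \<in> borel_measurable N" for T u v and N :: "'x measure"
    unfolding \<kappa>_def by measurable
  have \<kappa>_nonneg: "0 \<le> \<kappa> T z w + c" if "z \<in> C" "w \<in> C" "T \<ge> 0" for T z w
  proof (cases "z = w")
    case False
    then have "ln (cmod (z - w)) \<le> ln (exp c)"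
      using diam[OF that(1,2)] by (subst ln_le_cancel_iff) auto
    then show ?thesis
      using False that c0 by (simp add: \<kappa>_def)
  qed (use that c0 in \<open>simp add: \<kappa>_def\<close>)
  have bound: "(\<integral>\<^sup>+\<omega>. \<integral>\<^sup>+\<omega>'. ennreal (\<kappa> n (Z n \<omega>') (Z n \<omega>) + c) \<partial>\<Omega> \<partial>\<Omega>) \<le> ennreal (M' + 1 + c)" for n
  proof -
    define N where "N = Suc (r n)"
    \<comment> \<open>Since \<open>r\<close> is strictly increasing, the truncation level
      \<open>n\<close> is at most the number of points. Hence the diagonal contributes at most 1 to
      the normalised sum, the 1 in \<open>M' + 1 + c\<close>.\<close>
    have nN: "real n \<le> real N" "N > 0"
      using seq_suble[OF r, of n] by (auto simp: N_def)
    have "(\<integral>\<^sup>+\<omega>. \<integral>\<^sup>+\<omega>'. ennreal (\<kappa> n (Z n \<omega>') (Z n \<omega>) + c) \<partial>\<Omega> \<partial>\<Omega>) =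
        (\<integral>\<^sup>+\<omega>. (\<Sum>j<N. ennreal (\<kappa> n (zs j) (Z n \<omega>) + c)) / ennreal N \<partial>\<Omega>)"
      by (subst int[of "\<lambda>z. ennreal (\<kappa> n z _ + c)"]) (auto simp: N_def lessThan_Suc_atMost)
    also have "\<dots> = (\<Sum>i<N. (\<Sum>j<N. ennreal (\<kappa> n (zs j) (zs i) + c)) / ennreal N) / ennreal N"
      by (subst int[of "\<lambda>w. (\<Sum>j<N. ennreal (\<kappa> n (zs j) w + c)) / ennreal N"]) (auto simp: N_def lessThan_Suc_atMost)
    also have "\<dots> = ennreal (\<Sum>i<N. (\<Sum>j<N. \<kappa> n (zs j) (zs i) + c) / N) / ennreal N"
      using nN zs by (simp add: sum_ennreal \<kappa>_nonneg divide_ennreal sum_nonneg)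
    also have "\<dots> = ennreal ((\<Sum>i<N. (\<Sum>j<N. \<kappa> n (zs j) (zs i) + c) / N) / N)"
      using nN zs by (intro divide_ennreal sum_nonneg divide_nonneg_nonneg) (auto simp: \<kappa>_nonneg)
    also have "(\<Sum>i<N. (\<Sum>j<N. \<kappa> n (zs j) (zs i) + c) / N) / N = (\<Sum>i<N. \<Sum>j<N. \<kappa> n (zs j) (zs i)) / (real N)\<^sup>2 + c"
      using nN by (simp add: sum.distrib sum_divide_distrib[symmetric] field_simps power2_eq_square)
    also have "(\<Sum>i<N. \<Sum>j<N. \<kappa> n (zs j) (zs i)) \<le> M' * (real N)\<^sup>2 + real n * real N"
      by (subst sum.swap, rule truncated_pair_sum_bound[OF \<open>M' \<ge> 0\<close> leja])
        (auto simp: \<kappa>_def norm_minus_commute)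
    also have "real n * real N \<le> real N * real N"
      using nN by (intro mult_right_mono) auto
    also have "(M' * (real N)\<^sup>2 + real N * real N) / (real N)\<^sup>2 = M' + 1"
      using nN by (simp add: field_simps power2_eq_square)
    finally show ?thesis
      by (simp add: ennreal_leI divide_right_mono)
  qed
  have pointwise: "e2ennreal (log_kernel (Z' \<omega>') (Z' \<omega>) + ereal c) \<le>
      liminf (\<lambda>n. ennreal (\<kappa> n (Z n \<omega>') (Z n \<omega>) + c))"
    if \<omega>: "\<omega> \<in> space \<Omega>" "\<omega>' \<in> space \<Omega>" for \<omega> \<omega>'
  proof -
    \<comment> \<open>If the two samples coincide, the kernel equals the truncation level
      \<open>n\<close>, which eventually exceeds \<open>T\<close>; otherwise the distance being
      below exp(-T) gives the bound.\<close>
    have ev: "\<forall>\<^sub>F n in sequentially. T \<le> \<kappa> n (Z n \<omega>') (Z n \<omega>)"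
      if T: "cmod (Z' \<omega>' - Z' \<omega>) < exp (- T)" for T
    proof -
      have "(\<lambda>n. cmod (Z n \<omega>' - Z n \<omega>)) \<longlonglongrightarrow> cmod (Z' \<omega>' - Z' \<omega>)"
        using \<omega> by (intro tendsto_intros lim)
      then have "\<forall>\<^sub>F n in sequentially. cmod (Z n \<omega>' - Z n \<omega>) < exp (- T)"
        using T by (rule order_tendstoD(2))
      moreover have "\<forall>\<^sub>F n in sequentially. T \<le> real n"
        using filterlim_real_sequentially by (auto simp: filterlim_at_top)
      ultimately show ?thesis
      proof eventually_elim
        case (elim n)
        show ?case
        proof (cases "Z n \<omega>' = Z n \<omega>")
          case False
          then have "ln (cmod (Z n \<omega>' - Z n \<omega>)) < ln (exp (- T))"
            using elim by (subst ln_less_cancel_iff) auto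
          then show ?thesis
            using elim False by (simp add: \<kappa>_def)
        qed (use elim in \<open>simp add: \<kappa>_def\<close>)
      qed
    qed
    show ?thesis
      unfolding le_Liminf_iff
    proof (intro allI impI)
      fix y assume y: "y < e2ennreal (log_kernel (Z' \<omega>') (Z' \<omega>) + ereal c)"
      then obtain y0 where y0: "y0 \<ge> 0" "y = ennreal y0"
        by (cases y) auto
      have "\<exists>T. y0 < T + c \<and> cmod (Z' \<omega>' - Z' \<omega>) < exp (- T)"
      proof (cases "Z' \<omega>' = Z' \<omega>")
        case True
        then show ?thesis
          by (intro exI[of _ "y0 - c + 1"]) auto
      next
        case False
        then have "ennreal y0 < ennreal (c - ln (cmod (Z' \<omega>' - Z' \<omega>)))"
          using y y0 by (simp add: log_kernel_def e2ennreal_ereal)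
        then have "y0 - c < - ln (cmod (Z' \<omega>' - Z' \<omega>))"
          using y0 by (simp add: ennreal_less_iff)
        then obtain T where "y0 - c < T" "T < - ln (cmod (Z' \<omega>' - Z' \<omega>))"
          using dense by blast
        moreover from this have "exp (ln (cmod (Z' \<omega>' - Z' \<omega>))) < exp (- T)"
          by simp
        ultimately show ?thesis
          using False by (intro exI[of _ T]) auto
      qed
      then obtain T where T: "y0 < T + c" "cmod (Z' \<omega>' - Z' \<omega>) < exp (- T)"
        by blast
      show "\<forall>\<^sub>F n in sequentially. y < ennreal (\<kappa> n (Z n \<omega>') (Z n \<omega>) + c)"
        using ev[OF T(2)]
      proof eventually_elim
        case (elim n)
        then show ?case
          using T(1) y0 by (simp add: ennreal_less_iff)
      qed
    qed
  qed
  define \<nu> where "\<nu> = distr \<Omega> borel Z'"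
  have "(\<integral>\<^sup>+w. \<integral>\<^sup>+z. e2ennreal (log_kernel z w + ereal c) \<partial>\<nu> \<partial>\<nu>)
      = (\<integral>\<^sup>+\<omega>. \<integral>\<^sup>+\<omega>'. e2ennreal (log_kernel (Z' \<omega>') (Z' \<omega>) + ereal c) \<partial>\<Omega> \<partial>\<Omega>)"
  proof -
    have "sigma_finite_measure \<nu>"
      unfolding \<nu>_def by (intro prob_space_imp_sigma_finite prob_space_distr) simp
    define G where "G w = (\<integral>\<^sup>+z. e2ennreal (log_kernel z w + ereal c) \<partial>\<nu>)" for w
    have "G \<in> borel_measurable borel"
      using \<open>sigma_finite_measure \<nu>\<close> unfolding G_def[abs_def]
      by (intro sigma_finite_measure.borel_measurable_nn_integral) (auto simp: \<nu>_def)
    then have "(\<integral>\<^sup>+w. G w \<partial>\<nu>) = (\<integral>\<^sup>+\<omega>. G (Z' \<omega>) \<partial>\<Omega>)"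
      unfolding \<nu>_def by (intro nn_integral_distr) auto
    moreover have "G (Z' \<omega>) = (\<integral>\<^sup>+\<omega>'. e2ennreal (log_kernel (Z' \<omega>') (Z' \<omega>) + ereal c) \<partial>\<Omega>)" for \<omega>
      unfolding \<nu>_def G_def by (subst nn_integral_distr) auto
    ultimately show ?thesis
      unfolding G_def by simp
  qed
  also have "\<dots> \<le> (\<integral>\<^sup>+\<omega>. liminf (\<lambda>n. \<integral>\<^sup>+\<omega>'. ennreal (\<kappa> n (Z n \<omega>') (Z n \<omega>) + c) \<partial>\<Omega>) \<partial>\<Omega>)"
  proof (rule nn_integral_mono)
    fix \<omega> assume "\<omega> \<in> space \<Omega>"
    then have "(\<integral>\<^sup>+\<omega>'. e2ennreal (log_kernel (Z' \<omega>') (Z' \<omega>) + ereal c) \<partial>\<Omega>) \<le>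
        (\<integral>\<^sup>+\<omega>'. liminf (\<lambda>n. ennreal (\<kappa> n (Z n \<omega>') (Z n \<omega>) + c)) \<partial>\<Omega>)"
      by (intro nn_integral_mono pointwise)
    also have "\<dots> \<le> liminf (\<lambda>n. \<integral>\<^sup>+\<omega>'. ennreal (\<kappa> n (Z n \<omega>') (Z n \<omega>) + c) \<partial>\<Omega>)"
      by (intro nn_integral_liminf) auto
    finally show "(\<integral>\<^sup>+\<omega>'. e2ennreal (log_kernel (Z' \<omega>') (Z' \<omega>) + ereal c) \<partial>\<Omega>) \<le>
        liminf (\<lambda>n. \<integral>\<^sup>+\<omega>'. ennreal (\<kappa> n (Z n \<omega>') (Z n \<omega>) + c) \<partial>\<Omega>)" .
  qed
  also have "\<dots> \<le> liminf (\<lambda>n. \<integral>\<^sup>+\<omega>. \<integral>\<^sup>+\<omega>'. ennreal (\<kappa> n (Z n \<omega>') (Z n \<omega>) + c) \<partial>\<Omega> \<partial>\<Omega>)"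
    by (intro nn_integral_liminf) auto
  also have "\<dots> \<le> liminf (\<lambda>n :: nat. ennreal (M' + 1 + c))"
    using bound by (intro Liminf_mono always_eventually allI)
  also have "\<dots> < \<infinity>"
    by (simp add: Liminf_const)
  finally have fin: "(\<integral>\<^sup>+w. \<integral>\<^sup>+z. e2ennreal (log_kernel z w + ereal c) \<partial>\<nu> \<partial>\<nu>) < \<infinity>" .
  have sets: "sets \<nu> = sets borel"
    by (simp add: \<nu>_def)
  have one: "emeasure \<nu> UNIV = 1"
    using prob_space.emeasure_space_1[OF prob_space_distr[of Z' borel]] by (simp add: \<nu>_def)
  have "closed C"
    using C(1) by (rule compact_imp_closed)
  then have [measurable]: "C \<in> sets borel"
    by simp
  have AE: "AE z in \<nu>. z \<in> C"
    unfolding \<nu>_def using Z'C by (subst AE_distr_iff) auto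
  then have "emeasure \<nu> (- C) = 0"
    by (subst (asm) AE_iff_measurable[of "- C"]) (auto simp: \<nu>_def)
  then have "log_energy \<nu> = \<infinity>"
    using log_capacity_zero_imp_energy[OF C(3) sets one C(1) C(4)] by blast
  moreover have "log_energy \<nu> = \<infinity> \<longleftrightarrow> (\<integral>\<^sup>+w. \<integral>\<^sup>+z. e2ennreal (log_kernel z w + ereal c) \<partial>\<nu> \<partial>\<nu>) = \<infinity>"
    using one AE c0 diam by (intro log_energy_eq_top_iff[OF sets]) auto
  ultimately show False
    using fin by simp
qed


section \<open>Barriers at polar boundary sets\<close>

text \<open>The function is \<beta> times the difference of log|z - p| and the mean of the log|z - e
  k|, plus a constant. Both logarithms have the same growth at infinity. The decisive point is the
  order of choices: since all zeros lie in \<open>C\<close>, the value at \<open>q\<close> is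
  bounded in terms of the distance from \<open>q\<close> to \<open>C\<close> alone. So \<beta> can
  be fixed first and the polynomial chosen afterwards, small enough on \<open>C\<close> for the
  given \<beta> and \<open>M\<close>.\<close>

lemma polar_compact_barrier:
  assumes D: "open D" "q \<in> D" and \<rho>: "\<rho> > 0" "\<rho> \<le> cmod (q - p)"
    and C: "compact C" "C \<subseteq> E" "log_capacity E = 0" "C \<inter> D = {}" and \<epsilon>: "\<epsilon> > 0"
  shows "\<exists>\<beta> k fk U. 0 \<le> \<beta> \<and> \<beta> \<le> \<epsilon> \<and> harmonic_grad k fk D \<and> open U \<and> C \<subseteq> U \<and>
    (\<forall>z. \<rho> \<le> cmod (z - p) \<longrightarrow> z \<in> D \<longrightarrow> 0 \<le> \<beta> * ln (cmod (z - p)) + k z) \<and>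
    \<beta> * ln (cmod (q - p)) + k q \<le> \<epsilon> \<and>
    (\<forall>z\<in>U \<inter> D. \<rho> \<le> cmod (z - p) \<longrightarrow> M \<le> \<beta> * ln (cmod (z - p)) + k z)"
proof (cases "C = {}")
  case True
  then show ?thesis
    using \<epsilon> by (intro exI[of _ 0] exI[of _ "\<lambda>_. 0"] exI[of _ "{}"]) (auto simp: harmonic_grad_const)
next
  case False
  obtain L where L: "L > 0" "\<And>z. z \<in> C \<Longrightarrow> cmod (z - p) \<le> L"
  proof -
    have "bounded ((\<lambda>z. z - p) ` C)"
      using C(1) by (intro compact_imp_bounded compact_continuous_image continuous_intros)
    then obtain L where "L > 0" "\<forall>x\<in>(\<lambda>z. z - p) ` C. cmod x \<le> L"
      using bounded_pos by blast
    then show ?thesis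
      using that by blast
  qed
  obtain d where d: "d > 0" "ball q d \<subseteq> D"
    using D openE by blast
  have dq: "d \<le> cmod (q - e)" if "e \<in> C" for e
    using d C(4) that by (force simp: dist_norm)
  \<comment> \<open>For |z - p| at least \<rho>, the distance from \<open>z\<close> to a zero is at
    most |z - p| + L, hence at most (\<rho> + L) / \<rho> times |z - p|.\<close>
  define c where "c = ln ((\<rho> + L) / \<rho>)"
  \<comment> \<open>Bounds \<open>w q\<close> for every polynomial with zeros in
    \<open>C\<close>.\<close>
  define c0 where "c0 = \<bar>ln (cmod (q - p)) - ln d + c\<bar>"
  define \<beta> where "\<beta> = min \<epsilon> (\<epsilon> / (c0 + 1))"
  have \<beta>: "\<beta> > 0" "\<beta> \<le> \<epsilon>" "\<beta> * c0 \<le> \<epsilon>"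
  proof -
    have "c0 \<ge> 0"
      by (simp add: c0_def)
    then show "\<beta> > 0" "\<beta> \<le> \<epsilon>"
      using \<epsilon> by (auto simp: \<beta>_def)
    have "\<beta> * c0 \<le> \<epsilon> / (c0 + 1) * (c0 + 1)"
      using \<epsilon> \<open>c0 \<ge> 0\<close> by (intro mult_mono) (auto simp: \<beta>_def)
    then show "\<beta> * c0 \<le> \<epsilon>"
      using \<open>c0 \<ge> 0\<close> by simp
  qed
  \<comment> \<open>Solves M / \<beta> = ln \<rho> + (M' - 1) + c; the unit is given up in passing
    from \<open>C\<close> to the open neighbourhood \<open>U\<close>.\<close>
  define M' where "M' = M / \<beta> + 1 - ln \<rho> - c"
  obtain n e where n: "n \<ge> 1" and e: "\<And>k. k < n \<Longrightarrow> e k \<in> C"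
    and small: "\<And>z. z \<in> C \<Longrightarrow> (\<Prod>k<n. cmod (z - e k)) \<le> exp (- (real n * M'))"
    using small_product_on_polar_compact[OF C(1) False C(3,2)] by metis
  define w where "w z = ln (cmod (z - p)) - (\<Sum>k<n. ln (cmod (z - e k))) / real n + c" for z
  define k where "k z = \<beta> * c + (\<Sum>i<n. (- (\<beta> / real n)) * ln (cmod (z - e i)))" for z
  have wk: "\<beta> * w z = \<beta> * ln (cmod (z - p)) + k z" for z
    unfolding w_def k_def sum_distrib_left[symmetric] by (simp add: right_diff_distrib distrib_left)
  have eD: "e i \<notin> D" if "i < n" for i
    using e[OF that] C(4) by blast
  have "harmonic_grad k (\<lambda>z. 0 + (\<Sum>i<n. of_real (- (\<beta> / real n)) * (1 / (z - e i)))) D"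
    unfolding k_def[abs_def]
    by (intro harmonic_grad_add harmonic_grad_const harmonic_grad_sum harmonic_grad_cmult harmonic_grad_ln_norm eD)
      auto
  moreover have "0 \<le> w z" if z: "\<rho> \<le> cmod (z - p)" "z \<in> D" for z
  proof -
    have "ln (cmod (z - e i)) \<le> ln (cmod (z - p)) + c" if i: "i < n" for i
    proof -
      have "cmod (z - e i) \<le> cmod (z - p) + cmod (e i - p)"
        using norm_triangle_ineq4[of "z - p" "e i - p"] by simp
      also have "\<dots> \<le> cmod (z - p) + L * (cmod (z - p) / \<rho>)"
        using L(2)[OF e[OF i]] mult_left_mono[of 1 "cmod (z - p) / \<rho>" L] L(1) z \<rho>(1) by simp
      also have "\<dots> = cmod (z - p) * ((\<rho> + L) / \<rho>)"
        using \<rho>(1) by (simp add: field_simps)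
      finally have "ln (cmod (z - e i)) \<le> ln (cmod (z - p) * ((\<rho> + L) / \<rho>))"
        using eD[OF i] z by (intro ln_mono) auto
      also have "\<dots> = ln (cmod (z - p)) + c"
        unfolding c_def using z \<rho>(1) L(1) by (subst ln_mult_pos) auto
      finally show ?thesis .
    qed
    then have "(\<Sum>k<n. ln (cmod (z - e k))) \<le> (\<Sum>k<n. ln (cmod (z - p)) + c)"
      by (intro sum_mono) auto
    then have "(\<Sum>k<n. ln (cmod (z - e k))) / real n \<le> ln (cmod (z - p)) + c"
      using n by (simp add: field_simps)
    then show ?thesis
      by (simp add: w_def)
  qed
  then have "\<forall>z. \<rho> \<le> cmod (z - p) \<longrightarrow> z \<in> D \<longrightarrow> 0 \<le> \<beta> * ln (cmod (z - p)) + k z"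
    using \<beta>(1) unfolding wk[symmetric] by simp
  moreover have "\<beta> * ln (cmod (q - p)) + k q \<le> \<epsilon>"
  proof -
    have "(\<Sum>k<n. ln d) \<le> (\<Sum>k<n. ln (cmod (q - e k)))"
      using d(1) dq e by (intro sum_mono ln_mono) auto
    then have "ln d \<le> (\<Sum>k<n. ln (cmod (q - e k))) / real n"
      using n by (simp add: field_simps)
    then have "w q \<le> c0"
      unfolding w_def c0_def by linarith
    then have "\<beta> * w q \<le> \<beta> * c0"
      using \<beta>(1) by simp
    then show ?thesis
      using \<beta>(3) unfolding wk by linarith
  qed
  moreover define U where "U = {z. (\<Prod>k<n. cmod (z - e k)) < exp (- (real n * (M' - 1)))}"
  have "open U"
    unfolding U_def by (intro open_Collect_less continuous_intros)
  moreover have "C \<subseteq> U"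
  proof
    fix z assume "z \<in> C"
    then have "(\<Prod>k<n. cmod (z - e k)) \<le> exp (- (real n * M'))"
      by (rule small)
    also have "\<dots> < exp (- (real n * (M' - 1)))"
      using n by simp
    finally show "z \<in> U"
      by (simp add: U_def)
  qed
  moreover have "M \<le> \<beta> * ln (cmod (z - p)) + k z" if z: "z \<in> U \<inter> D" "\<rho> \<le> cmod (z - p)" for z
  proof -
    have ne: "z \<noteq> e i" if "i < n" for i
      using eD[OF that] z by auto
    have "(\<Sum>k<n. ln (cmod (z - e k))) = ln (\<Prod>k<n. cmod (z - e k))"
      using ne by (subst ln_prod) auto
    also have "\<dots> \<le> ln (exp (- (real n * (M' - 1))))"
      using z ne by (intro ln_mono prod_pos) (auto simp: U_def)
    finally have "(\<Sum>k<n. ln (cmod (z - e k))) \<le> real n * (1 - M')"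
      by (simp add: algebra_simps)
    then have "(\<Sum>k<n. ln (cmod (z - e k))) / real n \<le> 1 - M'"
      using n by (simp add: field_simps)
    moreover have "ln \<rho> \<le> ln (cmod (z - p))"
      using \<rho>(1) z by (intro ln_mono)
    ultimately have "M / \<beta> \<le> w z"
      unfolding w_def M'_def by linarith
    then have "M \<le> \<beta> * w z"
      using \<beta>(1) by (simp add: field_simps)
    then show ?thesis
      unfolding wk .
  qed
  ultimately show ?thesis
    using \<beta> by (intro exI[of _ \<beta>] exI[of _ k] exI[of _ U]) (auto intro: less_imp_le)
qed

text \<open>The boundary points where \<open>h\<close> fails to become smaller than \<epsilon> form
  a closed subset of \<open>E\<close>, possibly unbounded. A small multiple of log(|z - p| / \<rho>)
  dominates \<open>h\<close> far out, so the polynomial barrier has to deal only with a compact part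
  of that set. What remains of the region where \<open>h\<close> exceeds \<epsilon> plus the barrier
  stays away from the boundary and from infinity. The barrier is returned as a multiple of log|z -
  p| plus a harmonic function, so that its effect on the pole is visible.\<close>

lemma boundary_barrier:
  fixes h :: "complex \<Rightarrow> real"
  assumes D: "open D" "q \<in> D" and \<rho>: "\<rho> > 0" "\<rho> \<le> cmod (q - p)" "cball p \<rho> \<subseteq> D"
    and M: "\<And>z. z \<in> D - ball p \<rho> \<Longrightarrow> h z \<le> M"
    and E: "log_capacity E = 0"
    and bdry: "\<And>\<zeta>. \<zeta> \<in> frontier D - E \<Longrightarrow> \<exists>\<delta>>0. \<forall>z\<in>D. dist z \<zeta> < \<delta> \<longrightarrow> h z < \<epsilon>"
    and \<epsilon>: "\<epsilon> > 0"
  shows "\<exists>\<beta> k fk S. 0 \<le> \<beta> \<and> \<beta> \<le> \<epsilon> \<and> harmonic_grad k fk D \<and> compact S \<and> S \<subseteq> D \<and>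
    \<beta> * ln (cmod (q - p)) + k q \<le> \<epsilon> \<and> cball p \<rho> \<subseteq> S \<and>
    (\<forall>z\<in>D - ball p \<rho>. 0 \<le> \<beta> * ln (cmod (z - p)) + k z) \<and>
    (\<forall>z\<in>D - S. h z \<le> \<epsilon> + (\<beta> * ln (cmod (z - p)) + k z))"
proof -
  define F where "F = {\<zeta> \<in> frontier D. \<forall>\<delta>>0. \<exists>z\<in>D. dist z \<zeta> < \<delta> \<and> \<epsilon> \<le> h z}"
  have "closed F"
    unfolding closed_sequential_limits
  proof (intro allI impI, elim conjE)
    fix x l assume x: "\<forall>n. x n \<in> F" and lim: "x \<longlonglongrightarrow> l"
    have "l \<in> frontier D"
      using x lim frontier_closed[of D] unfolding closed_sequential_limits F_def by blast
    moreover have "\<exists>z\<in>D. dist z l < \<delta> \<and> \<epsilon> \<le> h z" if "\<delta> > 0" for \<delta>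
    proof -
      obtain n where n: "dist (x n) l < \<delta> / 2"
        using tendstoD[OF lim, of "\<delta> / 2"] \<open>\<delta> > 0\<close> unfolding eventually_sequentially
        by (meson half_gt_zero order_refl)
      have "x n \<in> F" "\<delta> / 2 > 0"
        using x that by auto
      then obtain z where z: "z \<in> D" "dist z (x n) < \<delta> / 2" "\<epsilon> \<le> h z"
        unfolding F_def by blast
      then have "dist z l < \<delta>"
        using dist_triangle[of z l "x n"] n by linarith
      then show ?thesis
        using z by blast
    qed
    ultimately show "l \<in> F"
      by (simp add: F_def)
  qed
  have FE: "F \<subseteq> E"
    using bdry unfolding F_def by (force simp: not_less)
  have FD: "F \<inter> D = {}"
    using D(1) by (auto simp: F_def frontier_def interior_open)
  define M' where "M' = max M 0"
  define l0 where "l0 = ln (cmod (q - p)) - ln \<rho>"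
  have l0: "l0 \<ge> 0"
    using ln_mono[OF \<rho>(2,1)] by (simp add: l0_def)
  \<comment> \<open>The additional term at \<open>q\<close> is \<delta> l0, which must use up at
    most half of \<epsilon>; the polynomial barrier gets the other half.\<close>
  define \<delta> where "\<delta> = min (\<epsilon> / 2) (\<epsilon> / 2 / (l0 + 1))"
  have \<delta>: "\<delta> > 0" "\<delta> \<le> \<epsilon> / 2" "\<delta> * l0 \<le> \<epsilon> / 2"
  proof -
    show "\<delta> \<le> \<epsilon> / 2"
      unfolding \<delta>_def by (rule min.cobounded1)
    show "\<delta> > 0"
      using \<epsilon> l0 by (simp add: \<delta>_def)
    have "\<delta> * l0 \<le> \<epsilon> / 2 / (l0 + 1) * (l0 + 1)"
      unfolding \<delta>_def using \<epsilon> l0 by (intro mult_mono min.cobounded2) auto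
    also have "\<dots> = \<epsilon> / 2"
    proof -
      have "x / y * y = x" if "y \<noteq> 0" for x y :: real
        using that by simp
      note * = this
      show ?thesis
        by (rule *) (use l0 in simp)
    qed
    finally show "\<delta> * l0 \<le> \<epsilon> / 2" .
  qed
  \<comment> \<open>The radius at which \<delta> log(|z - p| / \<rho>) reaches
    \<open>M'\<close>.\<close>
  define \<rho>1 where "\<rho>1 = \<rho> * exp (M' / \<delta>)"
  have \<rho>1: "M' \<le> \<delta> * (ln (cmod (z - p)) - ln \<rho>)" if "\<rho>1 \<le> cmod (z - p)" for z
  proof -
    have "ln \<rho>1 \<le> ln (cmod (z - p))"
      using that \<rho>(1) by (intro ln_mono) (auto simp: \<rho>1_def)
    then have "M' / \<delta> \<le> ln (cmod (z - p)) - ln \<rho>"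
      using \<rho>(1) by (simp add: \<rho>1_def ln_mult)
    then show ?thesis
      using \<delta>(1) by (simp add: field_simps)
  qed
  define C where "C = F \<inter> cball p \<rho>1"
  have "compact C"
    unfolding C_def using \<open>closed F\<close> by (intro closed_Int_compact) auto
  moreover have "C \<subseteq> E" "C \<inter> D = {}"
    using FE FD by (auto simp: C_def)
  ultimately have "\<exists>\<beta> k fk U. 0 \<le> \<beta> \<and> \<beta> \<le> \<epsilon> / 2 \<and> harmonic_grad k fk D \<and> open U \<and> C \<subseteq> U \<and>
    (\<forall>z. \<rho> \<le> cmod (z - p) \<longrightarrow> z \<in> D \<longrightarrow> 0 \<le> \<beta> * ln (cmod (z - p)) + k z) \<and>
    \<beta> * ln (cmod (q - p)) + k q \<le> \<epsilon> / 2 \<and>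
    (\<forall>z\<in>U \<inter> D. \<rho> \<le> cmod (z - p) \<longrightarrow> M' \<le> \<beta> * ln (cmod (z - p)) + k z)"
    using E \<epsilon> by (intro polar_compact_barrier[OF D \<rho>(1,2)]) auto
  then obtain \<beta> k fk U where \<beta>: "0 \<le> \<beta>" "\<beta> \<le> \<epsilon> / 2" and k: "harmonic_grad k fk D" and U: "open U" "C \<subseteq> U"
    and nonneg: "\<And>z. \<rho> \<le> cmod (z - p) \<Longrightarrow> z \<in> D \<Longrightarrow> 0 \<le> \<beta> * ln (cmod (z - p)) + k z"
    and kq: "\<beta> * ln (cmod (q - p)) + k q \<le> \<epsilon> / 2"
    and big: "\<And>z. z \<in> U \<Longrightarrow> z \<in> D \<Longrightarrow> \<rho> \<le> cmod (z - p) \<Longrightarrow> M' \<le> \<beta> * ln (cmod (z - p)) + k z"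
    by blast
  define b where "b z = (\<delta> + \<beta>) * ln (cmod (z - p)) + (k z + (- (\<delta> * ln \<rho>)))" for z
  have b: "b z = \<delta> * (ln (cmod (z - p)) - ln \<rho>) + (\<beta> * ln (cmod (z - p)) + k z)" for z
    by (simp add: b_def algebra_simps)
  have first_nonneg: "0 \<le> \<delta> * (ln (cmod (z - p)) - ln \<rho>)" if "\<rho> \<le> cmod (z - p)" for z
    using ln_mono[OF that \<rho>(1)] \<delta>(1) by simp
  have b_nonneg: "0 \<le> b z" if "z \<in> D - ball p \<rho>" for z
    using nonneg[of z] first_nonneg[of z] that unfolding b by (simp add: dist_norm norm_minus_commute)
  \<comment> \<open>The bad set. Its closure cannot meet the boundary: near \<open>F\<close> the
    barrier is at least \<open>M'\<close>, near every other boundary point \<open>h\<close> is below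
    \<epsilon>.\<close>
  define T where "T = {z \<in> D - ball p \<rho>. \<epsilon> + b z < h z}"
  have T\<rho>: "\<rho> \<le> cmod (z - p)" if "z \<in> T" for z
    using that by (simp add: T_def dist_norm norm_minus_commute)
  have hM: "h z \<le> M'" if "z \<in> T" for z
    using M[of z] that by (simp add: T_def M'_def)
  have "T \<subseteq> cball p \<rho>1"
  proof
    fix z assume z: "z \<in> T"
    show "z \<in> cball p \<rho>1"
    proof (rule ccontr)
      assume "z \<notin> cball p \<rho>1"
      then have "M' \<le> \<delta> * (ln (cmod (z - p)) - ln \<rho>)"
        by (intro \<rho>1) (simp add: dist_norm norm_minus_commute)
      then have "M' \<le> b z"
        using nonneg[OF T\<rho>[OF z]] z unfolding b by (simp add: T_def)
      then show False
        using z hM[OF z] \<epsilon> by (simp add: T_def)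
    qed
  qed
  then have clT: "closure T \<subseteq> cball p \<rho>1"
    by (intro closure_minimal) auto
  have "closure T \<subseteq> D"
  proof
    fix \<zeta> assume \<zeta>: "\<zeta> \<in> closure T"
    show "\<zeta> \<in> D"
    proof (rule ccontr)
      assume "\<zeta> \<notin> D"
      moreover have "\<zeta> \<in> closure D"
        using \<zeta> closure_mono[of T D] by (auto simp: T_def)
      ultimately have fr: "\<zeta> \<in> frontier D"
        using D(1) by (simp add: frontier_def interior_open)
      show False
      proof (cases "\<zeta> \<in> F")
        case True
        then have "\<zeta> \<in> U"
          using U(2) clT \<zeta> by (auto simp: C_def)
        then obtain z where z: "z \<in> T" "z \<in> U"
          using \<zeta> U(1) by (meson IntE all_not_in_conv open_Int_closure_eq_empty disjoint_iff)
        then have "M' \<le> \<beta> * ln (cmod (z - p)) + k z"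
          by (intro big T\<rho>) (auto simp: T_def)
        then have "M' \<le> b z"
          using first_nonneg[OF T\<rho>[OF z(1)]] unfolding b by simp
        then show False
          using z hM[OF z(1)] \<epsilon> by (simp add: T_def)
      next
        case False
        then obtain \<delta>' where \<delta>': "\<delta>' > 0" "\<And>z. z \<in> D \<Longrightarrow> dist z \<zeta> < \<delta>' \<Longrightarrow> h z < \<epsilon>"
          using fr by (force simp: F_def not_le)
        obtain z where z: "z \<in> T" "dist z \<zeta> < \<delta>'"
          using \<zeta> \<delta>'(1) by (auto simp: closure_approachable)
        then show False
          using \<delta>'(2)[of z] b_nonneg[of z] by (simp add: T_def)
      qed
    qed
  qed
  define S where "S = closure T \<union> cball p \<rho>"
  have "compact (closure T)"
    using clT bounded_subset[OF bounded_cball] by (auto simp: compact_eq_bounded_closed)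
  then have "compact S"
    unfolding S_def by (intro compact_Un) auto
  moreover have "S \<subseteq> D"
    using \<open>closure T \<subseteq> D\<close> \<rho>(3) by (auto simp: S_def)
  moreover have "h z \<le> \<epsilon> + b z" if z: "z \<in> D - S" for z
    using z closure_subset[of T] by (force simp: S_def T_def)
  moreover have "b q \<le> \<epsilon>"
    using kq \<delta>(3) unfolding b l0_def by linarith
  moreover have "harmonic_grad (\<lambda>z. k z + (- (\<delta> * ln \<rho>))) (\<lambda>z. fk z + 0) D"
    by (intro harmonic_grad_add k harmonic_grad_const)
  ultimately show ?thesis
    using \<beta> \<delta> b_nonneg unfolding b_def S_def
    by (intro exI[of _ "\<delta> + \<beta>"] exI[of _ "\<lambda>z. k z + (- (\<delta> * ln \<rho>))"] exI[of _ "\<lambda>z. fk z + 0"]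
        exI[of _ "closure T \<union> cball p \<rho>"]) (auto simp: S_def)
qed


section \<open>Circle averages\<close>

text \<open>The amount by which log(1/|z|) exceeds its mean over the circle of radius r about z, for
  z nonzero and |z| different from r. At z = 0 the convention for division and \<open>ln\<close>
  gives the value 0, which does not affect integrals.\<close>

definition log_bump :: "real \<Rightarrow> complex \<Rightarrow> real" where
  "log_bump r z = max 0 (ln (r / cmod z))"

lemma log_bump_measurable [measurable]: "log_bump r \<in> borel_measurable borel"
  unfolding log_bump_def[abs_def] by measurable

lemma log_bump_nonneg: "0 \<le> log_bump r z"
  by (simp add: log_bump_def)

lemma log_bump_eq_0: "r > 0 \<Longrightarrow> r \<le> cmod z \<Longrightarrow> log_bump r z = 0"
  by (cases "z = 0") (auto simp: log_bump_def ln_div intro!: max_absorb1)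

lemma ln_max_norm: "r > 0 \<Longrightarrow> z \<noteq> 0 \<Longrightarrow> ln (max (cmod z) r) = ln (cmod z) + log_bump r z"
  by (auto simp: log_bump_def max_def ln_div)

text \<open>Both signs of \<open>s\<close> are allowed because the adjoint of averaging with
  \<open>s\<close> is averaging with \<open>- s\<close>.\<close>

lemma log_pole_circle_mean:
  assumes W: "harmonic_grad W f D" "open D" and s: "s \<noteq> 0" and z: "cball z \<bar>s\<bar> \<subseteq> D" "z \<noteq> a" "cmod (z - a) \<noteq> \<bar>s\<bar>"
  shows "((\<lambda>t. W (z + of_real s * cis (2 * pi * t)) - \<alpha> * ln (cmod (z + of_real s * cis (2 * pi * t) - a)))
    has_integral W z - \<alpha> * ln (cmod (z - a)) - \<alpha> * log_bump \<bar>s\<bar> (z - a)) {0..1}"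
proof -
  have "((\<lambda>t. W (z + of_real s * cis (2 * pi * t))) has_integral W z) {0..1}"
  proof (cases "s > 0")
    case True
    then show ?thesis
      using harmonic_grad_mean_value[OF W, of z s] z by simp
  next
    case False
    \<comment> \<open>The case of negative \<open>s\<close> is reduced to a positive radius by the
      point reflection of the plane.\<close>
    have "harmonic_grad (\<lambda>x. W (- x)) (\<lambda>x. f (- x) * (- 1)) (uminus ` D)"
      using W by (intro harmonic_grad_compose[OF W(1)]) (auto intro!: derivative_eq_intros open_negations)
    moreover have "cball (- z) (- s) \<subseteq> uminus ` D"
    proof
      fix x assume "x \<in> cball (- z) (- s)"
      then have "cmod (z + x) \<le> - s"
        using norm_minus_commute[of "- z" x] by (simp add: dist_norm add.commute)
      then have "- x \<in> cball z \<bar>s\<bar>"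
        using False by (simp add: dist_norm)
      then show "x \<in> uminus ` D"
        using z(1) by (intro image_eqI[of _ _ "- x"]) auto
    qed
    ultimately have "((\<lambda>t. W (- (- z + of_real (- s) * cis (2 * pi * t)))) has_integral W (- (- z))) {0..1}"
      using W s False by (intro harmonic_grad_mean_value) (auto intro: open_negations)
    then show ?thesis
      by (simp add: add.commute)
  qed
  moreover have "((\<lambda>t. ln (cmod (z + of_real s * cis (2 * pi * t) - a))) has_integral
      ln (cmod (z - a)) + log_bump \<bar>s\<bar> (z - a)) {0..1}"
  proof (cases "s > 0")
    case True
    then show ?thesis
      using circle_mean_ln_norm[of s "z - a"] z ln_max_norm[of s "z - a"] by (simp add: algebra_simps)
  next
    case False
    have "cmod (a - z + of_real (- s) * cis (2 * pi * t)) = cmod (z + of_real s * cis (2 * pi * t) - a)" for t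
      by (subst norm_minus_commute[symmetric]) (simp add: algebra_simps norm_minus_commute)
    then show ?thesis
      using circle_mean_ln_norm[of "- s" "a - z"] z ln_max_norm[of "- s" "z - a"] False s
      by (simp add: norm_minus_commute)
  qed
  ultimately have "((\<lambda>t. W (z + of_real s * cis (2 * pi * t)) - \<alpha> * ln (cmod (z + of_real s * cis (2 * pi * t) - a)))
    has_integral W z - \<alpha> * (ln (cmod (z - a)) + log_bump \<bar>s\<bar> (z - a))) {0..1}"
    by (intro has_integral_diff has_integral_mult_right)
  then show ?thesis
    by (simp add: algebra_simps)
qed

text \<open>With values in \<open>ennreal\<close>, the order of integration may be exchanged without
  integrability conditions, and averages of functions with poles make sense.\<close>

definition circle_average :: "real \<Rightarrow> (complex \<Rightarrow> ennreal) \<Rightarrow> complex \<Rightarrow> ennreal" where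
  "circle_average s g z = (\<integral>\<^sup>+t. indicator {0..1} t * g (z + of_real s * cis (2 * pi * t)) \<partial>lborel)"

lemma circle_point_measurable [measurable]:
  "(\<lambda>x. fst x + of_real s * cis (2 * pi * snd x)) \<in> borel_measurable (borel \<Otimes>\<^sub>M borel)"
  "(\<lambda>t. z + of_real s * cis (2 * pi * t)) \<in> borel_measurable borel"
  by (simp_all add: borel_prod cis.ctr Complex_eq borel_measurable_continuous_onI continuous_intros)

lemma circle_average_measurable [measurable]:
  assumes [measurable]: "g \<in> borel_measurable borel"
  shows "circle_average s g \<in> borel_measurable borel"
proof -
  have "(\<lambda>z. \<integral>\<^sup>+t. indicator {0..1} t * g (z + of_real s * cis (2 * pi * t)) \<partial>lborel) \<in> borel_measurable borel"
    by (rule lborel.borel_measurable_nn_integral)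
      (use circle_point_measurable(1)[of s] in \<open>auto simp: split_beta' intro!: measurable_compose[OF _ assms]\<close>)
  then show ?thesis
    unfolding circle_average_def[abs_def] .
qed

text \<open>By translation invariance of Lebesgue measure.\<close>

lemma circle_average_adjoint:
  assumes [measurable]: "g \<in> borel_measurable borel" "h \<in> borel_measurable borel"
  shows "(\<integral>\<^sup>+z. g z * circle_average s h z \<partial>lborel) = (\<integral>\<^sup>+z. h z * circle_average (- s) g z \<partial>lborel)"
proof -
  have m: "(\<lambda>(z, t). indicator {0..1} t * (u z * v (z + of_real s * cis (2 * pi * t))))
      \<in> borel_measurable ((lborel :: complex measure) \<Otimes>\<^sub>M (lborel :: real measure))"
    if [measurable]: "u \<in> borel_measurable borel" "v \<in> borel_measurable borel" for u v :: "complex \<Rightarrow> ennreal" and s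
    using circle_point_measurable(1)[of s]
    by (auto simp: split_beta' intro!: borel_measurable_times_ennreal measurable_compose[OF _ that(2)])
  have e: "(\<integral>\<^sup>+z. u z * circle_average s v z \<partial>lborel) =
      (\<integral>\<^sup>+t. indicator {0..1} t * (\<integral>\<^sup>+z. u z * v (z + of_real s * cis (2 * pi * t)) \<partial>lborel) \<partial>lborel)"
    if [measurable]: "u \<in> borel_measurable borel" "v \<in> borel_measurable borel" for u v :: "complex \<Rightarrow> ennreal" and s
  proof -
    have "(\<integral>\<^sup>+z. u z * circle_average s v z \<partial>lborel) =
        (\<integral>\<^sup>+z. \<integral>\<^sup>+t. indicator {0..1} t * (u z * v (z + of_real s * cis (2 * pi * t))) \<partial>lborel \<partial>lborel)"
      unfolding circle_average_def
    proof (intro nn_integral_cong)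
      fix z
      have [measurable]: "(\<lambda>t. v (z + of_real s * cis (2 * pi * t))) \<in> borel_measurable lborel"
        using measurable_compose[OF circle_point_measurable(2) that(2)] by simp
      show "u z * (\<integral>\<^sup>+t. indicator {0..1} t * v (z + of_real s * cis (2 * pi * t)) \<partial>lborel) =
          (\<integral>\<^sup>+t. indicator {0..1} t * (u z * v (z + of_real s * cis (2 * pi * t))) \<partial>lborel)"
        unfolding mult.left_commute[of _ "u z"] by (rule nn_integral_cmult[symmetric]) measurable
    qed
    also have "\<dots> = (\<integral>\<^sup>+t. \<integral>\<^sup>+z. indicator {0..1} t * (u z * v (z + of_real s * cis (2 * pi * t))) \<partial>lborel \<partial>lborel)"
      by (rule lborel_pair.Fubini'[OF m, symmetric]) auto
    also have "\<dots> = (\<integral>\<^sup>+t. indicator {0..1} t * (\<integral>\<^sup>+z. u z * v (z + of_real s * cis (2 * pi * t)) \<partial>lborel) \<partial>lborel)"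
      by (intro nn_integral_cong nn_integral_cmult) auto
    finally show ?thesis .
  qed
  have "(\<integral>\<^sup>+z. g z * h (z + w) \<partial>lborel) = (\<integral>\<^sup>+z. h z * g (z - w) \<partial>lborel)" for w
  proof -
    have "(\<integral>\<^sup>+z. h z * g (z - w) \<partial>lborel) = (\<integral>\<^sup>+z. h z * g (z - w) \<partial>distr lborel borel ((+) w))"
      by (simp add: lborel_distr_plus)
    also have "\<dots> = (\<integral>\<^sup>+z. g z * h (z + w) \<partial>lborel)"
      by (subst nn_integral_distr) (auto simp: ac_simps)
    finally show ?thesis ..
  qed
  then show ?thesis
    unfolding e[OF assms] e[OF assms(2,1)] by simp
qed

text \<open>The bump is at most the number of natural numbers k with z in the disc of radius r
  exp(-k), and the areas of these discs form a geometric series with ratio exp(-2).\<close>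

lemma nn_integral_log_bump_finite:
  assumes r: "r > 0"
  shows "(\<integral>\<^sup>+z. ennreal (log_bump r z) \<partial>lborel) < \<infinity>"
proof -
  have "ennreal (log_bump r z) \<le> (\<Sum>k. indicator (cball 0 (r * exp (- real k))) z)" for z :: complex
  proof (cases "z = 0 \<or> r \<le> cmod z")
    case True
    then have "log_bump r z = 0"
      using r by (auto simp: log_bump_eq_0) (simp add: log_bump_def)
    then show ?thesis
      by simp
  next
    case False
    define x where "x = ln (r / cmod z)"
    have x: "x \<ge> 0"
      using False r by (simp add: x_def ln_ge_zero)
    define N where "N = nat \<lfloor>x\<rfloor>"
    have N: "real N \<le> x" "x \<le> real (Suc N)"
      using x by (auto simp: N_def) linarith+
    have "cmod z \<le> r * exp (- real k)" if "k \<le> N" for k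
    proof -
      have "cmod z = r * exp (- x)"
        using False r by (simp add: x_def exp_minus)
      also have "\<dots> \<le> r * exp (- real k)"
        using N that r by (intro mult_left_mono) auto
      finally show ?thesis .
    qed
    then have "(\<Sum>k\<le>N. indicator (cball 0 (r * exp (- real k))) z) = (\<Sum>k\<le>N. 1 :: ennreal)"
      by (intro sum.cong) auto
    moreover have "(\<Sum>k\<le>N. indicator (cball 0 (r * exp (- real k))) z) \<le>
        (\<Sum>k. indicator (cball 0 (r * exp (- real k))) z :: ennreal)"
      by (intro sum_le_suminf) auto
    moreover have "ennreal (log_bump r z) \<le> (\<Sum>k\<le>N. 1 :: ennreal)"
      using N(2) x by (simp add: log_bump_def x_def[symmetric] ennreal_of_nat_eq_real_of_nat del: ennreal_of_nat_eq_real_of_nat[symmetric])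
        (metis ennreal_leI ennreal_of_nat_eq_real_of_nat of_nat_Suc)
    ultimately show ?thesis
      by simp
  qed
  then have "(\<integral>\<^sup>+z. ennreal (log_bump r z) \<partial>lborel) \<le>
      (\<integral>\<^sup>+z. (\<Sum>k. indicator (cball (0 :: complex) (r * exp (- real k))) z) \<partial>lborel)"
    by (intro nn_integral_mono) auto
  also have "\<dots> = (\<Sum>k. emeasure lborel (cball (0 :: complex) (r * exp (- real k))))"
    by (subst nn_integral_suminf) (auto simp: borel_measurable_indicator_iff)
  also have "\<dots> = (\<Sum>k. ennreal (unit_ball_vol 2 * r\<^sup>2 * exp (- 2) ^ k))"
    using r by (intro suminf_cong)
      (simp add: emeasure_cball power_mult_distrib exp_of_nat_mult[symmetric] mult_ac power2_eq_square exp_add[symmetric])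
  also have "\<dots> = ennreal (\<Sum>k. unit_ball_vol 2 * r\<^sup>2 * exp (- 2) ^ k)"
    by (intro suminf_ennreal2 summable_mult summable_geometric) auto
  also have "\<dots> < \<infinity>"
    by simp
  finally show ?thesis .
qed

lemma nn_integral_log_bump_pos:
  assumes r: "r > 0"
  shows "0 < (\<integral>\<^sup>+z. ennreal (log_bump r z) \<partial>lborel)"
proof (rule ccontr)
  assume "\<not> ?thesis"
  then have "AE z in lborel. ennreal (log_bump r z) = 0"
    by (subst (asm) not_gr_zero, subst (asm) nn_integral_0_iff_AE) auto
  then have "AE z in lborel. z \<notin> ball 0 r - {0 :: complex}"
  proof eventually_elim
    case (elim z)
    show ?case
    proof
      assume "z \<in> ball 0 r - {0}"
      then have "ln (r / cmod z) > 0"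
        using r by (simp add: ln_div)
      then show False
        using elim by (simp add: log_bump_def max_def split: if_splits)
    qed
  qed
  then have "emeasure lborel (ball 0 r - {0 :: complex}) = 0"
    by (subst (asm) AE_iff_measurable[of "ball 0 r - {0}"]) auto
  moreover have "emeasure lborel (ball 0 r - {0 :: complex}) = emeasure lborel (ball (0 :: complex) r)"
    using r by (subst emeasure_Diff) auto
  moreover have "emeasure lborel (ball (0 :: complex) r) > 0"
    by (subst emeasure_ball) (use r in auto)
  ultimately show False
    by simp
qed

lemma nn_integral_log_bump_translate:
  "(\<integral>\<^sup>+z. ennreal (log_bump r (z - a)) \<partial>lborel) = (\<integral>\<^sup>+z. ennreal (log_bump r z) \<partial>lborel)"
proof -
  have "(\<integral>\<^sup>+z. ennreal (log_bump r (z - a)) \<partial>lborel) = (\<integral>\<^sup>+z. ennreal (log_bump r (z - a)) \<partial>distr lborel borel ((+) a))"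
    by (simp add: lborel_distr_plus)
  then show ?thesis
    by (subst (asm) nn_integral_distr) auto
qed

text \<open>Removes the positions excluded in the mean value formula: the centre at the pole, and
  the pole on the circle.\<close>

lemma AE_lborel_not_on_circle: "AE z in lborel. z \<noteq> a \<and> cmod (z - a) \<noteq> r"
proof -
  have "negligible (sphere a r)"
    by (rule negligible_sphere)
  then have "AE z in lebesgue. z \<notin> sphere a r"
    unfolding negligible_iff_null_sets by (rule AE_not_in)
  then have "AE z in lborel. z \<notin> sphere a r"
    by (subst (asm) AE_completion_iff) auto
  moreover have "AE z in lborel. z \<noteq> a"
    by (rule AE_lborel_singleton)
  ultimately show ?thesis
    by eventually_elim (auto simp: dist_norm norm_minus_commute)
qed


section \<open>Symmetry of the Green function\<close>

lemma harmonic_grad_log_pole: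
  assumes D: "open D" "p \<in> D" and u: "harmonic_grad u f (D - {p})"
    and pole: "\<forall>\<^sub>F z in at p. \<bar>u z + ln (cmod (z - p))\<bar> \<le> B"
  shows "\<exists>U fU. harmonic_grad U fU D \<and> (\<forall>z\<in>D - {p}. U z = u z + ln (cmod (z - p)))"
  by (rule harmonic_grad_removable_singularity[OF harmonic_grad_add[OF u harmonic_grad_ln_norm] D pole]) simp

text \<open>Written as a sum rather than a difference, since subtraction on \<open>ennreal\<close>
  truncates. Nonnegativity of \<open>g\<close> on the circle shows that the mean, that is g z minus
  the bump term, is a genuine nonnegative number.\<close>

lemma super_mean_log_pole:
  fixes g :: "complex \<Rightarrow> real"
  assumes W: "harmonic_grad W f D" "open D" and s: "s \<noteq> 0" and z: "cball z \<bar>s\<bar> \<subseteq> D" "z \<noteq> a" "cmod (z - a) \<noteq> \<bar>s\<bar>"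
    and g: "\<And>x. x \<in> D - {a} \<Longrightarrow> g x = W x - \<alpha> * ln (cmod (x - a))" "\<And>x. x \<in> D - {a} \<Longrightarrow> 0 \<le> g x"
    and \<alpha>: "0 \<le> \<alpha>"
  shows "circle_average s (\<lambda>x. ennreal (g x)) z + ennreal (\<alpha> * log_bump \<bar>s\<bar> (z - a)) = ennreal (g z)"
proof -
  define x where "x t = z + of_real s * cis (2 * pi * t)" for t
  have xz: "cmod (x t - z) = \<bar>s\<bar>" for t
    by (simp add: x_def norm_mult)
  have x: "x t \<in> D - {a}" for t
  proof -
    have "x t \<in> cball z \<bar>s\<bar>"
      using xz[of t] by (simp add: dist_norm norm_minus_commute)
    moreover have "x t \<noteq> a"
      using xz[of t] z(3) by (auto simp: norm_minus_commute)
    ultimately show ?thesis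
      using z(1) by auto
  qed
  have zD: "z \<in> D - {a}"
    using z by auto
  have "((\<lambda>t. W (x t) - \<alpha> * ln (cmod (x t - a))) has_integral
      W z - \<alpha> * ln (cmod (z - a)) - \<alpha> * log_bump \<bar>s\<bar> (z - a)) {0..1}"
    unfolding x_def by (rule log_pole_circle_mean[OF W s z])
  then have int: "((\<lambda>t. g (x t)) has_integral g z - \<alpha> * log_bump \<bar>s\<bar> (z - a)) {0..1}"
    using g(1)[OF x] g(1)[OF zD] by simp
  have nonneg: "0 \<le> g z - \<alpha> * log_bump \<bar>s\<bar> (z - a)"
    by (rule has_integral_nonneg[OF int]) (use g(2)[OF x] in auto)
  have "(\<integral>\<^sup>+t. ennreal (indicator {0..1} t * g (x t)) \<partial>lborel) = ennreal (g z - \<alpha> * log_bump \<bar>s\<bar> (z - a))"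
    using g(2)[OF x] int by (intro nn_integral_has_integral_lebesgue) auto
  moreover have "(\<integral>\<^sup>+t. ennreal (indicator {0..1} t * g (x t)) \<partial>lborel) = circle_average s (\<lambda>x. ennreal (g x)) z"
    unfolding circle_average_def x_def
    by (intro nn_integral_cong) (auto simp: indicator_def)
  ultimately show ?thesis
    using nonneg \<alpha> log_bump_nonneg by (simp add: ennreal_plus[symmetric] del: ennreal_plus)
qed

text \<open>The positive part has a mean at least that of the function and at least 0. So truncation
  turns the mean value identity into an inequality in the required direction.\<close>

lemma sub_mean_log_pole:
  fixes g :: "complex \<Rightarrow> real"
  assumes W: "harmonic_grad W f D" "open D" and s: "s \<noteq> 0" and z: "cball z \<bar>s\<bar> \<subseteq> D" "z \<noteq> a" "cmod (z - a) \<noteq> \<bar>s\<bar>"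
    and g: "\<And>x. x \<in> D - {a} \<Longrightarrow> g x = max 0 (W x - \<alpha> * ln (cmod (x - a)))" and \<alpha>: "0 \<le> \<alpha>"
  shows "ennreal (g z) \<le> circle_average s (\<lambda>x. ennreal (g x)) z + ennreal (\<alpha> * log_bump \<bar>s\<bar> (z - a))"
proof -
  define x where "x t = z + of_real s * cis (2 * pi * t)" for t
  have xz: "cmod (x t - z) = \<bar>s\<bar>" for t
    by (simp add: x_def norm_mult)
  have x: "x t \<in> D - {a}" for t
  proof -
    have "x t \<in> cball z \<bar>s\<bar>"
      using xz[of t] by (simp add: dist_norm norm_minus_commute)
    moreover have "x t \<noteq> a"
      using xz[of t] z(3) by (auto simp: norm_minus_commute)
    ultimately show ?thesis
      using z(1) by auto
  qed
  have zD: "z \<in> D - {a}"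
    using z by auto
  have "((\<lambda>t. W (x t) - \<alpha> * ln (cmod (x t - a))) has_integral
      W z - \<alpha> * ln (cmod (z - a)) - \<alpha> * log_bump \<bar>s\<bar> (z - a)) {0..1}"
    unfolding x_def by (rule log_pole_circle_mean[OF W s z])
  moreover have contx: "continuous_on {0..1} x"
    unfolding x_def[abs_def] by (intro continuous_intros)
  have "continuous_on {0..1} (\<lambda>t. max 0 (W (x t) - \<alpha> * ln (cmod (x t - a))))"
    using x by (intro continuous_intros contx
        continuous_on_compose2[OF harmonic_grad_continuous_on[OF W(1)] contx]) auto
  then have "(\<lambda>t. max 0 (W (x t) - \<alpha> * ln (cmod (x t - a)))) integrable_on {0..1}"
    by (rule integrable_continuous_real)
  then obtain J where J: "((\<lambda>t. max 0 (W (x t) - \<alpha> * ln (cmod (x t - a)))) has_integral J) {0..1}"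
    by blast
  ultimately have le: "W z - \<alpha> * ln (cmod (z - a)) - \<alpha> * log_bump \<bar>s\<bar> (z - a) \<le> J"
    by (rule has_integral_le) auto
  have J0: "0 \<le> J"
    by (rule has_integral_nonneg[OF J]) auto
  have "(\<integral>\<^sup>+t. ennreal (indicator {0..1} t * g (x t)) \<partial>lborel) = ennreal J"
    using J unfolding g[OF x] by (intro nn_integral_has_integral_lebesgue) auto
  moreover have "(\<integral>\<^sup>+t. ennreal (indicator {0..1} t * g (x t)) \<partial>lborel) = circle_average s (\<lambda>x. ennreal (g x)) z"
    unfolding circle_average_def x_def
    by (intro nn_integral_cong) (auto simp: indicator_def)
  ultimately have ca: "circle_average s (\<lambda>x. ennreal (g x)) z = ennreal J"
    by simp
  have "0 \<le> \<alpha> * log_bump \<bar>s\<bar> (z - a)"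
    using \<alpha> log_bump_nonneg by simp
  moreover from this have "g z \<le> J + \<alpha> * log_bump \<bar>s\<bar> (z - a)"
    using le J0 unfolding g[OF zD] by linarith
  ultimately show ?thesis
    unfolding ca using J0 by (simp add: ennreal_plus[symmetric] ennreal_leI del: ennreal_plus)
qed

lemma log_bump_ge: "L > 0 \<Longrightarrow> z \<noteq> 0 \<Longrightarrow> cmod z \<le> L \<Longrightarrow> 1 \<le> L \<Longrightarrow> - ln (cmod z) \<le> log_bump L z"
  by (auto simp: log_bump_def ln_div le_max_iff_disj)

lemma log_bump_le: "0 < d \<Longrightarrow> d \<le> cmod z \<Longrightarrow> 0 < L \<Longrightarrow> log_bump L z \<le> \<bar>ln (L / d)\<bar>"
proof -
  assume *: "0 < d" "d \<le> cmod z" "0 < L"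
  then have "ln (L / cmod z) \<le> ln (L / d)"
    by (intro ln_mono divide_left_mono divide_pos_pos mult_pos_pos) auto
  then show ?thesis
    by (auto simp: log_bump_def)
qed

text \<open>The poles are different, so near each of them the other factor is bounded, and the
  product is dominated by a sum of single logarithmic poles.\<close>

lemma product_of_log_poles_finite:
  fixes F G :: "complex \<Rightarrow> real"
  assumes S: "compact S" and pq: "p \<noteq> q" and \<alpha>: "\<alpha> \<ge> 1"
    and F: "\<And>z. z \<in> S - {p} \<Longrightarrow> 0 \<le> F z \<and> F z \<le> max 0 (C - \<alpha> * ln (cmod (z - p)))" "F p = 0" "\<And>z. z \<notin> S \<Longrightarrow> F z = 0"
    and G: "\<And>z. z \<in> S - {q} \<Longrightarrow> 0 \<le> G z \<and> G z \<le> C - ln (cmod (z - q))" "G q = 0" and C: "C \<ge> 0"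
  shows "(\<integral>\<^sup>+z. ennreal (F z) * ennreal (G z) \<partial>lborel) < \<infinity>"
proof -
  obtain L0 where L0: "L0 > 0" "\<And>z. z \<in> S \<Longrightarrow> cmod z \<le> L0"
    using compact_imp_bounded[OF S] bounded_pos by blast
  define L where "L = L0 + cmod p + cmod q + 1"
  have L: "L > 0" "1 \<le> L"
    using L0(1) by (auto simp: L_def intro: add_nonneg_pos)
  have Lp: "cmod (z - p) \<le> L" "cmod (z - q) \<le> L" if "z \<in> S" for z
    using L0(2)[OF that] norm_triangle_ineq4[of z p] norm_triangle_ineq4[of z q] norm_ge_zero[of p] norm_ge_zero[of q]
    unfolding L_def by linarith+
  define d where "d = cmod (p - q) / 2"
  have d: "d > 0"
    using pq by (simp add: d_def)
  define K where "K = \<bar>ln (L / d)\<bar>"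
  \<comment> \<open>Majorises the coefficients of 1, \<open>P\<close> and \<open>Q\<close> after the
    product of the two bounds is expanded and P Q is replaced by K (P + Q).\<close>
  define A where "A = C * C + \<alpha> * (C + K)"
  have K: "K \<ge> 0"
    by (simp add: K_def)
  have A: "A \<ge> 0" "C * C \<le> A" "C + \<alpha> * K \<le> A" "\<alpha> * C + \<alpha> * K \<le> A"
  proof -
    have "C * 1 \<le> \<alpha> * C"
      using C \<alpha> by (subst mult.commute) (intro mult_right_mono)
    moreover have "0 \<le> \<alpha> * K" "0 \<le> \<alpha> * C" "0 \<le> C * C"
      using C \<alpha> K by auto
    ultimately show "A \<ge> 0" "C * C \<le> A" "C + \<alpha> * K \<le> A" "\<alpha> * C + \<alpha> * K \<le> A"
      unfolding A_def distrib_left by linarith+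
  qed
  define P Q where "P z = log_bump L (z - p)" and "Q z = log_bump L (z - q)" for z
  have PQ: "0 \<le> P z" "0 \<le> Q z" for z
    by (auto simp: P_def Q_def log_bump_nonneg)
  have "ennreal (F z) * ennreal (G z) \<le> ennreal A * (indicator S z + ennreal (P z) + ennreal (Q z))" for z
  proof (cases "z \<in> S - {p, q}")
    case True
    then have z: "z \<in> S" "z \<in> S - {p}" "z \<in> S - {q}"
      by auto
    have "F z \<le> C + \<alpha> * P z"
    proof -
      have "\<alpha> * (- ln (cmod (z - p))) \<le> \<alpha> * P z"
        unfolding P_def using L Lp[OF z(1)] z \<alpha> by (intro mult_left_mono log_bump_ge) auto
      moreover have "0 \<le> C + \<alpha> * P z"
        using C \<alpha> PQ(1)[of z] by simp
      ultimately show ?thesis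
        using F(1)[OF z(2)] by (auto simp: max_def split: if_splits)
    qed
    moreover have "G z \<le> C + Q z"
    proof -
      have "- ln (cmod (z - q)) \<le> Q z"
        unfolding Q_def using L Lp[OF z(1)] z by (intro log_bump_ge) auto
      then show ?thesis
        using G(1)[OF z(3)] by simp
    qed
    ultimately have "F z * G z \<le> (C + \<alpha> * P z) * (C + Q z)"
      using F(1)[OF z(2)] G(1)[OF z(3)] by (intro mult_mono) auto
    also have "\<dots> = C * C + C * Q z + \<alpha> * C * P z + \<alpha> * (P z * Q z)"
      by (simp add: algebra_simps)
    \<comment> \<open>\<open>z\<close> is at distance at least \<open>d\<close>, half the distance
      of the poles, from one of them, and the bump there is at most \<open>K\<close>.\<close>
    also have "P z * Q z \<le> K * (P z + Q z)"
    proof -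
      have "2 * d \<le> cmod (z - p) + cmod (z - q)"
        using norm_triangle_ineq4[of "z - q" "z - p"] by (simp add: d_def)
      then have "d \<le> cmod (z - p) \<or> d \<le> cmod (z - q)"
        by linarith
      then show ?thesis
      proof
        assume "d \<le> cmod (z - p)"
        then have "P z \<le> K"
          unfolding P_def K_def using d L by (intro log_bump_le)
        then have "P z * Q z \<le> K * Q z"
          using PQ by (intro mult_right_mono)
        then show ?thesis
          using mult_nonneg_nonneg[OF K PQ(1)[of z]] by (simp add: distrib_left)
      next
        assume "d \<le> cmod (z - q)"
        then have "Q z \<le> K"
          unfolding Q_def K_def using d L by (intro log_bump_le)
        then have "P z * Q z \<le> P z * K"
          using PQ by (intro mult_left_mono)
        then show ?thesis
          using mult_nonneg_nonneg[OF K PQ(2)[of z]] by (simp add: distrib_left mult.commute)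
      qed
    qed
    also have "C * C + C * Q z + \<alpha> * C * P z + \<alpha> * (K * (P z + Q z)) =
        C * C + (\<alpha> * C + \<alpha> * K) * P z + (C + \<alpha> * K) * Q z"
      by (simp add: algebra_simps)
    also have "\<dots> \<le> A + A * P z + A * Q z"
      using A PQ by (intro add_mono mult_right_mono) auto
    finally have "F z * G z \<le> A * (1 + P z + Q z)"
      using \<alpha> by (simp add: algebra_simps)
    then have "ennreal (F z * G z) \<le> ennreal (A * (1 + P z + Q z))"
      by (rule ennreal_leI)
    then show ?thesis
      using z F(1)[OF z(2)] G(1)[OF z(3)] A PQ
      by (simp add: ennreal_mult[symmetric] ennreal_plus[symmetric] ennreal_1[symmetric] del: ennreal_plus ennreal_1)
  next
    case False
    then have "F z = 0 \<or> G z = 0"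
      using F(2,3) G(2) by auto
    then show ?thesis
      by auto
  qed
  then have "(\<integral>\<^sup>+z. ennreal (F z) * ennreal (G z) \<partial>lborel) \<le>
      (\<integral>\<^sup>+z. ennreal A * (indicator S z + ennreal (P z) + ennreal (Q z)) \<partial>lborel)"
    by (intro nn_integral_mono)
  also have "\<dots> = ennreal A * (emeasure lborel S + (\<integral>\<^sup>+z. ennreal (P z) \<partial>lborel) + (\<integral>\<^sup>+z. ennreal (Q z) \<partial>lborel))"
    using borel_compact[OF S] unfolding P_def Q_def
    by (subst nn_integral_cmult) (auto simp: nn_integral_add)
  also have "\<dots> < \<infinity>"
    using nn_integral_log_bump_finite[OF L(1)] emeasure_compact_finite[OF S]
    unfolding P_def Q_def nn_integral_log_bump_translate by (auto simp: ennreal_mult_less_top)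
  finally show ?thesis .
qed

text \<open>Let X be the integral of \<phi> v and Y that of \<phi> times the average of v. The
  identity for v - A v gives X = Y plus an integral of \<phi> against the bump at q. The inequality
  for \<phi> and self-adjointness give X at most Y plus an integral of v against the bump at p.
  Cancelling Y compares local means of \<phi> at q and of v at p. Exchanging the roles of the two
  poles yields symmetry.\<close>

lemma planar_green_le:
  fixes u v :: "complex \<Rightarrow> real"
  assumes D: "open D" "p \<in> D" "q \<in> D" "p \<noteq> q"
    and u: "harmonic_grad u fu (D - {p})" "\<And>z. z \<in> D - {p} \<Longrightarrow> 0 \<le> u z"
    and v: "harmonic_grad v fv (D - {q})" "\<And>z. z \<in> D - {q} \<Longrightarrow> 0 \<le> v z"
    and pole_u: "\<forall>\<^sub>F z in at p. \<bar>u z + ln (cmod (z - p))\<bar> \<le> Bu"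
    and pole_v: "\<forall>\<^sub>F z in at q. \<bar>v z + ln (cmod (z - q))\<bar> \<le> Bv"
    and away: "\<And>\<rho>. \<rho> > 0 \<Longrightarrow> \<exists>M. \<forall>z\<in>D - ball p \<rho>. u z \<le> M"
    and E: "log_capacity E = 0"
    and bdry: "\<And>\<zeta> \<epsilon>. \<zeta> \<in> frontier D - E \<Longrightarrow> \<epsilon> > 0 \<Longrightarrow> \<exists>\<delta>>0. \<forall>z\<in>D. dist z \<zeta> < \<delta> \<longrightarrow> u z < \<epsilon>"
  shows "u q \<le> v p"
proof -
  obtain U fU where U: "harmonic_grad U fU D" "\<And>z. z \<in> D - {p} \<Longrightarrow> U z = u z + ln (cmod (z - p))"
    using harmonic_grad_log_pole[OF D(1,2) u(1) pole_u] by blast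
  obtain V fV where V: "harmonic_grad V fV D" "\<And>z. z \<in> D - {q} \<Longrightarrow> V z = v z + ln (cmod (z - q))"
    using harmonic_grad_log_pole[OF D(1,3) v(1) pole_v] by blast
  \<comment> \<open>The loss of 3 \<epsilon> consists of the constant subtracted from
    \<open>u\<close>, the value of the barrier at \<open>q\<close>, and the variation of \<psi> over
    the small disc about \<open>q\<close>.\<close>
  have main: "u q - 3 * \<epsilon> \<le> (1 + \<epsilon>) * (v p + \<epsilon>)" if \<epsilon>: "\<epsilon> > 0" for \<epsilon>
  proof -
    obtain \<rho>0 where \<rho>0: "\<rho>0 > 0" "cball p \<rho>0 \<subseteq> D"
      using D(1,2) open_contains_cball by blast
    \<comment> \<open>The barrier is controlled only outside the disc of radius \<rho>, so
      \<open>q\<close> must not lie in its interior.\<close>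
    define \<rho> where "\<rho> = min \<rho>0 (cmod (q - p))"
    have \<rho>: "\<rho> > 0" "\<rho> \<le> cmod (q - p)" "cball p \<rho> \<subseteq> D"
      using \<rho>0 D(4) by (auto simp: \<rho>_def)
    obtain M where M: "\<And>z. z \<in> D - ball p \<rho> \<Longrightarrow> u z \<le> M"
      using away[OF \<rho>(1)] by blast
    obtain \<beta> k fk S where \<beta>: "0 \<le> \<beta>" "\<beta> \<le> \<epsilon>" and k: "harmonic_grad k fk D"
      and S: "compact S" "S \<subseteq> D" "cball p \<rho> \<subseteq> S" and kq: "\<beta> * ln (cmod (q - p)) + k q \<le> \<epsilon>"
      and out: "\<And>z. z \<in> D - S \<Longrightarrow> u z \<le> \<epsilon> + (\<beta> * ln (cmod (z - p)) + k z)"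
      using boundary_barrier[OF D(1,3) \<rho> M E bdry[OF _ \<epsilon>] \<epsilon>] by blast
    define W where "W z = (U z + (-1) * k z) + (- \<epsilon>)" for z
    have W: "harmonic_grad W (\<lambda>z. (fU z + of_real (-1) * fk z) + 0) D"
      unfolding W_def[abs_def] by (intro harmonic_grad_add harmonic_grad_cmult harmonic_grad_const U(1) k)
    define \<psi> where "\<psi> z = W z - (1 + \<beta>) * ln (cmod (z - p))" for z
    have \<psi>: "\<psi> z = u z - \<epsilon> - (\<beta> * ln (cmod (z - p)) + k z)" if "z \<in> D - {p}" for z
      using U(2)[OF that] by (simp add: \<psi>_def W_def algebra_simps)
    have cont_\<psi>: "continuous_on (D - {p}) \<psi>"
      unfolding \<psi>_def[abs_def]
      by (intro continuous_intros continuous_on_subset[OF harmonic_grad_continuous_on[OF W]]) auto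
    \<comment> \<open>Extension by 0 to the plane, and at the pole, gives Borel functions on all of
      the plane, as the adjointness of the averages requires.\<close>
    define \<phi> where "\<phi> z = indicator (D - {p}) z *\<^sub>R max 0 (\<psi> z)" for z
    define v0 where "v0 z = indicator (D - {q}) z *\<^sub>R v z" for z
    have [measurable]: "\<phi> \<in> borel_measurable borel" "v0 \<in> borel_measurable borel"
      unfolding \<phi>_def[abs_def] v0_def[abs_def] using D(1) cont_\<psi> harmonic_grad_continuous_on[OF v(1)]
      by (intro borel_measurable_continuous_on_indicator continuous_intros; auto intro: borel_open open_delete)+
    have \<phi>_out: "\<phi> z = 0" if "z \<notin> S" for z
    proof (cases "z \<in> D - {p}")
      case True
      then show ?thesis
        using out[of z] that \<psi>[OF True] by (simp add: \<phi>_def)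
    qed (simp add: \<phi>_def)
    obtain e where e: "e > 0" "(\<Union>x\<in>S. ball x e) \<subseteq> D"
      using compact_subset_open_imp_ball_epsilon_subset[OF S(1) D(1) S(2)] by blast
    have "isCont \<psi> q" "isCont v p"
      using cont_\<psi> harmonic_grad_continuous_on[OF v(1)] D
      by (auto simp: continuous_on_eq_continuous_at open_delete)
    then have "\<forall>\<^sub>F z in nhds q. \<psi> q - \<epsilon> < \<psi> z \<and> z \<in> D - {p}" "\<forall>\<^sub>F z in nhds p. v z < v p + \<epsilon> \<and> z \<in> D - {q}"
      using \<epsilon> D unfolding isCont_def tendsto_at_iff_tendsto_nhds
      by (intro eventually_conj eventually_nhds_in_open open_delete; auto elim!: order_tendstoD)+
    then obtain dq dp where dq: "dq > 0" "\<And>z. dist z q < dq \<Longrightarrow> \<psi> q - \<epsilon> < \<psi> z \<and> z \<in> D - {p}"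
      and dp: "dp > 0" "\<And>z. dist z p < dp \<Longrightarrow> v z < v p + \<epsilon> \<and> z \<in> D - {q}"
      unfolding eventually_nhds_metric by blast
    \<comment> \<open>Circles of radius \<open>r\<close> about points of \<open>S\<close> stay in
      \<open>D\<close>, and on the discs about \<open>q\<close> and \<open>p\<close> the functions
      \<psi> and \<open>v\<close> are within \<epsilon> of the needed bounds.\<close>
    define r where "r = min e (min dq dp) / 2"
    have r: "r > 0" "r < e" "r < dq" "r < dp"
      using e(1) dq(1) dp(1) by (auto simp: r_def)
    have in_D: "cball z r \<subseteq> D" if "z \<in> S" for z
      using e(2) r(2) that by (force simp: subset_eq)
    let ?A = "circle_average r (\<lambda>x. ennreal (v0 x))"
    let ?B = "circle_average (- r) (\<lambda>x. ennreal (\<phi> x))"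
    have A: "AE z in lborel. ennreal (\<phi> z) * ennreal (v0 z) =
        ennreal (\<phi> z) * ?A z + ennreal (\<phi> z) * ennreal (log_bump r (z - q))"
      using AE_lborel_not_on_circle[of q r]
    proof eventually_elim
      case (elim z)
      show ?case
      proof (cases "z \<in> S")
        case True
        have "?A z + ennreal (1 * log_bump \<bar>r\<bar> (z - q)) = ennreal (v0 z)"
          using elim r(1) in_D[OF True] V(2) v(2)
          by (intro super_mean_log_pole[OF V(1) D(1)]) (auto simp: v0_def)
        then show ?thesis
          using r(1) by (simp add: distrib_left[symmetric])
      qed (simp add: \<phi>_out)
    qed
    have B: "AE z in lborel. ennreal (\<phi> z) \<le> ?B z + ennreal ((1 + \<beta>) * log_bump r (z - p))"
      using AE_lborel_not_on_circle[of p r]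
    proof eventually_elim
      case (elim z)
      show ?case
      proof (cases "z \<in> S")
        case True
        have "ennreal (\<phi> z) \<le> ?B z + ennreal ((1 + \<beta>) * log_bump \<bar>- r\<bar> (z - p))"
          using elim r(1) in_D[OF True] \<beta>(1)
          by (intro sub_mean_log_pole[OF W D(1)]) (auto simp: \<phi>_def \<psi>_def)
        then show ?thesis
          using r(1) by simp
      qed (simp add: \<phi>_out)
    qed
    define X where "X = (\<integral>\<^sup>+z. ennreal (\<phi> z) * ennreal (v0 z) \<partial>lborel)"
    define Y where "Y = (\<integral>\<^sup>+z. ennreal (\<phi> z) * ?A z \<partial>lborel)"
    define c where "c = (\<integral>\<^sup>+z. ennreal (log_bump r z) \<partial>lborel)"
    have XY: "X = Y + (\<integral>\<^sup>+z. ennreal (\<phi> z) * ennreal (log_bump r (z - q)) \<partial>lborel)"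
      unfolding X_def Y_def by (subst nn_integral_cong_AE[OF A], subst nn_integral_add) auto
    have "X \<le> (\<integral>\<^sup>+z. ennreal (v0 z) * (?B z + ennreal ((1 + \<beta>) * log_bump r (z - p))) \<partial>lborel)"
      unfolding X_def
      by (rule nn_integral_mono_AE) (use B in eventually_elim, subst mult.commute, auto intro: mult_left_mono)
    also have "\<dots> = (\<integral>\<^sup>+z. ennreal (v0 z) * ?B z \<partial>lborel) +
        (\<integral>\<^sup>+z. ennreal (v0 z) * ennreal ((1 + \<beta>) * log_bump r (z - p)) \<partial>lborel)"
      unfolding distrib_left by (subst nn_integral_add) auto
    also have "(\<integral>\<^sup>+z. ennreal (v0 z) * ?B z \<partial>lborel) = Y"
      unfolding Y_def by (rule circle_average_adjoint[symmetric]) auto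
    finally have XY': "X \<le> Y + (\<integral>\<^sup>+z. ennreal (v0 z) * ennreal ((1 + \<beta>) * log_bump r (z - p)) \<partial>lborel)" .
    have "X < \<infinity>"
    proof -
      have "compact (W ` S)" "compact (V ` S)"
        using S harmonic_grad_continuous_on[OF W] harmonic_grad_continuous_on[OF V(1)]
        by (auto intro!: compact_continuous_image continuous_on_subset[OF _ S(2)])
      then obtain C1 C2 where C: "\<And>z. z \<in> S \<Longrightarrow> \<bar>W z\<bar> \<le> C1" "\<And>z. z \<in> S \<Longrightarrow> \<bar>V z\<bar> \<le> C2"
        by (metis bounded_iff compact_imp_bounded imageI real_norm_def)
      define C where "C = \<bar>C1\<bar> + \<bar>C2\<bar>"
      have WC: "\<phi> z \<le> max 0 (C - (1 + \<beta>) * ln (cmod (z - p)))" if "z \<in> S" for z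
        using C(1)[OF that] by (auto simp: \<phi>_def \<psi>_def C_def indicator_def)
      show ?thesis
        unfolding X_def
      proof (rule product_of_log_poles_finite[OF S(1) D(4)])
        show "0 \<le> v0 z \<and> v0 z \<le> C - ln (cmod (z - q))" if "z \<in> S - {q}" for z
          using that S(2) V(2)[of z] v(2)[of z] C(2)[of z] by (auto simp: v0_def C_def)
        show "0 \<le> \<phi> z \<and> \<phi> z \<le> max 0 (C - (1 + \<beta>) * ln (cmod (z - p)))" if "z \<in> S - {p}" for z
          using WC[of z] that by (auto simp: \<phi>_def)
      qed (use \<beta>(1) \<phi>_out in \<open>auto simp: \<phi>_def v0_def C_def\<close>)
    qed
    \<comment> \<open>Finiteness of \<open>X\<close> passes to its summand \<open>Y\<close>, which
      can then be cancelled.\<close>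
    then have "Y \<noteq> \<infinity>"
      using XY by (auto simp: less_top[symmetric])
    moreover have "Y + (\<integral>\<^sup>+z. ennreal (\<phi> z) * ennreal (log_bump r (z - q)) \<partial>lborel) \<le>
        Y + (\<integral>\<^sup>+z. ennreal (v0 z) * ennreal ((1 + \<beta>) * log_bump r (z - p)) \<partial>lborel)"
      using XY XY' by simp
    ultimately have le: "(\<integral>\<^sup>+z. ennreal (\<phi> z) * ennreal (log_bump r (z - q)) \<partial>lborel) \<le>
        (\<integral>\<^sup>+z. ennreal (v0 z) * ennreal ((1 + \<beta>) * log_bump r (z - p)) \<partial>lborel)"
      by (simp add: ennreal_add_left_cancel_le)
    have "ennreal (\<psi> q - \<epsilon>) * c = (\<integral>\<^sup>+z. ennreal (\<psi> q - \<epsilon>) * ennreal (log_bump r (z - q)) \<partial>lborel)"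
      unfolding c_def by (subst nn_integral_log_bump_translate[of r q, symmetric], subst nn_integral_cmult) auto
    also have "\<dots> \<le> (\<integral>\<^sup>+z. ennreal (\<phi> z) * ennreal (log_bump r (z - q)) \<partial>lborel)"
    proof (rule nn_integral_mono)
      fix z
      show "ennreal (\<psi> q - \<epsilon>) * ennreal (log_bump r (z - q)) \<le> ennreal (\<phi> z) * ennreal (log_bump r (z - q))"
      proof (cases "r \<le> cmod (z - q)")
        case False
        then have "dist z q < dq"
          using r(3) by (simp add: dist_norm)
        then have "\<psi> q - \<epsilon> \<le> \<phi> z"
          using dq(2)[of z] by (auto simp: \<phi>_def)
        then show ?thesis
          by (intro mult_right_mono ennreal_leI) auto
      qed (use r(1) in \<open>simp add: log_bump_eq_0\<close>)
    qed
    also note le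
    also have "(\<integral>\<^sup>+z. ennreal (v0 z) * ennreal ((1 + \<beta>) * log_bump r (z - p)) \<partial>lborel) \<le>
        (\<integral>\<^sup>+z. ennreal ((1 + \<beta>) * (v p + \<epsilon>)) * ennreal (log_bump r (z - p)) \<partial>lborel)"
    proof (rule nn_integral_mono)
      fix z
      show "ennreal (v0 z) * ennreal ((1 + \<beta>) * log_bump r (z - p)) \<le>
          ennreal ((1 + \<beta>) * (v p + \<epsilon>)) * ennreal (log_bump r (z - p))"
      proof (cases "r \<le> cmod (z - p)")
        case False
        then have "dist z p < dp"
          using r(4) by (simp add: dist_norm)
        then have v0z: "0 \<le> v0 z" "v0 z \<le> v p + \<epsilon>"
          using dp(2)[of z] v(2)[of z] by (auto simp: v0_def)
        have "v0 z * ((1 + \<beta>) * log_bump r (z - p)) \<le> (v p + \<epsilon>) * ((1 + \<beta>) * log_bump r (z - p))"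
          using v0z \<beta>(1) log_bump_nonneg by (intro mult_right_mono) auto
        then have "ennreal (v0 z * ((1 + \<beta>) * log_bump r (z - p))) \<le>
            ennreal ((1 + \<beta>) * (v p + \<epsilon>) * log_bump r (z - p))"
          by (intro ennreal_leI) (simp add: mult_ac)
        then show ?thesis
          using v0z \<beta>(1) log_bump_nonneg by (subst (1 2) ennreal_mult[symmetric]) auto
      qed (use r(1) in \<open>simp add: log_bump_eq_0\<close>)
    qed
    also have "\<dots> = ennreal ((1 + \<beta>) * (v p + \<epsilon>)) * c"
      unfolding c_def by (subst nn_integral_log_bump_translate[of r p, symmetric], subst nn_integral_cmult) auto
    finally have "ennreal (\<psi> q - \<epsilon>) * c \<le> ennreal ((1 + \<beta>) * (v p + \<epsilon>)) * c" .
    then have "ennreal (\<psi> q - \<epsilon>) \<le> ennreal ((1 + \<beta>) * (v p + \<epsilon>))"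
      using nn_integral_log_bump_pos[OF r(1)] nn_integral_log_bump_finite[OF r(1)]
      unfolding c_def[symmetric] by (subst (asm) (1 2) mult.commute, subst (asm) ennreal_mult_le_mult_iff) auto
    moreover have vp: "0 \<le> (1 + \<beta>) * (v p + \<epsilon>)"
      using v(2)[of p] D \<epsilon> \<beta>(1) by simp
    ultimately have "\<psi> q - \<epsilon> \<le> (1 + \<beta>) * (v p + \<epsilon>)"
      by (simp add: ennreal_le_iff)
    moreover have "u q - 2 * \<epsilon> \<le> \<psi> q"
      using \<psi>[of q] D kq by simp
    moreover have "(1 + \<beta>) * (v p + \<epsilon>) \<le> (1 + \<epsilon>) * (v p + \<epsilon>)"
      using v(2)[of p] D \<epsilon> \<beta> by (intro mult_right_mono) auto
    ultimately show ?thesis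
      by linarith
  qed
  show ?thesis
  proof (rule field_le_epsilon)
    fix e :: real assume e: "e > 0"
    have vp: "0 \<le> v p"
      using v(2)[of p] D by simp
    \<comment> \<open>For \<epsilon> at most 1, (1 + \<epsilon>) (v p + \<epsilon>) + 3 \<epsilon>
      is at most v p + \<epsilon> (v p + 5).\<close>
    define \<epsilon> where "\<epsilon> = min 1 (e / (v p + 5))"
    have \<epsilon>: "\<epsilon> > 0" "\<epsilon> \<le> 1" "\<epsilon> \<le> e / (v p + 5)"
      using e vp by (auto simp: \<epsilon>_def)
    have "\<epsilon> * (v p + 5) \<le> e"
      using \<epsilon>(3) vp by (simp add: pos_le_divide_eq)
    moreover have "\<epsilon> * \<epsilon> \<le> \<epsilon>"
      using \<epsilon> by (intro mult_left_le) auto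
    ultimately show "u q \<le> v p + e"
      using main[OF \<epsilon>(1)] by (simp add: algebra_simps)
  qed
qed

section \<open>From the sphere to the plane\<close>

lemma sphere_open_preimage:
  assumes "openin riemann_sphere V"
  shows "open {z. Some z \<in> V}"
proof -
  consider U where "open U" "V = Some ` U" | C where "closed C" "V = insert None (Some ` (- C))"
    using assms unfolding riemann_sphere_def openin_Alexandroff_compactification
    by (auto simp: Compl_eq_Diff_UNIV)
  then show ?thesis
  proof cases
    case 1
    then have "{z. Some z \<in> V} = U"
      by auto
    with 1 show ?thesis by simp
  next
    case 2
    then have "{z. Some z \<in> V} = - C"
      by auto
    with 2 show ?thesis by (simp add: open_Compl)
  qed
qed

lemma frontier_sphere:
  assumes D: "openin riemann_sphere D" and \<zeta>: "\<zeta> \<in> frontier {z. Some z \<in> D}"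
  shows "Some \<zeta> \<in> riemann_sphere frontier_of D"
proof -
  have cl: "\<zeta> \<in> closure {z. Some z \<in> D}" and nD: "Some \<zeta> \<notin> D"
    using \<zeta> sphere_open_preimage[OF D] by (auto simp: frontier_def interior_open)
  have "\<exists>y\<in>D. y \<in> T" if "Some \<zeta> \<in> T" "openin riemann_sphere T" for T
  proof -
    have "open {z. Some z \<in> T}" "\<zeta> \<in> {z. Some z \<in> T}"
      using that sphere_open_preimage by auto
    then have "{z. Some z \<in> T} \<inter> {z. Some z \<in> D} \<noteq> {}"
      using cl open_Int_closure_eq_empty[of "{z. Some z \<in> T}" "{z. Some z \<in> D}"] by blast
    then show ?thesis
      by blast
  qed
  then have "Some \<zeta> \<in> riemann_sphere closure_of D"
    unfolding in_closure_of by (auto simp: riemann_sphere_def)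
  moreover have "Some \<zeta> \<notin> riemann_sphere interior_of D"
    using nD interior_of_subset[of riemann_sphere D] by auto
  ultimately show ?thesis
    by (simp add: frontier_of_def)
qed

lemma green_functionD:
  assumes "green_function D g" "p \<in> D"
  shows "\<And>q. q \<in> D \<Longrightarrow> 0 \<le> g q p"
    and "sphere_harmonic_on (\<lambda>q. g q p) (D - {p})"
    and "\<And>U. openin riemann_sphere U \<Longrightarrow> p \<in> U \<Longrightarrow> \<exists>B. \<forall>q \<in> D - U. g q p \<le> ereal B"
    and "log_pole (\<lambda>q. g q p) p"
    and "quasi_everywhere_on {z. Some z \<in> riemann_sphere frontier_of D}
          (\<lambda>z. ((\<lambda>q. g q p) \<longlongrightarrow> 0) (atin_within riemann_sphere (Some z) D))"
  using bspec[OF assms(1)[unfolded green_function_def] assms(2)] by simp_all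

lemma green_function_finite:
  "green_function D g \<Longrightarrow> p \<in> D \<Longrightarrow> q \<in> D - {p} \<Longrightarrow> \<bar>g q p\<bar> \<noteq> \<infinity>"
  using green_functionD(2)[of D g p] unfolding sphere_harmonic_on_def by simp

lemma green_function_pole: "green_function D g \<Longrightarrow> p \<in> D \<Longrightarrow> g p p = \<infinity>"
  using green_functionD(4)[of D g p] by (simp add: log_pole_def)

lemma green_function_log_pole:
  assumes "green_function D g" "Some p \<in> D"
  shows "\<exists>B. \<forall>\<^sub>F z in at p. \<bar>real_of_ereal (g (Some z) (Some p)) + ln (cmod (z - p))\<bar> \<le> B"
  using green_functionD(4)[OF assms] by (simp add: log_pole_def)

lemma green_function_harmonic:
  assumes "green_function D g" "Some p \<in> D"
  shows "\<exists>f. harmonic_grad (\<lambda>z. real_of_ereal (g (Some z) (Some p))) f ({z. Some z \<in> D} - {p})"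
proof -
  have "harmonic_on (\<lambda>z. real_of_ereal (g (Some z) (Some p))) {z. Some z \<in> D - {Some p}}"
    using green_functionD(2)[OF assms] by (simp add: sphere_harmonic_on_def)
  also have "{z. Some z \<in> D - {Some p}} = {z. Some z \<in> D} - {p}"
    by auto
  finally show ?thesis
    by (rule harmonic_on_imp_harmonic_grad)
qed

lemma green_function_bounded:
  assumes g: "green_function D g" "Some p \<in> D" and "\<rho> > 0"
  shows "\<exists>M. \<forall>z\<in>{z. Some z \<in> D} - ball p \<rho>. real_of_ereal (g (Some z) (Some p)) \<le> M"
proof -
  have "openin riemann_sphere (Some ` ball p \<rho>)" "Some p \<in> Some ` ball p \<rho>"
    using \<open>\<rho> > 0\<close> by (auto simp: riemann_sphere_def)
  from green_functionD(3)[OF g this] obtain B where B: "\<And>q. q \<in> D - Some ` ball p \<rho> \<Longrightarrow> g q (Some p) \<le> ereal B"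
    by blast
  have "real_of_ereal (g (Some z) (Some p)) \<le> B" if "z \<in> {z. Some z \<in> D} - ball p \<rho>" for z
  proof -
    have z: "Some z \<in> D - Some ` ball p \<rho>" "Some z \<in> D - {Some p}"
      using that \<open>\<rho> > 0\<close> by auto
    then show ?thesis
      using B[OF z(1)] green_function_finite[OF g z(2)] by (cases "g (Some z) (Some p)") auto
  qed
  then show ?thesis
    by blast
qed

lemma green_function_boundary:
  assumes D: "openin riemann_sphere D" and g: "green_function D g" "Some p \<in> D"
  shows "\<exists>E. log_capacity E = 0 \<and> (\<forall>\<zeta>\<in>frontier {z. Some z \<in> D} - E. \<forall>\<epsilon>>0. \<exists>\<delta>>0.
    \<forall>z\<in>{z. Some z \<in> D}. dist z \<zeta> < \<delta> \<longrightarrow> real_of_ereal (g (Some z) (Some p)) < \<epsilon>)"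
proof -
  define E where "E = {z \<in> {z. Some z \<in> riemann_sphere frontier_of D}.
    \<not> ((\<lambda>q. g q (Some p)) \<longlongrightarrow> 0) (atin_within riemann_sphere (Some z) D)}"
  have "log_capacity E = 0"
    using green_functionD(5)[OF g] unfolding quasi_everywhere_on_def E_def .
  moreover have "\<exists>\<delta>>0. \<forall>z\<in>{z. Some z \<in> D}. dist z \<zeta> < \<delta> \<longrightarrow> real_of_ereal (g (Some z) (Some p)) < \<epsilon>"
    if \<zeta>: "\<zeta> \<in> frontier {z. Some z \<in> D} - E" and \<epsilon>: "\<epsilon> > 0" for \<zeta> \<epsilon>
  proof -
    have nD: "Some \<zeta> \<notin> D"
      using \<zeta> sphere_open_preimage[OF D] by (auto simp: frontier_def interior_open)
    have "((\<lambda>q. g q (Some p)) \<longlongrightarrow> 0) (atin_within riemann_sphere (Some \<zeta>) D)"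
      using \<zeta> frontier_sphere[OF D] by (auto simp: E_def)
    then have "\<forall>\<^sub>F q in atin_within riemann_sphere (Some \<zeta>) D. g q (Some p) < ereal \<epsilon>"
      using \<epsilon> by (intro order_tendstoD(2)) auto
    then obtain T where T: "openin riemann_sphere T" "Some \<zeta> \<in> T"
      "\<And>q. q \<in> T \<Longrightarrow> q \<in> D \<Longrightarrow> q \<noteq> Some \<zeta> \<Longrightarrow> g q (Some p) < ereal \<epsilon>"
      unfolding eventually_atin_within by (auto simp: riemann_sphere_def)
    obtain \<delta> where \<delta>: "\<delta> > 0" "ball \<zeta> \<delta> \<subseteq> {z. Some z \<in> T}"
      using sphere_open_preimage[OF T(1)] T(2) openE by blast
    have "real_of_ereal (g (Some z) (Some p)) < \<epsilon>" if "Some z \<in> D" "dist z \<zeta> < \<delta>" for z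
    proof -
      have "g (Some z) (Some p) < ereal \<epsilon>"
        using T(3)[of "Some z"] \<delta>(2) that nD by (auto simp: dist_commute subset_eq)
      moreover have "0 \<le> g (Some z) (Some p)"
        using green_functionD(1)[OF g that(1)] .
      ultimately show ?thesis
        by (cases "g (Some z) (Some p)") auto
    qed
    then show ?thesis
      using \<delta>(1) by blast
  qed
  ultimately show ?thesis
    by (intro exI[of _ E] conjI ballI allI impI)
qed

lemma green_function_le:
  assumes D: "openin riemann_sphere D" and g: "green_function D g"
    and pq: "Some p \<in> D" "Some q \<in> D" "p \<noteq> q"
  shows "real_of_ereal (g (Some q) (Some p)) \<le> real_of_ereal (g (Some p) (Some q))"
proof -
  obtain fu where u: "harmonic_grad (\<lambda>z. real_of_ereal (g (Some z) (Some p))) fu ({z. Some z \<in> D} - {p})"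
    using green_function_harmonic[OF g pq(1)] by blast
  obtain fv where v: "harmonic_grad (\<lambda>z. real_of_ereal (g (Some z) (Some q))) fv ({z. Some z \<in> D} - {q})"
    using green_function_harmonic[OF g pq(2)] by blast
  obtain Bu where Bu: "\<forall>\<^sub>F z in at p. \<bar>real_of_ereal (g (Some z) (Some p)) + ln (cmod (z - p))\<bar> \<le> Bu"
    using green_function_log_pole[OF g pq(1)] by blast
  obtain Bv where Bv: "\<forall>\<^sub>F z in at q. \<bar>real_of_ereal (g (Some z) (Some q)) + ln (cmod (z - q))\<bar> \<le> Bv"
    using green_function_log_pole[OF g pq(2)] by blast
  obtain E where E: "log_capacity E = 0"
    "\<And>\<zeta> \<epsilon>. \<zeta> \<in> frontier {z. Some z \<in> D} - E \<Longrightarrow> \<epsilon> > 0 \<Longrightarrow>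
      \<exists>\<delta>>0. \<forall>z\<in>{z. Some z \<in> D}. dist z \<zeta> < \<delta> \<longrightarrow> real_of_ereal (g (Some z) (Some p)) < \<epsilon>"
    using green_function_boundary[OF D g pq(1)] by blast
  have nonneg: "0 \<le> real_of_ereal (g (Some z) (Some w))" if "Some z \<in> D" "Some w \<in> D" for z w
    using green_functionD(1)[OF g that(2,1)] by (rule real_of_ereal_pos)
  show ?thesis
    by (rule planar_green_le[OF sphere_open_preimage[OF D] _ _ pq(3) u _ v _ Bu Bv _ E])
      (use pq nonneg green_function_bounded[OF g pq(1)] in auto)
qed

lemma green_function_symmetric:
  assumes D: "openin riemann_sphere D" and g: "green_function D g" and pq: "Some p \<in> D" "Some q \<in> D"
  shows "g (Some p) (Some q) = g (Some q) (Some p)"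
proof (cases "p = q")
  case False
  then have "real_of_ereal (g (Some p) (Some q)) = real_of_ereal (g (Some q) (Some p))"
    using green_function_le[OF D g] pq by (intro antisym) auto
  then show ?thesis
    using green_function_finite[OF g pq(1), of "Some q"] green_function_finite[OF g pq(2), of "Some p"] pq False
    by (cases "g (Some p) (Some q)"; cases "g (Some q) (Some p)") auto
qed simp

text \<open>The properties of the Green function on \<open>K\<close> on which the energy arguments
  rest. The constant in \<open>log_bound\<close> may depend on the pole.\<close>

locale green_kernel =
  fixes K :: "complex set" and G :: "complex \<Rightarrow> complex \<Rightarrow> ereal"
  assumes compact: "compact K"
    and nonneg: "\<And>z w. z \<in> K \<Longrightarrow> w \<in> K \<Longrightarrow> 0 \<le> G z w"
    and diag: "\<And>z. z \<in> K \<Longrightarrow> G z z = \<infinity>"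
    and finite_off_diag: "\<And>z w. z \<in> K \<Longrightarrow> w \<in> K \<Longrightarrow> z \<noteq> w \<Longrightarrow> \<bar>G z w\<bar> \<noteq> \<infinity>"
    and sym: "\<And>z w. z \<in> K \<Longrightarrow> w \<in> K \<Longrightarrow> G z w = G w z"
    and cont: "\<And>w. w \<in> K \<Longrightarrow> continuous_on (K - {w}) (\<lambda>z. real_of_ereal (G z w))"
    and log_bound: "\<And>w. w \<in> K \<Longrightarrow> \<exists>B. \<forall>z\<in>K - {w}. \<bar>real_of_ereal (G z w) + ln (cmod (z - w))\<bar> \<le> B"

lemma green_kernel_green_function:
  assumes D: "openin riemann_sphere D" and g: "green_function D g" and K: "compact K" "Some ` K \<subseteq> D"
  shows "green_kernel K (\<lambda>z w. g (Some z) (Some w))"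
proof
  have KD: "Some z \<in> D" if "z \<in> K" for z
    using K(2) that by auto
  show "compact K"
    by fact
  show "0 \<le> g (Some z) (Some w)" if "z \<in> K" "w \<in> K" for z w
    using green_functionD(1)[OF g KD[OF that(2)] KD[OF that(1)]] .
  show "g (Some z) (Some z) = \<infinity>" if "z \<in> K" for z
    using green_function_pole[OF g KD[OF that]] .
  show "\<bar>g (Some z) (Some w)\<bar> \<noteq> \<infinity>" if "z \<in> K" "w \<in> K" "z \<noteq> w" for z w
    using green_function_finite[OF g KD[OF that(2)]] KD[OF that(1)] that(3) by simp
  show "g (Some z) (Some w) = g (Some w) (Some z)" if "z \<in> K" "w \<in> K" for z w
    using green_function_symmetric[OF D g KD[OF that(1)] KD[OF that(2)]] .
  fix w assume w: "w \<in> K"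
  obtain f where f: "harmonic_grad (\<lambda>z. real_of_ereal (g (Some z) (Some w))) f ({z. Some z \<in> D} - {w})"
    using green_function_harmonic[OF g KD[OF w]] by blast
  show "continuous_on (K - {w}) (\<lambda>z. real_of_ereal (g (Some z) (Some w)))"
    by (rule continuous_on_subset[OF harmonic_grad_continuous_on[OF f]]) (use KD in auto)
  obtain B where "\<forall>\<^sub>F z in at w. \<bar>real_of_ereal (g (Some z) (Some w)) + ln (cmod (z - w))\<bar> \<le> B"
    using green_function_log_pole[OF g KD[OF w]] by blast
  then obtain d where d: "d > 0" "\<And>z. z \<noteq> w \<Longrightarrow> dist z w < d \<Longrightarrow>
      \<bar>real_of_ereal (g (Some z) (Some w)) + ln (cmod (z - w))\<bar> \<le> B"
    unfolding eventually_at by blast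
  obtain M where M: "\<And>z. z \<in> {z. Some z \<in> D} - ball w d \<Longrightarrow> real_of_ereal (g (Some z) (Some w)) \<le> M"
    using green_function_bounded[OF g KD[OF w] d(1)] by blast
  obtain L where L: "L > 0" "\<And>z. z \<in> K \<Longrightarrow> cmod z \<le> L"
    using compact_imp_bounded[OF K(1)] bounded_pos by blast
  \<comment> \<open>Near the pole the local bound \<open>B\<close> applies; elsewhere the kernel is
    between 0 and \<open>M\<close> and the distance between \<open>d\<close> and
    \<open>2 * L\<close>.\<close>
  define B' where "B' = \<bar>B\<bar> + \<bar>M\<bar> + \<bar>ln d\<bar> + \<bar>ln (2 * L)\<bar>"
  have "\<bar>real_of_ereal (g (Some z) (Some w)) + ln (cmod (z - w))\<bar> \<le> B'" if z: "z \<in> K - {w}" for z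
  proof (cases "dist z w < d")
    case True
    then show ?thesis
      using d(2)[of z] z by (auto simp: B'_def)
  next
    case False
    then have dz: "d \<le> cmod (z - w)"
      by (simp add: dist_norm)
    have "cmod (z - w) \<le> 2 * L"
      using norm_triangle_ineq4[of z w] L(2)[of z] L(2)[of w] z w by auto
    then have "ln (cmod (z - w)) \<le> ln (2 * L)"
      by (rule ln_mono) (use dz d(1) in linarith)
    moreover have "ln d \<le> ln (cmod (z - w))"
      by (rule ln_mono[OF dz d(1)])
    moreover have "0 \<le> real_of_ereal (g (Some z) (Some w))"
      using green_functionD(1)[OF g KD[OF w] KD[of z]] z by (intro real_of_ereal_pos) auto
    moreover have "real_of_ereal (g (Some z) (Some w)) \<le> M"
      using M[of z] KD[of z] z False by (auto simp: dist_commute)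
    ultimately show ?thesis
      unfolding B'_def by linarith
  qed
  then show "\<exists>B. \<forall>z\<in>K - {w}. \<bar>real_of_ereal (g (Some z) (Some w)) + ln (cmod (z - w))\<bar> \<le> B"
    by blast
qed

context green_kernel
begin

text \<open>Closed, because \<open>G\<close> is symmetric and continuous in its first argument off the pole.\<close>

definition uniform_poles :: "nat \<Rightarrow> complex set" where
  "uniform_poles n = {w \<in> K. \<forall>z\<in>K - {w}. \<bar>real_of_ereal (G z w) + ln (cmod (z - w))\<bar> \<le> real n}"

lemma closed_uniform_poles: "closed (uniform_poles n)"
  unfolding closed_sequential_limits
proof (intro allI impI, elim conjE)
  fix x l assume x: "\<forall>k. x k \<in> uniform_poles n" and lim: "x \<longlonglongrightarrow> l"
  have xK: "x k \<in> K" for k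
    using x by (simp add: uniform_poles_def)
  have l: "l \<in> K"
    using closed_sequentially[OF compact_imp_closed[OF compact] xK lim] .
  have "\<bar>real_of_ereal (G z l) + ln (cmod (z - l))\<bar> \<le> real n" if z: "z \<in> K - {l}" for z
  proof (rule tendsto_upperbound)
    have ne: "\<forall>\<^sub>F k in sequentially. x k \<noteq> z"
      using z by (intro tendsto_imp_eventually_ne[OF lim]) auto
    have "continuous_on (K - {z}) (\<lambda>w. real_of_ereal (G w z))"
      using cont z by auto
    then have "((\<lambda>k. real_of_ereal (G (x k) z)) \<longlongrightarrow> real_of_ereal (G l z)) sequentially"
      using lim z l ne xK by (elim continuous_on_tendsto_compose) (auto elim: eventually_mono)
    then have "((\<lambda>k. real_of_ereal (G z (x k))) \<longlongrightarrow> real_of_ereal (G z l)) sequentially"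
      using sym[of z] xK l z by simp
    then show "(\<lambda>k. \<bar>real_of_ereal (G z (x k)) + ln (cmod (z - x k))\<bar>) \<longlonglongrightarrow>
        \<bar>real_of_ereal (G z l) + ln (cmod (z - l))\<bar>"
      using z by (intro tendsto_rabs tendsto_add tendsto_ln tendsto_norm tendsto_diff tendsto_const lim) auto
    show "\<forall>\<^sub>F k in sequentially. \<bar>real_of_ereal (G z (x k)) + ln (cmod (z - x k))\<bar> \<le> real n"
      using ne
    proof eventually_elim
      case (elim k)
      then show ?case
        using x z by (auto simp: uniform_poles_def)
    qed
  qed simp
  then show "l \<in> uniform_poles n"
    using l by (simp add: uniform_poles_def)
qed

text \<open>A measure charging \<open>K\<close> charges one of these closed pieces, where the Green
  kernel and the logarithmic kernel differ by a bounded amount.\<close>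

lemma uniform_poles_cover: "K = (\<Union>n. uniform_poles n)"
proof
  show "K \<subseteq> (\<Union>n. uniform_poles n)"
  proof
    fix w assume w: "w \<in> K"
    then obtain B where B: "\<And>z. z \<in> K - {w} \<Longrightarrow> \<bar>real_of_ereal (G z w) + ln (cmod (z - w))\<bar> \<le> B"
      using log_bound by blast
    obtain n where "B \<le> real n"
      using real_arch_simple by blast
    then show "w \<in> (\<Union>n. uniform_poles n)"
      using B w by (auto simp: uniform_poles_def intro: order_trans)
  qed
qed (auto simp: uniform_poles_def)

lemma uniform_poles_estimate:
  assumes "w \<in> uniform_poles n" "z \<in> K"
  shows "G z w \<le> log_kernel z w + ereal n" "log_kernel z w \<le> G z w + ereal n"
proof -
  have wK: "w \<in> K"
    using assms by (simp add: uniform_poles_def)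
  have "G z w \<le> log_kernel z w + ereal n \<and> log_kernel z w \<le> G z w + ereal n"
  proof (cases "z = w")
    case True
    then show ?thesis
      using diag[OF wK] by (simp add: log_kernel_def)
  next
    case False
    then obtain r where r: "G z w = ereal r"
      using finite_off_diag[OF assms(2) wK] by (cases "G z w") auto
    have "\<bar>r + ln (cmod (z - w))\<bar> \<le> real n"
      using assms False r by (force simp: uniform_poles_def)
    then show ?thesis
      using False r by (auto simp: log_kernel_def)
  qed
  then show "G z w \<le> log_kernel z w + ereal n" "log_kernel z w \<le> G z w + ereal n"
    by auto
qed

end


section \<open>The continuous energy problem\<close>

text \<open>For an arbitrary integrand the integral is a lower integral, the supremum over simple
  minorants; measurable minorants give the same value and are easier to scale.\<close>

lemma nn_integral_le_iff:
  "(\<integral>\<^sup>+x. h x \<partial>M) \<le> c \<longleftrightarrow> (\<forall>g\<in>borel_measurable M. (\<forall>x. g x \<le> h x) \<longrightarrow> (\<integral>\<^sup>+x. g x \<partial>M) \<le> c)"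
proof
  assume c: "(\<integral>\<^sup>+x. h x \<partial>M) \<le> c"
  show "\<forall>g\<in>borel_measurable M. (\<forall>x. g x \<le> h x) \<longrightarrow> (\<integral>\<^sup>+x. g x \<partial>M) \<le> c"
    by (intro ballI impI order_trans[OF _ c] nn_integral_mono) simp
next
  assume R: "\<forall>g\<in>borel_measurable M. (\<forall>x. g x \<le> h x) \<longrightarrow> (\<integral>\<^sup>+x. g x \<partial>M) \<le> c"
  show "(\<integral>\<^sup>+x. h x \<partial>M) \<le> c"
    unfolding nn_integral_def
  proof (rule SUP_least)
    fix g assume g: "g \<in> {g. simple_function M g \<and> g \<le> h}"
    then have "g \<in> borel_measurable M" "\<forall>x. g x \<le> h x"
      by (auto simp: le_fun_def intro: borel_measurable_simple_function)
    then have "(\<integral>\<^sup>+x. g x \<partial>M) \<le> c"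
      using R by blast
    moreover have "(\<integral>\<^sup>+x. g x \<partial>M) = integral\<^sup>S M g"
      using g by (intro nn_integral_eq_simple_integral) auto
    ultimately show "integral\<^sup>S M g \<le> c"
      by simp
  qed
qed

lemma ennreal_inverse_cancel:
  assumes "t > 0"
  shows "ennreal t * (ennreal (1 / t) * x) = x" "ennreal (1 / t) * (ennreal t * x) = x"
proof -
  have inv: "ennreal t * ennreal (1 / t) = 1" "ennreal (1 / t) * ennreal t = 1"
    using assms by (simp_all add: ennreal_mult[symmetric])
  show "ennreal t * (ennreal (1 / t) * x) = x" "ennreal (1 / t) * (ennreal t * x) = x"
    by (simp_all only: mult.assoc[symmetric] inv mult_1)
qed

text \<open>Neither the weight nor the Green potential is assumed to be Borel measurable, so homogeneity of
  the integral is needed for arbitrary integrands.\<close>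

lemma nn_integral_scale_measure_arbitrary:
  assumes t: "t > 0"
  shows "(\<integral>\<^sup>+x. h x \<partial>scale_measure (ennreal t) M) = ennreal t * (\<integral>\<^sup>+x. h x \<partial>M)"
proof -
  have le: "(\<integral>\<^sup>+x. h x \<partial>scale_measure (ennreal t) M) \<le> ennreal t * (\<integral>\<^sup>+x. h x \<partial>M)" for t M
  proof (rule nn_integral_le_iff[THEN iffD2], intro ballI impI)
    fix g assume "g \<in> borel_measurable (scale_measure (ennreal t) M)" and g: "\<forall>x. g x \<le> h x"
    then have "g \<in> borel_measurable M"
      by simp
    then have "(\<integral>\<^sup>+x. g x \<partial>scale_measure (ennreal t) M) = ennreal t * (\<integral>\<^sup>+x. g x \<partial>M)"
      by (rule nn_integral_scale_measure)
    also have "\<dots> \<le> ennreal t * (\<integral>\<^sup>+x. h x \<partial>M)"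
      using g by (intro mult_left_mono nn_integral_mono) auto
    finally show "(\<integral>\<^sup>+x. g x \<partial>scale_measure (ennreal t) M) \<le> ennreal t * (\<integral>\<^sup>+x. h x \<partial>M)" .
  qed
  have "scale_measure (ennreal (1 / t)) (scale_measure (ennreal t) M) = M"
    using ennreal_inverse_cancel(2)[OF t, of 1] by (simp add: scale_scale_measure)
  then have "(\<integral>\<^sup>+x. h x \<partial>M) \<le> ennreal (1 / t) * (\<integral>\<^sup>+x. h x \<partial>scale_measure (ennreal t) M)"
    using le[of "1 / t" "scale_measure (ennreal t) M"] by simp
  then have "ennreal t * (\<integral>\<^sup>+x. h x \<partial>M) \<le> ennreal t * (ennreal (1 / t) * (\<integral>\<^sup>+x. h x \<partial>scale_measure (ennreal t) M))"
    by (rule mult_left_mono) simp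
  then show ?thesis
    unfolding ennreal_inverse_cancel(1)[OF t] using le by (intro antisym) auto
qed

text \<open>One inequality, valid for every positive factor, is applied to \<open>t\<close> and to
  \<open>1 / t\<close>.\<close>

lemma nn_integral_cmult_arbitrary:
  assumes t: "t > 0"
  shows "(\<integral>\<^sup>+x. ennreal t * h x \<partial>M) = ennreal t * (\<integral>\<^sup>+x. h x \<partial>M)"
proof -
  have le: "(\<integral>\<^sup>+x. ennreal t * h x \<partial>M) \<le> ennreal t * (\<integral>\<^sup>+x. h x \<partial>M)" if t: "t > 0" for t and h :: "'a \<Rightarrow> ennreal"
  proof (rule nn_integral_le_iff[THEN iffD2], intro ballI impI)
    fix g assume g: "g \<in> borel_measurable M" "\<forall>x. g x \<le> ennreal t * h x"
    have "ennreal (1 / t) * g x \<le> h x" for x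
      using mult_left_mono[OF spec[OF g(2), of x], of "ennreal (1 / t)"]
      unfolding ennreal_inverse_cancel(2)[OF t] by simp
    then have "(\<integral>\<^sup>+x. ennreal (1 / t) * g x \<partial>M) \<le> (\<integral>\<^sup>+x. h x \<partial>M)"
      by (intro nn_integral_mono)
    then have "ennreal (1 / t) * (\<integral>\<^sup>+x. g x \<partial>M) \<le> (\<integral>\<^sup>+x. h x \<partial>M)"
      unfolding nn_integral_cmult[OF g(1)] .
    then have "ennreal t * (ennreal (1 / t) * (\<integral>\<^sup>+x. g x \<partial>M)) \<le> ennreal t * (\<integral>\<^sup>+x. h x \<partial>M)"
      by (rule mult_left_mono) simp
    then show "(\<integral>\<^sup>+x. g x \<partial>M) \<le> ennreal t * (\<integral>\<^sup>+x. h x \<partial>M)"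
      unfolding ennreal_inverse_cancel(1)[OF t] .
  qed
  have "(\<integral>\<^sup>+x. h x \<partial>M) \<le> ennreal (1 / t) * (\<integral>\<^sup>+x. ennreal t * h x \<partial>M)"
    using le[of "1 / t" "\<lambda>x. ennreal t * h x"] t unfolding ennreal_inverse_cancel(2)[OF t] by simp
  then have "ennreal t * (\<integral>\<^sup>+x. h x \<partial>M) \<le> ennreal t * (ennreal (1 / t) * (\<integral>\<^sup>+x. ennreal t * h x \<partial>M))"
    by (rule mult_left_mono) simp
  then show ?thesis
    unfolding ennreal_inverse_cancel(1)[OF t] using le[OF t] by (intro antisym)
qed

lemma ennreal_le_diff_add: "(a :: ennreal) \<le> (a - ennreal k) + ennreal k"
  by (metis add.commute ennreal_minus_le_iff ennreal_neq_top order_refl)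

lemma ennreal_diff_le: "(a :: ennreal) \<le> b + ennreal k \<Longrightarrow> a - ennreal k \<le> b"
  by (simp add: ennreal_minus_le_iff add.commute)

lemma closed_sublevel_lsc:
  assumes K: "closed K" and f: "lower_semicontinuous_on K f"
  shows "closed {z \<in> K. f z \<le> a}"
  unfolding closed_sequential_limits
proof (intro allI impI, elim conjE)
  fix x l assume x: "\<forall>n. x n \<in> {z \<in> K. f z \<le> a}" and lim: "x \<longlonglongrightarrow> l"
  have l: "l \<in> K"
    by (rule closed_sequentially[OF K _ lim]) (use x in auto)
  have "f l \<le> a"
  proof (rule ccontr)
    assume "\<not> f l \<le> a"
    then have "a < Liminf (at l within K) f"
      using f l unfolding lower_semicontinuous_on_def by (meson less_le_trans not_le)
    then have "\<forall>\<^sub>F z in at l within K. a < f z"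
      by (rule less_LiminfD)
    then obtain d where d: "d > 0" "\<And>z. z \<in> K \<Longrightarrow> z \<noteq> l \<Longrightarrow> dist z l < d \<Longrightarrow> a < f z"
      unfolding eventually_at by auto
    obtain n where n: "dist (x n) l < d"
      using tendstoD[OF lim d(1)] unfolding eventually_sequentially by (meson order_refl)
    \<comment> \<open>The lower limit ignores the point \<open>l\<close> itself, so a term of the
      sequence equal to \<open>l\<close> is treated separately.\<close>
    have "a < f (x n)"
      using d(2)[of "x n"] x n \<open>\<not> f l \<le> a\<close> by (cases "x n = l") auto
    then show False
      using x by (auto simp: not_le[symmetric])
  qed
  then show "l \<in> {z \<in> K. f z \<le> a}"
    using l by simp
qed

text \<open>Otherwise the sublevel sets for the levels -n would be nested nonempty compact sets, and
  at a common point \<open>f\<close> would be -\<infinity>.\<close>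

lemma lsc_bounded_below:
  assumes K: "compact K" and f: "lower_semicontinuous_on K f" "\<And>z. z \<in> K \<Longrightarrow> f z \<noteq> -\<infinity>"
  shows "\<exists>B\<ge>0. \<forall>z\<in>K. ereal (- B) \<le> f z"
proof (rule ccontr)
  assume contra: "\<not> ?thesis"
  define S where "S n = {z \<in> K. f z \<le> ereal (- real n)}" for n :: nat
  have "S n \<noteq> {}" for n
    using contra[unfolded not_ex, rule_format, of "real n"] by (auto simp: S_def not_le less_imp_le)
  moreover have "compact (S n)" for n
  proof -
    have "compact (K \<inter> S n)"
      unfolding S_def using K by (intro compact_Int_closed closed_sublevel_lsc f compact_imp_closed)
    then show ?thesis
      by (simp add: S_def Collect_conj_eq inf_absorb2 Int_absorb1 subset_eq)
  qed
  moreover have "S n \<subseteq> S m" if "m \<le> n" for m n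
    using that by (auto simp: S_def intro: order_trans)
  ultimately have "(\<Inter>n. S n) \<noteq> {}"
    by (intro compact_nest) auto
  then obtain z where z: "z \<in> K" "\<And>n. f z \<le> ereal (- real n)"
    by (auto simp: S_def)
  obtain n where n: "- real_of_ereal (f z) < real n"
    using reals_Archimedean2 by blast
  show False
    using z(2)[of n] z(2)[of 0] n f(2)[OF z(1)] by (cases "f z") auto
qed

locale weighted_green_kernel = green_kernel +
  fixes f :: "complex \<Rightarrow> ereal"
  assumes f_not_MInf: "\<And>z. z \<in> K \<Longrightarrow> f z \<noteq> -\<infinity>"
    and f_lsc: "lower_semicontinuous_on K f"
begin

lemma K_borel [measurable]: "K \<in> sets borel"
  using compact by (rule borel_compact)

lemma uniform_poles_borel [measurable]: "uniform_poles n \<in> sets borel"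
  using closed_uniform_poles by (rule borel_closed)

text \<open>A closed exhaustion of the set where \<open>f\<close> is negative, with \<open>f\<close>
  bounded away from 0 on each member.\<close>

definition sublevel :: "nat \<Rightarrow> complex set" where
  "sublevel m = {z \<in> K. f z \<le> ereal (- (1 / real (Suc m)))}"

lemma closed_sublevel: "closed (sublevel m)"
  unfolding sublevel_def by (rule closed_sublevel_lsc[OF compact_imp_closed[OF compact] f_lsc])

lemma sublevel_borel [measurable]: "sublevel m \<in> sets borel"
  using closed_sublevel by (rule borel_closed)

lemma negative_set_eq: "{z \<in> K. f z < 0} = (\<Union>m. sublevel m)"
proof
  show "{z \<in> K. f z < 0} \<subseteq> (\<Union>m. sublevel m)"
  proof
    fix z assume z: "z \<in> {z \<in> K. f z < 0}"
    then obtain r where r: "f z = ereal r" "r < 0"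
      using f_not_MInf[of z] by (cases "f z") auto
    then obtain m where "inverse (real (Suc m)) < - r"
      using reals_Archimedean[of "- r"] by auto
    then show "z \<in> (\<Union>m. sublevel m)"
      using z r by (auto simp: sublevel_def inverse_eq_divide intro!: exI[of _ m])
  qed
  show "(\<Union>m. sublevel m) \<subseteq> {z \<in> K. f z < 0}"
  proof
    fix z assume "z \<in> (\<Union>m. sublevel m)"
    then obtain m where "z \<in> K" "f z \<le> ereal (- (1 / real (Suc m)))"
      by (auto simp: sublevel_def)
    moreover have "ereal (- (1 / real (Suc m))) < 0"
      by simp
    ultimately show "z \<in> {z \<in> K. f z < 0}"
      using le_less_trans by blast
  qed
qed

definition interaction :: "complex measure \<Rightarrow> ennreal" where
  "interaction \<mu> = (\<integral>\<^sup>+w. \<integral>\<^sup>+z. e2ennreal (G z w) \<partial>\<mu> \<partial>\<mu>)"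

definition weighted :: "complex measure \<Rightarrow> ereal" where
  "weighted \<mu> = ereal_integral \<mu> (\<lambda>w. ereal_integral \<mu> (\<lambda>z. G z w)) + 2 * ereal_integral \<mu> f"

lemma measures_upto_facts:
  assumes "\<mu> \<in> measures_upto K R"
  shows "sets \<mu> = sets borel" "space \<mu> = UNIV" "AE z in \<mu>. z \<in> K" "emeasure \<mu> UNIV = emeasure \<mu> K"
    "emeasure \<mu> UNIV < \<infinity>"
proof -
  show s: "sets \<mu> = sets borel"
    using assms by (simp add: measures_upto_def)
  then show sp: "space \<mu> = UNIV"
    using sets_eq_imp_space_eq by fastforce
  note [measurable_cong] = s
  have null: "emeasure \<mu> (- K) = 0"
    using assms by (simp add: measures_upto_def)
  then show "AE z in \<mu>. z \<in> K"
    by (intro AE_I[of _ _ "- K"]) (auto simp: s)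
  have "emeasure \<mu> (K \<union> - K) = emeasure \<mu> K + emeasure \<mu> (- K)"
    by (intro plus_emeasure[symmetric]) (auto simp: s)
  then show e: "emeasure \<mu> UNIV = emeasure \<mu> K"
    using null by simp
  have "emeasure \<mu> K \<le> ennreal R"
    using assms by (simp add: measures_upto_def)
  then show "emeasure \<mu> UNIV < \<infinity>"
    unfolding e by (rule le_less_trans) simp
qed

lemma interaction_eq:
  assumes \<mu>: "\<mu> \<in> measures_upto K R"
  shows "ereal_integral \<mu> (\<lambda>w. ereal_integral \<mu> (\<lambda>z. G z w)) = enn2ereal (interaction \<mu>)"
proof -
  note AE = measures_upto_facts(3)[OF \<mu>]
  define P where "P w = (\<integral>\<^sup>+z. e2ennreal (G z w) \<partial>\<mu>)" for w
  have P: "ereal_integral \<mu> (\<lambda>z. G z w) = enn2ereal (P w)" if "w \<in> K" for w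
  proof -
    have "(\<integral>\<^sup>+z. e2ennreal (- G z w) \<partial>\<mu>) = (\<integral>\<^sup>+z. 0 \<partial>\<mu>)"
      using AE by (intro nn_integral_cong_AE, elim AE_mp) (use nonneg that in \<open>auto simp: e2ennreal_neg\<close>)
    then show ?thesis
      by (simp add: ereal_integral_def P_def zero_ennreal.rep_eq)
  qed
  have "(\<integral>\<^sup>+w. e2ennreal (ereal_integral \<mu> (\<lambda>z. G z w)) \<partial>\<mu>) = (\<integral>\<^sup>+w. P w \<partial>\<mu>)"
    using AE by (intro nn_integral_cong_AE, elim AE_mp) (auto simp: P)
  moreover have "(\<integral>\<^sup>+w. e2ennreal (- ereal_integral \<mu> (\<lambda>z. G z w)) \<partial>\<mu>) = (\<integral>\<^sup>+w. 0 \<partial>\<mu>)"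
    using AE by (intro nn_integral_cong_AE, elim AE_mp) (auto simp: P e2ennreal_neg)
  ultimately show ?thesis
    by (subst ereal_integral_def) (simp add: interaction_def P_def zero_ennreal.rep_eq)
qed

lemma integral_neg_part_finite:
  assumes \<mu>: "\<mu> \<in> measures_upto K R"
  shows "(\<integral>\<^sup>+z. e2ennreal (- f z) \<partial>\<mu>) < \<infinity>"
proof -
  obtain B where B: "B \<ge> 0" "\<And>z. z \<in> K \<Longrightarrow> ereal (- B) \<le> f z"
    using lsc_bounded_below[OF compact f_lsc f_not_MInf] by blast
  have "e2ennreal (- f z) \<le> ennreal B" if "z \<in> K" for z
  proof -
    have "- f z \<le> ereal B"
      using B(2)[OF that] by (cases "f z") auto
    then show ?thesis
      using e2ennreal_mono by (fastforce simp: e2ennreal_ereal)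
  qed
  then have "(\<integral>\<^sup>+z. e2ennreal (- f z) \<partial>\<mu>) \<le> (\<integral>\<^sup>+z. ennreal B \<partial>\<mu>)"
    using measures_upto_facts(3)[OF \<mu>] by (intro nn_integral_mono_AE) (elim AE_mp, auto)
  also have "\<dots> < \<infinity>"
    using measures_upto_facts(2,5)[OF \<mu>] by (simp add: ennreal_mult_less_top)
  finally show ?thesis .
qed

lemma scale_measures_upto:
  assumes \<mu>: "\<mu> \<in> measures_upto K R" and t: "t > 0" "ennreal t * emeasure \<mu> K \<le> ennreal R'"
  shows "scale_measure (ennreal t) \<mu> \<in> measures_upto K R'"
  using assms by (auto simp: measures_upto_def)

text \<open>A finite total has finite parts, because the interaction is nonnegative and the negative
  part of \<open>f\<close> is integrable. Along the ray through \<mu> the functional is then a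
  quadratic polynomial in the scaling factor, and the properties of the minimizer are read off from
  its coefficients.\<close>

lemma finite_weighted:
  assumes \<mu>: "\<mu> \<in> measures_upto K R" and fin: "weighted \<mu> < \<infinity>"
  obtains i s where "i \<ge> 0" "interaction \<mu> = ennreal i" "ereal_integral \<mu> f = ereal s"
    "weighted \<mu> = ereal (i + 2 * s)"
    "\<And>t. t > 0 \<Longrightarrow> weighted (scale_measure (ennreal t) \<mu>) = ereal (t * t * i + 2 * t * s)"
proof -
  define Fp Fm where "Fp = (\<integral>\<^sup>+z. e2ennreal (f z) \<partial>\<mu>)" and "Fm = (\<integral>\<^sup>+z. e2ennreal (- f z) \<partial>\<mu>)"
  have J: "weighted \<mu> = enn2ereal (interaction \<mu>) + 2 * (enn2ereal Fp - enn2ereal Fm)"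
    unfolding weighted_def interaction_eq[OF \<mu>] by (simp add: ereal_integral_def Fp_def Fm_def)
  obtain b where b: "b \<ge> 0" "Fm = ennreal b"
    using integral_neg_part_finite[OF \<mu>] by (cases Fm) (auto simp: Fm_def)
  obtain a where a: "a \<ge> 0" "Fp = ennreal a"
    using fin unfolding J by (cases Fp; cases "interaction \<mu>") (auto simp: b)
  obtain i where i: "i \<ge> 0" "interaction \<mu> = ennreal i"
    using fin unfolding J by (cases "interaction \<mu>") (auto simp: a b)
  have s: "ereal_integral \<mu> f = ereal (a - b)"
    using a b by (simp add: ereal_integral_def Fp_def[symmetric] Fm_def[symmetric])
  have "weighted (scale_measure (ennreal t) \<mu>) = ereal (t * t * i + 2 * t * (a - b))" if t: "t > 0" for t
  proof -
    have \<mu>t: "scale_measure (ennreal t) \<mu> \<in> measures_upto K (t * R)"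
    proof (rule scale_measures_upto[OF \<mu> t])
      have "emeasure \<mu> K \<le> ennreal R"
        using \<mu> by (simp add: measures_upto_def)
      then have "ennreal t * emeasure \<mu> K \<le> ennreal t * ennreal R"
        by (rule mult_left_mono) simp
      then show "ennreal t * emeasure \<mu> K \<le> ennreal (t * R)"
        using t by (simp add: ennreal_mult')
    qed
    have "interaction (scale_measure (ennreal t) \<mu>) = ennreal t * (ennreal t * interaction \<mu>)"
      unfolding interaction_def nn_integral_scale_measure_arbitrary[OF t] nn_integral_cmult_arbitrary[OF t] ..
    also have "\<dots> = ennreal (t * t * i)"
      using t i by (simp add: ennreal_mult[symmetric] mult.assoc)
    finally have "interaction (scale_measure (ennreal t) \<mu>) = ennreal (t * t * i)" .
    moreover have "ereal_integral (scale_measure (ennreal t) \<mu>) f = ereal (t * (a - b))"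
      unfolding ereal_integral_def nn_integral_scale_measure_arbitrary[OF t] Fp_def[symmetric] Fm_def[symmetric]
      using t a b by (simp add: ennreal_mult[symmetric] right_diff_distrib)
    ultimately show ?thesis
      unfolding weighted_def interaction_eq[OF \<mu>t] using t i(1) by (simp add: mult.assoc)
  qed
  then show ?thesis
    using that[OF i s] a b i unfolding J by simp
qed

lemma weighted_null: "weighted (null_measure borel) = 0"
  by (simp add: weighted_def ereal_integral_def zero_ennreal.rep_eq)

lemma null_measures_upto: "null_measure borel \<in> measures_upto K R"
  by (simp add: measures_upto_def)

text \<open>A set of positive measure and small diameter exists inside one piece with uniform
  constant. There the logarithmic singularity makes the kernel at least 1, and the interaction is at
  least the square of the measure of that set.\<close>

lemma interaction_pos:
  assumes \<mu>: "\<mu> \<in> measures_upto K R" and pos: "emeasure \<mu> K > 0"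
  shows "interaction \<mu> > 0"
proof -
  note s = measures_upto_facts(1)[OF \<mu>]
  have "\<exists>n. emeasure \<mu> (uniform_poles n) \<noteq> 0"
  proof (rule ccontr)
    assume "\<not> ?thesis"
    then have "emeasure \<mu> (\<Union>n. uniform_poles n) = 0"
      by (intro emeasure_UN_eq_0) (auto simp: s)
    then show False
      using pos unfolding uniform_poles_cover[symmetric] by simp
  qed
  then obtain n where n: "emeasure \<mu> (uniform_poles n) \<noteq> 0"
    by blast
  \<comment> \<open>Two points of a ball of this radius are closer than exp(-(n + 1)), so their
    logarithmic kernel exceeds n + 1; the comparison with \<open>G\<close> costs
    \<open>n\<close>.\<close>
  define \<rho> where "\<rho> = exp (- real (n + 1)) / 2"
  have \<rho>: "\<rho> > 0"
    by (simp add: \<rho>_def)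
  have "uniform_poles n \<subseteq> K"
    by (auto simp: uniform_poles_def)
  then have "compact (uniform_poles n)"
    using closed_uniform_poles compact by (metis compact_Int_closed inf.absorb_iff2)
  then obtain T where T: "finite T" "uniform_poles n \<subseteq> (\<Union>x\<in>T. ball x \<rho>)"
    using seq_compact_imp_totally_bounded[OF compact_imp_seq_compact[OF \<open>compact (uniform_poles n)\<close>]] \<rho>
    by (auto dest!: spec[of _ \<rho>])
  have "\<exists>x\<in>T. emeasure \<mu> (uniform_poles n \<inter> ball x \<rho>) \<noteq> 0"
  proof (rule ccontr)
    assume "\<not> ?thesis"
    then have "(\<Sum>x\<in>T. emeasure \<mu> (uniform_poles n \<inter> ball x \<rho>)) = 0"
      by simp
    moreover have "emeasure \<mu> (\<Union>x\<in>T. uniform_poles n \<inter> ball x \<rho>) \<le> (\<Sum>x\<in>T. emeasure \<mu> (uniform_poles n \<inter> ball x \<rho>))"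
      using T(1) by (intro emeasure_subadditive_finite) (auto simp: s)
    moreover have "(\<Union>x\<in>T. uniform_poles n \<inter> ball x \<rho>) = uniform_poles n"
      using T(2) by auto
    ultimately show False
      using n by simp
  qed
  then obtain x where x: "emeasure \<mu> (uniform_poles n \<inter> ball x \<rho>) \<noteq> 0"
    by blast
  define A where "A = uniform_poles n \<inter> ball x \<rho>"
  have [measurable]: "A \<in> sets \<mu>"
    by (simp add: s A_def)
  have G1: "1 \<le> e2ennreal (G z w)" if zw: "z \<in> A" "w \<in> A" for z w
  proof -
    have zK: "z \<in> K" and wn: "w \<in> uniform_poles n"
      using zw by (auto simp: A_def uniform_poles_def)
    have "ereal (real n + 1) \<le> log_kernel z w"
    proof (cases "z = w")
      case False
      have "cmod (z - w) < exp (- real (n + 1))"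
        using zw dist_triangle_half_r[of x z "exp (- real (n + 1))" w] by (auto simp: A_def \<rho>_def dist_norm)
      then have "ln (cmod (z - w)) \<le> ln (exp (- real (n + 1)))"
        using False by (intro ln_mono) auto
      then show ?thesis
        using False by (simp add: log_kernel_def)
    qed (simp add: log_kernel_def)
    also have "\<dots> \<le> G z w + ereal n"
      by (rule uniform_poles_estimate(2)[OF wn zK])
    finally have "1 \<le> G z w"
      by (cases "G z w") (auto simp: one_ereal_def)
    then show ?thesis
      using e2ennreal_mono[of 1 "G z w"] by (simp add: one_ereal_def e2ennreal_ereal)
  qed
  have "indicator A w * emeasure \<mu> A \<le> (\<integral>\<^sup>+z. e2ennreal (G z w) \<partial>\<mu>)" for w
  proof (cases "w \<in> A")
    case True
    have "emeasure \<mu> A = (\<integral>\<^sup>+z. indicator A z \<partial>\<mu>)"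
      by simp
    also have "\<dots> \<le> (\<integral>\<^sup>+z. e2ennreal (G z w) \<partial>\<mu>)"
      using G1 True by (intro nn_integral_mono) (auto simp: indicator_def)
    finally show ?thesis
      using True by simp
  qed simp
  then have "(\<integral>\<^sup>+w. indicator A w * emeasure \<mu> A \<partial>\<mu>) \<le> interaction \<mu>"
    unfolding interaction_def by (intro nn_integral_mono)
  then have "emeasure \<mu> A * emeasure \<mu> A \<le> interaction \<mu>"
    by (subst (asm) nn_integral_multc) auto
  moreover have "emeasure \<mu> A * emeasure \<mu> A \<noteq> 0"
    using x by (simp add: A_def)
  ultimately show ?thesis
    by (metis gr_zeroI le_zero_eq)
qed

lemma diameter_bound: "\<exists>c\<ge>0. \<forall>z\<in>K. \<forall>w\<in>K. cmod (z - w) \<le> exp c"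
proof -
  obtain L where L: "L > 0" "\<And>z. z \<in> K \<Longrightarrow> cmod z \<le> L"
    using compact_imp_bounded[OF compact] bounded_pos by blast
  have "cmod (z - w) \<le> exp (2 * L)" if "z \<in> K" "w \<in> K" for z w
    using norm_triangle_ineq4[of z w] L(2)[OF that(1)] L(2)[OF that(2)] exp_ge_add_one_self[of "2 * L"] by linarith
  then show ?thesis
    using L(1) by (intro exI[of _ "2 * L"]) auto
qed

text \<open>Positive capacity supplies a probability measure of finite logarithmic energy on the set
  where \<open>f\<close> is negative. Its restriction to a piece with uniform constant and
  \<open>f\<close> bounded away from 0 has finite Green energy and negative field integral. For a
  small multiple the linear field term outweighs the quadratic interaction.\<close>

lemma negative_weighted_exists:
  assumes R: "R > 0" and cap: "log_capacity {z \<in> K. f z < 0} \<noteq> 0"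
  shows "\<exists>\<mu>\<in>measures_upto K R. weighted \<mu> < 0"
proof -
  obtain \<nu> C where s: "sets \<nu> = sets borel" and one: "emeasure \<nu> UNIV = 1"
    and C: "compact C" "C \<subseteq> {z \<in> K. f z < 0}" "emeasure \<nu> (- C) = 0" and "exp_minus (log_energy \<nu>) \<noteq> 0"
  proof -
    have "0 < log_capacity {z \<in> K. f z < 0}"
      using cap by (simp add: zero_less_iff_neq_zero)
    then show ?thesis
      unfolding log_capacity_def less_SUP_iff using that by auto
  qed
  then have en: "log_energy \<nu> \<noteq> \<infinity>"
    by (auto simp: exp_minus_def)
  have sp: "space \<nu> = UNIV"
    using sets_eq_imp_space_eq[OF s] by simp
  note [measurable_cong] = s
  have [measurable]: "C \<in> sets borel"
    using C(1) by (rule borel_compact)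
  have CK: "C \<subseteq> K"
    using C(2) by auto
  have AEC: "AE z in \<nu>. z \<in> C"
    using C(3) by (intro AE_I[of _ _ "- C"]) (auto simp: s)
  interpret \<nu>: finite_measure \<nu>
    using one sp by (intro finite_measureI) simp
  have "emeasure \<nu> (C \<union> - C) = emeasure \<nu> C + emeasure \<nu> (- C)"
    by (intro plus_emeasure[symmetric]) (auto simp: s)
  then have \<nu>C: "emeasure \<nu> C = 1"
    using one C(3) by simp
  define A where "A m n = C \<inter> sublevel m \<inter> uniform_poles n" for m n
  have [measurable]: "A m n \<in> sets borel" for m n
    unfolding A_def by measurable
  have "\<exists>m n. emeasure \<nu> (A m n) \<noteq> 0"
  proof (rule ccontr)
    assume "\<not> ?thesis"
    then have "emeasure \<nu> (\<Union>m. \<Union>n. A m n) = 0"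
      by (intro emeasure_UN_eq_0) (auto simp: s)
    moreover have "(\<Union>m. \<Union>n. A m n) = C"
    proof -
      have "(\<Union>m. \<Union>n. A m n) = C \<inter> (\<Union>m. sublevel m) \<inter> (\<Union>n. uniform_poles n)"
        by (auto simp: A_def)
      then show ?thesis
        using C(2) CK unfolding negative_set_eq[symmetric] uniform_poles_cover[symmetric] by blast
    qed
    ultimately show False
      using \<nu>C by simp
  qed
  then obtain m n where mn: "emeasure \<nu> (A m n) \<noteq> 0"
    by blast
  define B where "B = A m n"
  have [measurable]: "B \<in> sets borel"
    by (simp add: B_def)
  have BK: "B \<subseteq> K" and Bn: "B \<subseteq> uniform_poles n" and Bm: "B \<subseteq> sublevel m"
    unfolding B_def A_def using CK by blast+
  define \<mu> where "\<mu> = density \<nu> (indicator B)"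
  have em: "emeasure \<mu> X = emeasure \<nu> (B \<inter> X)" if "X \<in> sets borel" for X
    unfolding \<mu>_def using that by (subst emeasure_density) (auto simp: s indicator_inter_arith[symmetric])
  have \<mu>1: "\<mu> \<in> measures_upto K 1"
  proof -
    have "emeasure \<nu> (B \<inter> K) \<le> emeasure \<nu> UNIV"
      using sp s by (intro emeasure_mono) auto
    moreover have "B \<inter> - K = {}"
      using BK by auto
    ultimately show ?thesis
      using one em[of K] em[of "- K"] by (simp add: measures_upto_def s) (simp add: \<mu>_def s)
  qed
  have AEB: "AE z in \<mu>. z \<in> B"
    unfolding \<mu>_def by (subst AE_density) (auto simp: indicator_def)
  have le_\<nu>: "(\<integral>\<^sup>+x. h x \<partial>\<mu>) \<le> (\<integral>\<^sup>+x. h x \<partial>\<nu>)" if [measurable]: "h \<in> borel_measurable borel" for h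
    unfolding \<mu>_def by (subst nn_integral_density) (auto intro!: nn_integral_mono simp: indicator_def)
  obtain c where c: "c \<ge> 0" "\<And>z w. z \<in> K \<Longrightarrow> w \<in> K \<Longrightarrow> cmod (z - w) \<le> exp c"
    using diameter_bound by blast
  \<comment> \<open>A measurable majorant of the Green kernel on \<open>B\<close>, so that the outer
    integrals can be enlarged from \<mu> to \<nu>.\<close>
  define H where "H z w = e2ennreal (log_kernel z w + ereal c) + ennreal n" for z w
  have "interaction \<mu> < \<infinity>"
  proof -
    have GH: "e2ennreal (G z w) \<le> H z w" if "z \<in> B" "w \<in> B" for z w
    proof -
      have "G z w \<le> log_kernel z w + ereal n"
        using uniform_poles_estimate(1)[of w n z] that BK Bn by auto
      also have "\<dots> \<le> log_kernel z w + ereal c + ereal n"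
        using c(1) by (cases "log_kernel z w") auto
      finally have "e2ennreal (G z w) \<le> e2ennreal (log_kernel z w + ereal c + ereal n)"
        by (rule e2ennreal_mono)
      also have "\<dots> \<le> H z w"
        unfolding H_def by (intro e2ennreal_add_const_le) simp
      finally show ?thesis .
    qed
    have [measurable]: "(\<lambda>w. \<integral>\<^sup>+z. H z w \<partial>\<nu>) \<in> borel_measurable borel"
      using \<nu>.borel_measurable_nn_integral[of "\<lambda>w z. H z w" borel] unfolding H_def by simp
    have Hm [measurable]: "(\<lambda>z. H z w) \<in> borel_measurable borel" for w
      unfolding H_def by measurable
    have "interaction \<mu> \<le> (\<integral>\<^sup>+w. \<integral>\<^sup>+z. H z w \<partial>\<nu> \<partial>\<mu>)"
      unfolding interaction_def
    proof (rule nn_integral_mono_AE, use AEB in eventually_elim)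
      case (elim w)
      have "(\<integral>\<^sup>+z. e2ennreal (G z w) \<partial>\<mu>) \<le> (\<integral>\<^sup>+z. H z w \<partial>\<mu>)"
        by (rule nn_integral_mono_AE, use AEB in eventually_elim) (use GH elim in auto)
      also have "\<dots> \<le> (\<integral>\<^sup>+z. H z w \<partial>\<nu>)"
        by (rule le_\<nu>) simp
      finally show ?case .
    qed
    also have "\<dots> \<le> (\<integral>\<^sup>+w. \<integral>\<^sup>+z. H z w \<partial>\<nu> \<partial>\<nu>)"
      by (rule le_\<nu>) simp
    also have "\<dots> = (\<integral>\<^sup>+w. (\<integral>\<^sup>+z. e2ennreal (log_kernel z w + ereal c) \<partial>\<nu>) + ennreal n \<partial>\<nu>)"
      unfolding H_def by (subst nn_integral_add) (auto simp: sp one)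
    also have "\<dots> = (\<integral>\<^sup>+w. \<integral>\<^sup>+z. e2ennreal (log_kernel z w + ereal c) \<partial>\<nu> \<partial>\<nu>) + ennreal n"
      by (subst nn_integral_add) (auto simp: sp one)
    also have "\<dots> < \<infinity>"
    proof -
      have "(\<integral>\<^sup>+w. \<integral>\<^sup>+z. e2ennreal (log_kernel z w + ereal c) \<partial>\<nu> \<partial>\<nu>) \<noteq> \<infinity>"
        using en log_energy_eq_top_iff[OF s _ AEC c(1)] one c(2) CK by (auto simp: subset_eq)
      then show ?thesis
        by (auto simp: less_top[symmetric])
    qed
    finally show ?thesis .
  qed
  define F where "F = (\<integral>\<^sup>+z. e2ennreal (- f z) \<partial>\<mu>)"
  have Fp: "(\<integral>\<^sup>+z. e2ennreal (f z) \<partial>\<mu>) = (\<integral>\<^sup>+z. 0 \<partial>\<mu>)"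
  proof (rule nn_integral_cong_AE, use AEB in eventually_elim)
    case (elim z)
    then have "f z < 0"
      using Bm negative_set_eq by blast
    then show ?case
      by (simp add: e2ennreal_neg less_imp_le)
  qed
  have f_int: "ereal_integral \<mu> f = - enn2ereal F"
    unfolding ereal_integral_def Fp F_def by (simp add: zero_ennreal.rep_eq)
  have "F < \<infinity>"
    unfolding F_def by (rule integral_neg_part_finite[OF \<mu>1])
  have "weighted \<mu> < \<infinity>"
    using \<open>interaction \<mu> < \<infinity>\<close> \<open>F < \<infinity>\<close> unfolding weighted_def interaction_eq[OF \<mu>1] f_int
    by (cases F; cases "interaction \<mu>") auto
  then obtain i s' where dec: "i \<ge> 0" "interaction \<mu> = ennreal i" "ereal_integral \<mu> f = ereal s'"
    "\<And>t. t > 0 \<Longrightarrow> weighted (scale_measure (ennreal t) \<mu>) = ereal (t * t * i + 2 * t * s')"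
    using finite_weighted[OF \<mu>1] by metis
  have "(\<integral>\<^sup>+z. ennreal (1 / real (Suc m)) \<partial>\<mu>) \<le> F"
    unfolding F_def
  proof (rule nn_integral_mono_AE, use AEB in eventually_elim)
    case (elim z)
    then have "f z \<le> ereal (- (1 / real (Suc m)))"
      using Bm by (auto simp: sublevel_def)
    then have "ereal (1 / real (Suc m)) \<le> - f z"
      by (cases "f z") auto
    then show ?case
      using e2ennreal_mono by (fastforce simp: e2ennreal_ereal)
  qed
  moreover have "(\<integral>\<^sup>+z. ennreal (1 / real (Suc m)) \<partial>\<mu>) \<noteq> 0"
    using em[of UNIV] mn by (simp add: B_def \<mu>_def s sp)
  ultimately have "F \<noteq> 0"
    by (metis le_zero_eq)
  then have s': "s' < 0"
    using dec(3) \<open>F < \<infinity>\<close> unfolding f_int by (cases F) auto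
  \<comment> \<open>Chosen so that t i is at most -s'; then t i + 2 s' is at most s', which is
    negative. The bounds \<open>R\<close> and 1 keep the scaled measure admissible.\<close>
  define t where "t = min R (min 1 (- s' / (i + 1)))"
  have t: "t > 0" "t \<le> R" "t \<le> 1" "t \<le> - s' / (i + 1)"
    using R s' dec(1) by (auto simp: t_def intro!: divide_neg_pos)
  have "t * i \<le> - s'"
  proof -
    have "t * i \<le> t * (i + 1)"
      using t by simp
    also have "\<dots> \<le> - s'"
      using t(4) dec(1) by (subst (asm) pos_le_divide_eq) auto
    finally show ?thesis .
  qed
  then have "t * (t * i + 2 * s') < 0"
    using t(1) s' by (intro mult_pos_neg) auto
  then have "weighted (scale_measure (ennreal t) \<mu>) < 0"
    using dec(4)[OF t(1)] by (simp add: algebra_simps)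
  moreover have "scale_measure (ennreal t) \<mu> \<in> measures_upto K R"
  proof (rule scale_measures_upto[OF \<mu>1 t(1)])
    have "emeasure \<mu> K \<le> ennreal 1"
      using \<mu>1 by (simp add: measures_upto_def)
    then have "ennreal t * emeasure \<mu> K \<le> ennreal t * ennreal 1"
      by (rule mult_left_mono) simp
    also have "\<dots> \<le> ennreal R"
      using t by (simp add: ennreal_leI)
    finally show "ennreal t * emeasure \<mu> K \<le> ennreal R" .
  qed
  ultimately show ?thesis
    by blast
qed

text \<open>If \<mu> charged \<open>A\<close>, its normalised restriction would be a probability
  measure on a compact polar set. Finite Green energy and the uniform comparison of the kernels
  would give it finite logarithmic energy.\<close>

lemma finite_interaction_null_on_polar:
  assumes \<mu>: "\<mu> \<in> measures_upto K R" and fin: "interaction \<mu> < \<infinity>"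
    and A: "compact A" "A \<subseteq> uniform_poles n" "A \<subseteq> E" "log_capacity E = 0"
  shows "emeasure \<mu> A = 0"
proof (rule ccontr)
  assume A0: "emeasure \<mu> A \<noteq> 0"
  note s = measures_upto_facts(1)[OF \<mu>] and sp = measures_upto_facts(2)[OF \<mu>]
  note [measurable_cong] = s
  have [measurable]: "A \<in> sets borel"
    using A(1) by (rule borel_compact)
  have AK: "A \<subseteq> K"
    using A(2) by (auto simp: uniform_poles_def)
  have "emeasure \<mu> A \<le> emeasure \<mu> UNIV"
    using sp s by (intro emeasure_mono) auto
  then obtain a where a: "a > 0" "emeasure \<mu> A = ennreal a"
    using A0 measures_upto_facts(5)[OF \<mu>] by (cases "emeasure \<mu> A") (auto simp: top_unique order_le_less)
  define \<kappa> where "\<kappa> = 1 / a"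
  have \<kappa>: "\<kappa> > 0"
    using a by (simp add: \<kappa>_def)
  define \<nu> where "\<nu> = density \<mu> (\<lambda>z. ennreal \<kappa> * indicator A z)"
  have s\<nu>: "sets \<nu> = sets borel"
    by (simp add: \<nu>_def s)
  note [measurable_cong] = s\<nu>
  have int: "(\<integral>\<^sup>+z. h z \<partial>\<nu>) = ennreal \<kappa> * (\<integral>\<^sup>+z. indicator A z * h z \<partial>\<mu>)"
    if [measurable]: "h \<in> borel_measurable borel" for h
    unfolding \<nu>_def by (subst nn_integral_density) (auto simp: mult.assoc nn_integral_cmult)
  have one: "emeasure \<nu> UNIV = 1"
    unfolding \<nu>_def using a \<kappa> by (subst emeasure_density)
      (auto simp: s nn_integral_cmult ennreal_mult[symmetric] \<kappa>_def)
  have nullA: "emeasure \<nu> (- A) = 0"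
    unfolding \<nu>_def by (subst emeasure_density) (auto simp: s mult.assoc indicator_inter_arith[symmetric])
  then have AEA: "AE z in \<nu>. z \<in> A"
    by (intro AE_I[of _ _ "- A"]) (auto simp: s\<nu>)
  interpret \<nu>: finite_measure \<nu>
    using one sets_eq_imp_space_eq[OF s\<nu>] by (intro finite_measureI) simp
  have sp\<nu>: "space \<nu> = UNIV"
    using sets_eq_imp_space_eq[OF s\<nu>] by simp
  obtain c where c: "c \<ge> 0" "\<And>z w. z \<in> K \<Longrightarrow> w \<in> K \<Longrightarrow> cmod (z - w) \<le> exp c"
    using diameter_bound by blast
  \<comment> \<open>On \<open>A\<close> the logarithmic kernel is at most \<open>G\<close> plus
    \<open>n\<close>, and \<open>c\<close> is the shift that makes it nonnegative.\<close>
  define k where "k = real n + c"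
  define a' where "a' z w = e2ennreal (log_kernel z w + ereal c)" for z w
  have [measurable]: "(\<lambda>z. a' z w) \<in> borel_measurable borel" for w
    unfolding a'_def by measurable
  have [measurable]: "(\<lambda>w. \<integral>\<^sup>+z. a' z w - ennreal k \<partial>\<nu>) \<in> borel_measurable borel"
    using \<nu>.borel_measurable_nn_integral[of "\<lambda>w z. a' z w - ennreal k" borel] unfolding a'_def by simp
  have est: "a' z w - ennreal k \<le> e2ennreal (G z w)" if "z \<in> A" "w \<in> A" for z w
  proof (rule ennreal_diff_le)
    have "log_kernel z w \<le> G z w + ereal n"
      using uniform_poles_estimate(2)[of w n z] that A(2) AK by auto
    then have "log_kernel z w + ereal c \<le> G z w + ereal k"
      unfolding k_def by (cases "log_kernel z w"; cases "G z w") auto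
    then have "a' z w \<le> e2ennreal (G z w + ereal k)"
      unfolding a'_def by (rule e2ennreal_mono)
    also have "\<dots> \<le> e2ennreal (G z w) + ennreal k"
      using c(1) by (intro e2ennreal_add_const_le) (simp add: k_def)
    finally show "a' z w \<le> e2ennreal (G z w) + ennreal k" .
  qed
  \<comment> \<open>The density formula is applied to the measurable function
    \<open>a' z w - ennreal k\<close>; the Green kernel enters only afterwards, by
    monotonicity.\<close>
  have inner: "(\<integral>\<^sup>+z. a' z w - ennreal k \<partial>\<nu>) \<le> ennreal \<kappa> * (\<integral>\<^sup>+z. e2ennreal (G z w) \<partial>\<mu>)" if "w \<in> A" for w
    using est[OF _ that] by (subst int) (auto intro!: mult_left_mono nn_integral_mono simp: indicator_def)
  have "(\<integral>\<^sup>+w. \<integral>\<^sup>+z. a' z w - ennreal k \<partial>\<nu> \<partial>\<nu>) =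
      ennreal \<kappa> * (\<integral>\<^sup>+w. indicator A w * (\<integral>\<^sup>+z. a' z w - ennreal k \<partial>\<nu>) \<partial>\<mu>)"
    by (rule int) simp
  also have "\<dots> \<le> ennreal \<kappa> * (\<integral>\<^sup>+w. ennreal \<kappa> * (\<integral>\<^sup>+z. e2ennreal (G z w) \<partial>\<mu>) \<partial>\<mu>)"
    using inner by (intro mult_left_mono nn_integral_mono) (auto simp: indicator_def)
  also have "\<dots> = ennreal \<kappa> * (ennreal \<kappa> * interaction \<mu>)"
    unfolding interaction_def nn_integral_cmult_arbitrary[OF \<kappa>] ..
  also have "\<dots> < \<infinity>"
    using fin by (simp add: ennreal_mult_less_top)
  finally have fin': "(\<integral>\<^sup>+w. \<integral>\<^sup>+z. a' z w - ennreal k \<partial>\<nu> \<partial>\<nu>) < \<infinity>" .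
  have "(\<integral>\<^sup>+w. \<integral>\<^sup>+z. a' z w \<partial>\<nu> \<partial>\<nu>) \<le> (\<integral>\<^sup>+w. \<integral>\<^sup>+z. (a' z w - ennreal k) + ennreal k \<partial>\<nu> \<partial>\<nu>)"
    by (intro nn_integral_mono ennreal_le_diff_add)
  also have "\<dots> = (\<integral>\<^sup>+w. (\<integral>\<^sup>+z. a' z w - ennreal k \<partial>\<nu>) + ennreal k \<partial>\<nu>)"
    by (intro nn_integral_cong, subst nn_integral_add) (auto simp: sp\<nu> one)
  also have "\<dots> = (\<integral>\<^sup>+w. \<integral>\<^sup>+z. a' z w - ennreal k \<partial>\<nu> \<partial>\<nu>) + ennreal k"
    by (subst nn_integral_add) (auto simp: sp\<nu> one)
  also have "\<dots> < \<infinity>"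
    using fin' by (auto simp: less_top[symmetric])
  finally have "(\<integral>\<^sup>+w. \<integral>\<^sup>+z. a' z w \<partial>\<nu> \<partial>\<nu>) < \<infinity>" .
  moreover have "log_energy \<nu> = \<infinity>"
    by (rule log_capacity_zero_imp_energy[OF A(4) s\<nu> one A(1) A(3) nullA])
  then have "(\<integral>\<^sup>+w. \<integral>\<^sup>+z. a' z w \<partial>\<nu> \<partial>\<nu>) = \<infinity>"
    using log_energy_eq_top_iff[OF s\<nu> _ AEA c(1)] one c(2) AK unfolding a'_def by (auto simp: subset_eq)
  ultimately show False
    by simp
qed

text \<open>The set where \<open>f\<close> is negative is a countable union of compact polar pieces
  with uniform constants, each of which is a null set of a measure with finite interaction.\<close>

lemma polar_negative_set_imp_nonneg:
  assumes \<mu>: "\<mu> \<in> measures_upto K R" and fin: "interaction \<mu> < \<infinity>"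
    and cap: "log_capacity {z \<in> K. f z < 0} = 0"
  shows "ereal_integral \<mu> f \<ge> 0"
proof -
  note s = measures_upto_facts(1)[OF \<mu>]
  have "emeasure \<mu> (sublevel m \<inter> uniform_poles n) = 0" for m n
  proof (rule finite_interaction_null_on_polar[OF \<mu> fin _ _ _ cap])
    have "compact (K \<inter> (sublevel m \<inter> uniform_poles n))"
      using compact closed_sublevel closed_uniform_poles by (intro compact_Int_closed closed_Int)
    then show "compact (sublevel m \<inter> uniform_poles n)"
      by (rule back_subst[where P = compact]) (auto simp: sublevel_def)
    show "sublevel m \<inter> uniform_poles n \<subseteq> {z \<in> K. f z < 0}"
      unfolding negative_set_eq by auto
  qed auto
  then have "emeasure \<mu> (\<Union>m. \<Union>n. sublevel m \<inter> uniform_poles n) = 0"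
    by (intro emeasure_UN_eq_0) (auto simp: s)
  moreover have "(\<Union>m. \<Union>n. sublevel m \<inter> uniform_poles n) = {z \<in> K. f z < 0}"
  proof -
    have "(\<Union>m. \<Union>n. sublevel m \<inter> uniform_poles n) = (\<Union>m. sublevel m) \<inter> (\<Union>n. uniform_poles n)"
      by auto
    then show ?thesis
      unfolding negative_set_eq[symmetric] uniform_poles_cover[symmetric] by blast
  qed
  ultimately have "emeasure \<mu> {z \<in> K. f z < 0} = 0"
    by simp
  moreover have "{z \<in> K. f z < 0} \<in> sets \<mu>"
    unfolding negative_set_eq s by measurable
  ultimately have "AE z in \<mu>. z \<notin> {z \<in> K. f z < 0}"
    by (intro AE_not_in) (auto simp: null_sets_def)
  then have "AE z in \<mu>. 0 \<le> f z"
    using measures_upto_facts(3)[OF \<mu>] by eventually_elim auto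
  then have "(\<integral>\<^sup>+z. e2ennreal (- f z) \<partial>\<mu>) = (\<integral>\<^sup>+z. 0 \<partial>\<mu>)"
    by (intro nn_integral_cong_AE) (elim AE_mp, auto simp: e2ennreal_neg)
  then show ?thesis
    by (simp add: ereal_integral_def zero_ennreal.rep_eq)
qed

section \<open>The minimizing measure\<close>

context
  fixes \<mu> R
  assumes R: "R > 0" and \<mu>: "\<mu> \<in> measures_upto K R"
    and minimal: "\<And>\<nu>. \<nu> \<in> measures_upto K R \<Longrightarrow> weighted \<mu> \<le> weighted \<nu>"
begin

lemma minimum_nonpos: "weighted \<mu> \<le> 0"
  using minimal[OF null_measures_upto] by (simp add: weighted_null)

lemma minimum_finite: "weighted \<mu> < \<infinity>"
  using minimum_nonpos by (auto intro: le_less_trans)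

text \<open>If the negative set has positive capacity, some admissible measure beats the zero
  measure. If it is polar, the field integral is nonnegative, so a nonpositive minimum leaves no
  interaction and therefore no mass.\<close>

lemma minimizer_zero_iff: "\<mu> = null_measure borel \<longleftrightarrow> log_capacity {z \<in> K. f z < 0} = 0"
proof
  assume 0: "\<mu> = null_measure borel"
  show "log_capacity {z \<in> K. f z < 0} = 0"
  proof (rule ccontr)
    assume "log_capacity {z \<in> K. f z < 0} \<noteq> 0"
    from negative_weighted_exists[OF R this] obtain \<nu> where "\<nu> \<in> measures_upto K R" "weighted \<nu> < 0"
      by blast
    then show False
      using minimal[of \<nu>] unfolding 0 weighted_null by simp
  qed
next
  assume cap: "log_capacity {z \<in> K. f z < 0} = 0"
  obtain i s where dec: "i \<ge> 0" "interaction \<mu> = ennreal i" "ereal_integral \<mu> f = ereal s"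
    "weighted \<mu> = ereal (i + 2 * s)"
    using finite_weighted[OF \<mu> minimum_finite] by metis
  have "s \<ge> 0"
    using polar_negative_set_imp_nonneg[OF \<mu> _ cap] dec by simp
  then have "i = 0"
    using minimum_nonpos dec by simp
  then have K0: "emeasure \<mu> K = 0"
    using interaction_pos[OF \<mu>] dec by (auto simp: zero_less_iff_neq_zero)
  note facts = measures_upto_facts[OF \<mu>]
  show "\<mu> = null_measure borel"
  proof (rule measure_eqI)
    show "sets \<mu> = sets (null_measure borel)"
      using facts(1) by simp
    fix A assume "A \<in> sets \<mu>"
    then have "emeasure \<mu> A \<le> emeasure \<mu> UNIV"
      using facts(1,2) by (intro emeasure_mono) auto
    then show "emeasure \<mu> A = emeasure (null_measure borel) A"
      using K0 facts(4) by simp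
  qed
qed

text \<open>Below the maximal mass both directions of scaling are admissible, so t = 1 minimises t *
  t * i + 2 * t * s in the interior of an interval, and the derivative 2 i + 2 s vanishes.\<close>

lemma minimizer_small_mass:
  assumes "measure \<mu> K < R"
  shows "weighted \<mu> = ereal_integral \<mu> f" "weighted \<mu> = - enn2ereal (interaction \<mu>)"
proof -
  obtain i s where dec: "i \<ge> 0" "interaction \<mu> = ennreal i" "ereal_integral \<mu> f = ereal s"
    "weighted \<mu> = ereal (i + 2 * s)"
    "\<And>t. t > 0 \<Longrightarrow> weighted (scale_measure (ennreal t) \<mu>) = ereal (t * t * i + 2 * t * s)"
    using finite_weighted[OF \<mu> minimum_finite] by metis
  define m where "m = measure \<mu> K"
  have m: "m \<ge> 0" "m < R" and em: "emeasure \<mu> K = ennreal m"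
    using assms measures_upto_facts(4,5)[OF \<mu>] by (auto simp: m_def emeasure_eq_ennreal_measure)
  have le: "i + 2 * s \<le> t * t * i + 2 * t * s" if t: "t > 0" "t * m \<le> R" for t
  proof -
    have "scale_measure (ennreal t) \<mu> \<in> measures_upto K R"
      using t m(1) by (intro scale_measures_upto[OF \<mu>]) (auto simp: em ennreal_mult[symmetric] ennreal_leI)
    then show ?thesis
      using minimal dec(4) dec(5)[OF t(1)] by (metis ereal_less_eq(3))
  qed
  \<comment> \<open>Keeps (1 + \<epsilon>) m at most \<open>R\<close>; the denominator
    \<open>m + 1\<close> also serves m = 0.\<close>
  define \<epsilon>0 where "\<epsilon>0 = min (1 / 2) ((R - m) / (m + 1))"
  have \<epsilon>0: "\<epsilon>0 > 0" "\<epsilon>0 < 1" "\<epsilon>0 \<le> (R - m) / (m + 1)"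
    using m by (auto simp: \<epsilon>0_def)
  have upper: "0 \<le> (2 + \<epsilon>) * i + 2 * s" and lower: "(2 - \<epsilon>) * i + 2 * s \<le> 0" if \<epsilon>: "\<epsilon> > 0" "\<epsilon> \<le> \<epsilon>0" for \<epsilon>
  proof -
    have "\<epsilon> * (m + 1) \<le> R - m"
      using order_trans[OF \<epsilon>(2) \<epsilon>0(3)] m by (simp add: pos_le_divide_eq)
    then have "i + 2 * s \<le> (1 + \<epsilon>) * (1 + \<epsilon>) * i + 2 * (1 + \<epsilon>) * s"
      using \<epsilon> by (intro le) (auto simp: algebra_simps)
    then have "0 \<le> \<epsilon> * ((2 + \<epsilon>) * i + 2 * s)"
      by (simp add: algebra_simps)
    then show "0 \<le> (2 + \<epsilon>) * i + 2 * s"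
      using \<epsilon> by (simp add: zero_le_mult_iff)
    have "(1 - \<epsilon>) * m \<le> 1 * m"
      using \<epsilon> m by (intro mult_right_mono) auto
    then have "i + 2 * s \<le> (1 - \<epsilon>) * (1 - \<epsilon>) * i + 2 * (1 - \<epsilon>) * s"
      using \<epsilon> \<epsilon>0 m by (intro le) auto
    then have "0 \<le> \<epsilon> * (- ((2 - \<epsilon>) * i + 2 * s))"
      by (simp add: algebra_simps)
    then show "(2 - \<epsilon>) * i + 2 * s \<le> 0"
      using \<epsilon> by (simp add: zero_le_mult_iff)
  qed
  have "i + s = 0"
  proof (rule ccontr)
    assume ne: "i + s \<noteq> 0"
    \<comment> \<open>The one-sided conditions give 2 |i + s| at most \<epsilon> i, and this
      \<epsilon> makes the latter at most |i + s|.\<close>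
    define \<epsilon> where "\<epsilon> = min \<epsilon>0 (\<bar>i + s\<bar> / (i + 1))"
    have \<epsilon>: "\<epsilon> > 0" "\<epsilon> \<le> \<epsilon>0" "\<epsilon> \<le> \<bar>i + s\<bar> / (i + 1)"
      using \<epsilon>0 ne dec(1) by (auto simp: \<epsilon>_def intro!: divide_pos_pos)
    have "\<epsilon> * i \<le> \<epsilon> * (i + 1)"
      using \<epsilon> by simp
    also have "\<dots> \<le> \<bar>i + s\<bar>"
      using \<epsilon>(3) dec(1) by (simp add: pos_le_divide_eq)
    finally have "\<epsilon> * i \<le> \<bar>i + s\<bar>" .
    then show False
      using upper[OF \<epsilon>(1,2)] lower[OF \<epsilon>(1,2)] ne by (simp add: algebra_simps)
  qed
  then have s: "s = - i"
    by linarith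
  show "weighted \<mu> = ereal_integral \<mu> f" "weighted \<mu> = - enn2ereal (interaction \<mu>)"
    unfolding dec(2-4) using dec(1) s by auto
qed

text \<open>If the minimum were 0, then s = - i / 2 with i > 0, and halving the measure would give i
  / 4 + s = - i / 4.\<close>

lemma minimum_negative:
  assumes "measure \<mu> K > 0"
  shows "weighted \<mu> < 0"
proof (rule ccontr)
  assume "\<not> weighted \<mu> < 0"
  then have w0: "weighted \<mu> = 0"
    using minimum_nonpos by simp
  obtain i s where dec: "i \<ge> 0" "interaction \<mu> = ennreal i"
    "weighted \<mu> = ereal (i + 2 * s)"
    "\<And>t. t > 0 \<Longrightarrow> weighted (scale_measure (ennreal t) \<mu>) = ereal (t * t * i + 2 * t * s)"
    using finite_weighted[OF \<mu> minimum_finite] by metis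
  have "emeasure \<mu> K > 0"
    using assms by (auto simp: measure_def zero_less_iff_neq_zero)
  then have "i > 0"
    using interaction_pos[OF \<mu>] dec(2) by simp
  moreover have "scale_measure (ennreal (1 / 2)) \<mu> \<in> measures_upto K R"
  proof (rule scale_measures_upto[OF \<mu>])
    have "ennreal (1 / 2) * emeasure \<mu> K \<le> ennreal 1 * emeasure \<mu> K"
      by (intro mult_right_mono ennreal_leI) auto
    also have "\<dots> \<le> ennreal R"
      using \<mu> by (simp add: measures_upto_def)
    finally show "ennreal (1 / 2) * emeasure \<mu> K \<le> ennreal R" .
  qed simp
  then have "0 \<le> weighted (scale_measure (ennreal (1 / 2)) \<mu>)"
    using minimal w0 by metis
  then have "0 \<le> i / 4 + s"
    using dec(4)[of "1 / 2"] by simp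
  moreover have "i + 2 * s = 0"
    using w0 dec(3) by simp
  ultimately show False
    by linarith
qed

end

end


section \<open>The discrete energy problem\<close>

text \<open>A single mass occurs only in the row and the column of its own index; separating these
  displays the affine dependence on it.\<close>

lemma sum_off_diagonal_insert:
  fixes w :: "'i \<Rightarrow> 'i \<Rightarrow> 'a :: comm_monoid_add"
  assumes "finite T" "i \<notin> T"
  shows "(\<Sum>k\<in>insert i T. \<Sum>j\<in>insert i T - {k}. w k j) =
    (\<Sum>j\<in>T. w i j) + (\<Sum>k\<in>T. w k i) + (\<Sum>k\<in>T. \<Sum>j\<in>T - {k}. w k j)"
proof -
  have "(\<Sum>j\<in>insert i T - {k}. w k j) = w k i + (\<Sum>j\<in>T - {k}. w k j)" if "k \<in> T" for k
  proof -
    have "insert i T - {k} = insert i (T - {k})"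
      using that assms(2) by auto
    then show ?thesis
      using assms by simp
  qed
  then have "(\<Sum>k\<in>T. \<Sum>j\<in>insert i T - {k}. w k j) = (\<Sum>k\<in>T. w k i) + (\<Sum>k\<in>T. \<Sum>j\<in>T - {k}. w k j)"
    by (simp add: sum.distrib)
  moreover have "insert i T - {i} = T"
    using assms(2) by auto
  ultimately show ?thesis
    using assms by (simp add: add.assoc)
qed

text \<open>An arbitrary index set allows one particle to be removed and the others to be
  renumbered.\<close>

definition pair_sum :: "(complex \<Rightarrow> complex \<Rightarrow> ereal) \<Rightarrow> nat set \<Rightarrow> (nat \<Rightarrow> complex) \<Rightarrow> (nat \<Rightarrow> real) \<Rightarrow> ereal" where
  "pair_sum G I z m = (\<Sum>i\<in>I. \<Sum>j\<in>I - {i}. ereal (m i * m j) * G (z i) (z j))"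

definition field_sum :: "(complex \<Rightarrow> ereal) \<Rightarrow> nat set \<Rightarrow> (nat \<Rightarrow> complex) \<Rightarrow> (nat \<Rightarrow> real) \<Rightarrow> ereal" where
  "field_sum f I z m = (\<Sum>j\<in>I. ereal (m j) * f (z j))"

lemma discrete_energy_eq:
  "discrete_energy g f N (z, m) =
    pair_sum (\<lambda>z w. g (Some z) (Some w)) {1..N} z m + ereal (2 * real N) * field_sum f {1..N} z m"
  by (simp add: discrete_energy_def pair_sum_def field_sum_def)

lemma pair_sum_insert_zero:
  assumes "finite T" "i \<notin> T" "m i = 0"
  shows "pair_sum G (insert i T) z m = pair_sum G T z m"
  unfolding pair_sum_def sum_off_diagonal_insert[OF assms(1,2)] by (simp add: assms(3) zero_ereal_def[symmetric])

lemma field_sum_insert_zero: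
  assumes "finite T" "i \<notin> T" "m i = 0"
  shows "field_sum f (insert i T) z m = field_sum f T z m"
  using assms by (simp add: field_sum_def zero_ereal_def[symmetric])

lemma pair_sum_cong:
  assumes "\<And>i. i \<in> I \<Longrightarrow> z i = z' i" "\<And>i. i \<in> I \<Longrightarrow> m i = m' i"
  shows "pair_sum G I z m = pair_sum G I z' m'"
  unfolding pair_sum_def by (intro sum.cong refl) (auto simp: assms)

lemma field_sum_cong:
  assumes "\<And>i. i \<in> I \<Longrightarrow> z i = z' i" "\<And>i. i \<in> I \<Longrightarrow> m i = m' i"
  shows "field_sum f I z m = field_sum f I z' m'"
  unfolding field_sum_def by (intro sum.cong refl) (auto simp: assms)

lemma pair_sum_reindex:
  assumes \<sigma>: "bij_betw \<sigma> I J"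
  shows "pair_sum G J z m = pair_sum G I (z \<circ> \<sigma>) (m \<circ> \<sigma>)"
proof -
  have "pair_sum G J z m = (\<Sum>i\<in>I. \<Sum>j\<in>J - {\<sigma> i}. ereal (m (\<sigma> i) * m j) * G (z (\<sigma> i)) (z j))"
    unfolding pair_sum_def by (rule sum.reindex_bij_betw[OF \<sigma>, symmetric])
  also have "\<dots> = pair_sum G I (z \<circ> \<sigma>) (m \<circ> \<sigma>)"
    unfolding pair_sum_def o_def
  proof (rule sum.cong[OF refl])
    fix i assume i: "i \<in> I"
    have "bij_betw \<sigma> (I - {i}) (J - {\<sigma> i})"
      using bij_betw_DiffI[OF \<sigma>, of "{i}" "{\<sigma> i}"] i \<sigma> by (auto simp: bij_betw_def)
    then show "(\<Sum>j\<in>J - {\<sigma> i}. ereal (m (\<sigma> i) * m j) * G (z (\<sigma> i)) (z j)) =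
        (\<Sum>j\<in>I - {i}. ereal (m (\<sigma> i) * m (\<sigma> j)) * G (z (\<sigma> i)) (z (\<sigma> j)))"
      by (rule sum.reindex_bij_betw[symmetric])
  qed
  finally show ?thesis .
qed

lemma field_sum_reindex:
  assumes \<sigma>: "bij_betw \<sigma> I J"
  shows "field_sum f J z m = field_sum f I (z \<circ> \<sigma>) (m \<circ> \<sigma>)"
  unfolding field_sum_def o_def by (rule sum.reindex_bij_betw[OF \<sigma>, symmetric])

lemma discrete_minimizerD:
  assumes "discrete_minimizer g f K R N z m"
  shows "\<And>i. i \<in> {1..N} \<Longrightarrow> z i \<in> K" "\<And>i. i \<in> {1..N} \<Longrightarrow> 0 \<le> m i" "\<And>i. i \<in> {1..N} \<Longrightarrow> m i \<le> R"
    and "\<And>z' m'. \<lbrakk>\<And>i. i \<in> {1..N} \<Longrightarrow> z' i \<in> K; \<And>i. i \<in> {1..N} \<Longrightarrow> m' i \<in> {0..R}\<rbrakk> \<Longrightarrow>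
      discrete_energy g f N (z, m) \<le> discrete_energy g f N (z', m')"
    and "min_discrete_energy g f K R N = discrete_energy g f N (z, m)"
proof -
  have c: "(z, m) \<in> configurations K R N"
    and le: "\<And>c. c \<in> configurations K R N \<Longrightarrow> discrete_energy g f N (z, m) \<le> discrete_energy g f N c"
    using assms by (auto simp: discrete_minimizer_def is_arg_min_def not_less)
  show "\<And>i. i \<in> {1..N} \<Longrightarrow> z i \<in> K" "\<And>i. i \<in> {1..N} \<Longrightarrow> 0 \<le> m i" "\<And>i. i \<in> {1..N} \<Longrightarrow> m i \<le> R"
    using c by (auto simp: configurations_def Pi_iff)
  show "\<And>z' m'. \<lbrakk>\<And>i. i \<in> {1..N} \<Longrightarrow> z' i \<in> K; \<And>i. i \<in> {1..N} \<Longrightarrow> m' i \<in> {0..R}\<rbrakk> \<Longrightarrow>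
      discrete_energy g f N (z, m) \<le> discrete_energy g f N (z', m')"
    by (intro le) (auto simp: configurations_def)
  show "min_discrete_energy g f K R N = discrete_energy g f N (z, m)"
    unfolding min_discrete_energy_def using c le by (intro antisym INF_lower INF_greatest) auto
qed

lemma discrete_energy_zero_mass: "discrete_energy g f N (z, \<lambda>_. 0) = 0"
  by (simp add: discrete_energy_def zero_ereal_def[symmetric])

lemma discrete_minimum_nonpos:
  assumes "discrete_minimizer g f K R N z m" "0 \<le> R"
  shows "discrete_energy g f N (z, m) \<le> 0"
proof -
  have "discrete_energy g f N (z, m) \<le> discrete_energy g f N (z, \<lambda>_. 0)"
    using assms(2) discrete_minimizerD(1)[OF assms(1)] by (intro discrete_minimizerD(4)[OF assms(1)]) auto
  then show ?thesis
    by (simp add: discrete_energy_zero_mass)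
qed

lemma field_sum_not_MInf:
  assumes "\<And>i. i \<in> I \<Longrightarrow> f (z i) \<noteq> -\<infinity>" "\<And>i. i \<in> I \<Longrightarrow> 0 \<le> m i"
  shows "field_sum f I z m \<noteq> -\<infinity>"
proof -
  have "\<forall>i\<in>I. ereal (m i) * f (z i) \<noteq> -\<infinity>"
  proof
    fix i assume "i \<in> I"
    then show "ereal (m i) * f (z i) \<noteq> -\<infinity>"
      using assms[of i] by (cases "f (z i)") auto
  qed
  then show ?thesis
    unfolding field_sum_def by (induction I rule: infinite_finite_induct) auto
qed

section \<open>Minimizers of the discrete energy\<close>

context weighted_green_kernel
begin

lemma pair_sum_nonneg:
  assumes "\<And>i. i \<in> I \<Longrightarrow> z i \<in> K" "\<And>i. i \<in> I \<Longrightarrow> 0 \<le> m i"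
  shows "0 \<le> pair_sum G I z m"
  unfolding pair_sum_def using assms nonneg by (intro sum_nonneg) auto

text \<open>Any configuration can be extended by a particle of mass 0. This changes only the factor
  2 N of the field term, and a larger factor lowers a nonpositive sum.\<close>

lemma discrete_min_decreasing:
  assumes G: "G = (\<lambda>z w. g (Some z) (Some w))" and neg: "\<And>z. z \<in> K \<Longrightarrow> f z \<le> 0" and N: "N \<ge> 1" and R: "R \<ge> 0"
  shows "min_discrete_energy g f K R (N + 1) \<le> min_discrete_energy g f K R N"
  unfolding min_discrete_energy_def
proof (rule INF_mono)
  fix c assume c: "c \<in> configurations K R N"
  obtain z m where zm: "c = (z, m)"
    by (cases c)
  have z: "\<And>i. i \<in> {1..N} \<Longrightarrow> z i \<in> K" and m: "\<And>i. i \<in> {1..N} \<Longrightarrow> m i \<in> {0..R}"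
    using c by (auto simp: zm configurations_def)
  \<comment> \<open>The new particle sits at \<open>z 1\<close> merely to lie in \<open>K\<close>.
    The infinite kernel value at this coincidence is cancelled by the convention for zero
    mass.\<close>
  define z' m' where "z' = z(N + 1 := z 1)" and "m' = m(N + 1 := 0)"
  have "(z', m') \<in> configurations K R (N + 1)"
    using z m N R by (auto simp: configurations_def z'_def m'_def)
  moreover have "discrete_energy g f (N + 1) (z', m') \<le> discrete_energy g f N c"
  proof -
    have ins: "{1..N + 1} = insert (N + 1) {1..N}"
      by auto
    have "pair_sum G {1..N + 1} z' m' = pair_sum G {1..N} z' m'"
      unfolding ins by (rule pair_sum_insert_zero) (auto simp: m'_def)
    also have "\<dots> = pair_sum G {1..N} z m"
      by (rule pair_sum_cong) (auto simp: z'_def m'_def)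
    finally have P: "pair_sum G {1..N + 1} z' m' = pair_sum G {1..N} z m" .
    have "field_sum f {1..N + 1} z' m' = field_sum f {1..N} z' m'"
      unfolding ins by (rule field_sum_insert_zero) (auto simp: m'_def)
    also have "\<dots> = field_sum f {1..N} z m"
      by (rule field_sum_cong) (auto simp: z'_def m'_def)
    finally have F: "field_sum f {1..N + 1} z' m' = field_sum f {1..N} z m" .
    have "field_sum f {1..N} z m \<le> 0"
      unfolding field_sum_def using z m neg by (intro sum_nonpos) (auto simp: ereal_mult_le_0_iff)
    then have "ereal (2 * real (N + 1)) * field_sum f {1..N} z m \<le> ereal (2 * real N) * field_sum f {1..N} z m"
      by (cases "field_sum f {1..N} z m") (auto intro: mult_right_mono_neg)
    then show ?thesis
      unfolding zm discrete_energy_eq G[symmetric] P F by (intro add_left_mono)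
  qed
  ultimately show "\<exists>c'\<in>configurations K R (N + 1). discrete_energy g f (N + 1) c' \<le> discrete_energy g f N c"
    by blast
qed

text \<open>Coinciding particles with positive masses have infinite energy, whereas zero masses show
  that the minimum is at most 0.\<close>

lemma discrete_minimizer_distinct:
  assumes G: "G = (\<lambda>z w. g (Some z) (Some w))" and R: "R \<ge> 0" and min: "discrete_minimizer g f K R N z m"
    and ij: "i \<in> {1..N}" "j \<in> {1..N}" "i \<noteq> j" "m i > 0" "m j > 0"
  shows "z i \<noteq> z j"
proof
  assume eq: "z i = z j"
  note zK = discrete_minimizerD(1)[OF min] and m0 = discrete_minimizerD(2)[OF min]
  have "ereal (m i * m j) * G (z i) (z j) = \<infinity>"
    using ij diag[OF zK[OF ij(2)]] by (simp add: eq)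
  then have "(\<Sum>j\<in>{1..N} - {i}. ereal (m i * m j) * G (z i) (z j)) = \<infinity>"
    unfolding sum_Pinfty using ij(2,3) by (intro conjI bexI[of _ j]) simp_all
  then have "pair_sum G {1..N} z m = \<infinity>"
    unfolding pair_sum_def using ij(1) by (auto simp: sum_Pinfty)
  moreover have "field_sum f {1..N} z m \<noteq> -\<infinity>"
    using zK m0 f_not_MInf by (intro field_sum_not_MInf) auto
  then have "ereal (2 * real N) * field_sum f {1..N} z m \<noteq> -\<infinity>"
    by (cases "field_sum f {1..N} z m") auto
  ultimately have "discrete_energy g f N (z, m) = \<infinity>"
    unfolding discrete_energy_eq G[symmetric] by simp
  then show False
    using discrete_minimum_nonpos[OF min R] by simp
qed

text \<open>Removing a particle of mass 0 turns the minimizer for N + 1 into a competitor for N. The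
  two energies differ only by twice the field sum, which is at least 2 R N \<beta>, contrary to the
  assumed gap.\<close>

lemma discrete_minimizer_all_positive:
  assumes G: "G = (\<lambda>z w. g (Some z) (Some w))" and R: "R \<ge> 0"
    and \<beta>: "\<And>z. z \<in> K \<Longrightarrow> \<beta> \<le> f z" "\<beta> < 0"
    and gap: "min_discrete_energy g f K R (N + 1) < min_discrete_energy g f K R N + ereal (2 * R * real N) * \<beta>"
    and min: "discrete_minimizer g f K R (N + 1) z m" and j: "j \<in> {1..N + 1}"
  shows "m j > 0"
proof (rule ccontr)
  assume "\<not> m j > 0"
  then have mj: "m j = 0"
    using discrete_minimizerD(2)[OF min j] by simp
  note zK = discrete_minimizerD(1)[OF min] and m0 = discrete_minimizerD(2)[OF min] and mR = discrete_minimizerD(3)[OF min]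
  \<comment> \<open>Renumbers the remaining particles by skipping the index
    \<open>j\<close>.\<close>
  define \<sigma> where "\<sigma> i = (if i < j then i else i + 1)" for i :: nat
  have \<sigma>: "bij_betw \<sigma> {1..N} ({1..N + 1} - {j})"
    by (rule bij_betw_byWitness[where f' = "\<lambda>k. if k < j then k else k - 1"])
      (use j in \<open>auto simp: \<sigma>_def split: if_splits\<close>)
  have ins: "{1..N + 1} = insert j ({1..N + 1} - {j})"
    using j by auto
  define z' m' where "z' = z \<circ> \<sigma>" and "m' = m \<circ> \<sigma>"
  have \<sigma>in: "\<sigma> i \<in> {1..N + 1}" if "i \<in> {1..N}" for i
    using bij_betwE[OF \<sigma>] that by auto
  have z'K: "z' i \<in> K" and m'0: "0 \<le> m' i" and m'R: "m' i \<le> R" if "i \<in> {1..N}" for i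
    using zK[OF \<sigma>in[OF that]] m0[OF \<sigma>in[OF that]] mR[OF \<sigma>in[OF that]] by (auto simp: z'_def m'_def)
  have "pair_sum G {1..N + 1} z m = pair_sum G ({1..N + 1} - {j}) z m"
    by (subst ins, rule pair_sum_insert_zero) (auto simp: mj)
  then have P: "pair_sum G {1..N + 1} z m = pair_sum G {1..N} z' m'"
    using pair_sum_reindex[OF \<sigma>] by (simp add: z'_def m'_def)
  have "field_sum f {1..N + 1} z m = field_sum f ({1..N + 1} - {j}) z m"
    by (subst ins, rule field_sum_insert_zero) (auto simp: mj)
  then have F: "field_sum f {1..N + 1} z m = field_sum f {1..N} z' m'"
    using field_sum_reindex[OF \<sigma>] by (simp add: z'_def m'_def)
  let ?F = "field_sum f {1..N} z' m'"
  have "ereal (real N) * (ereal R * \<beta>) = (\<Sum>i\<in>{1..N}. ereal R * \<beta>)"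
    by (simp add: sum_constant_ereal mult.commute)
  also have "\<dots> \<le> ?F"
    unfolding field_sum_def
  proof (rule sum_mono)
    fix i assume i: "i \<in> {1..N}"
    have "ereal R * \<beta> \<le> ereal (m' i) * \<beta>"
      using m'R[OF i] m'0[OF i] \<beta>(2) R by (cases \<beta>) (auto intro: mult_right_mono_neg)
    also have "\<dots> \<le> ereal (m' i) * f (z' i)"
      using m'0[OF i] \<beta>(1)[OF z'K[OF i]] by (intro ereal_mult_left_mono) auto
    finally show "ereal R * \<beta> \<le> ereal (m' i) * f (z' i)" .
  qed
  finally have "ereal 2 * (ereal (real N) * (ereal R * \<beta>)) \<le> ereal 2 * ?F"
    by (rule ereal_mult_left_mono) simp
  moreover have "ereal 2 * (ereal (real N) * (ereal R * \<beta>)) = ereal (2 * R * real N) * \<beta>"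
    by (simp add: mult.assoc[symmetric]) (simp add: mult_ac)
  ultimately have step: "ereal (2 * R * real N) * \<beta> \<le> ereal 2 * ?F"
    by simp
  have "min_discrete_energy g f K R N \<le> discrete_energy g f N (z', m')"
    unfolding min_discrete_energy_def using z'K m'0 m'R by (intro INF_lower) (auto simp: configurations_def)
  then have "min_discrete_energy g f K R N + ereal (2 * R * real N) * \<beta> \<le> discrete_energy g f N (z', m') + ereal 2 * ?F"
    using step by (rule add_mono)
  also have "\<dots> = pair_sum G {1..N} z' m' + (ereal (2 * real N) * ?F + ereal 2 * ?F)"
    unfolding discrete_energy_eq G[symmetric] by (rule add.assoc)
  also have "ereal (2 * real N) * ?F + ereal 2 * ?F = (ereal (2 * real N) + ereal 2) * ?F"
    by (rule ereal_left_distrib[symmetric]) auto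
  also have "ereal (2 * real N) + ereal 2 = ereal (2 * real (N + 1))"
    by simp
  also have "pair_sum G {1..N} z' m' + ereal (2 * real (N + 1)) * ?F = min_discrete_energy g f K R (N + 1)"
    unfolding discrete_minimizerD(5)[OF min] discrete_energy_eq G[symmetric] P F ..
  finally show False
    using gap by simp
qed

text \<open>With all other data fixed, the energy is affine in the mass of particle
  \<open>i\<close>. A minimum at an interior mass forces the slope to vanish, which is the asserted
  equation.\<close>

lemma discrete_minimizer_interior_mass:
  assumes G: "G = (\<lambda>z w. g (Some z) (Some w))" and R: "R \<ge> 0" and N: "N \<ge> 1"
    and min: "discrete_minimizer g f K R N z m"
    and i: "i \<in> {1..N}" "0 < m i" "m i < R"
  shows "\<bar>f (z i)\<bar> \<noteq> \<infinity>"
    and "(\<Sum>j\<in>{1..N} - {i}. ereal (m j) * G (z i) (z j)) = - (ereal (real N) * f (z i))"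
proof -
  note zK = discrete_minimizerD(1)[OF min] and m0 = discrete_minimizerD(2)[OF min] and mR = discrete_minimizerD(3)[OF min]
  define T where "T = {1..N} - {i}"
  have T: "finite T" "i \<notin> T" "{1..N} = insert i T"
    using i(1) by (auto simp: T_def)
  have TK: "z k \<in> K" "0 \<le> m k" if "k \<in> T" for k
    using zK m0 that by (auto simp: T_def)
  define P where "P = (\<Sum>j\<in>T. ereal (m j) * G (z i) (z j))"
  define A where "A = pair_sum G T z m"
  define F where "F = field_sum f T z m"
  have term_nonneg: "0 \<le> ereal (m j) * G (z i) (z j)" if "j \<in> T" for j
    using nonneg[OF zK[OF i(1)] TK(1)[OF that]] TK(2)[OF that] by auto
  have P0: "0 \<le> P"
    unfolding P_def by (intro sum_nonneg term_nonneg)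
  have A0: "0 \<le> A"
    unfolding A_def using TK by (intro pair_sum_nonneg)
  have F0: "F \<noteq> -\<infinity>"
    unfolding F_def using TK f_not_MInf by (intro field_sum_not_MInf) auto
  have energy: "discrete_energy g f N (z, m(i := x)) =
      (ereal x * P + ereal x * P + A) + ereal (2 * real N) * (ereal x * f (z i) + F)" if x: "0 \<le> x" for x
  proof -
    have "(\<Sum>j\<in>T. ereal (x * m j) * G (z i) (z j)) = ereal x * P"
    proof -
      have "(\<Sum>j\<in>T. ereal (x * m j) * G (z i) (z j)) = (\<Sum>j\<in>T. ereal x * (ereal (m j) * G (z i) (z j)))"
        by (simp add: mult.assoc[symmetric])
      also have "\<dots> = ereal x * P"
        unfolding P_def using term_nonneg by (intro sum_ereal_right_distrib[symmetric])
      finally show ?thesis .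
    qed
    \<comment> \<open>Symmetry of the kernel identifies the column with the row. This produces the
      factor 2 that matches the factor 2 of the field term.\<close>
    moreover have "(\<Sum>k\<in>T. ereal (m k * x) * G (z k) (z i)) = (\<Sum>j\<in>T. ereal (x * m j) * G (z i) (z j))"
      by (intro sum.cong refl) (use TK(1) sym zK[OF i(1)] in \<open>simp add: mult.commute\<close>)
    moreover define m' where "m' = m(i := x)"
    have m': "m' i = x" "\<And>j. j \<in> T \<Longrightarrow> m' j = m j"
      using T(2) by (auto simp: m'_def)
    have AF: "pair_sum G T z m' = A" "field_sum f T z m' = F"
      unfolding A_def F_def by (auto intro!: pair_sum_cong field_sum_cong m'(2))
    have "pair_sum G (insert i T) z m' = (\<Sum>j\<in>T. ereal (m' i * m' j) * G (z i) (z j)) +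
        (\<Sum>k\<in>T. ereal (m' k * m' i) * G (z k) (z i)) + pair_sum G T z m'"
      unfolding pair_sum_def by (rule sum_off_diagonal_insert[OF T(1,2)])
    ultimately have "pair_sum G (insert i T) z m' = ereal x * P + ereal x * P + A"
      unfolding AF by (simp add: m' cong: sum.cong)
    moreover have "field_sum f (insert i T) z m' = ereal x * f (z i) + F"
      using AF(2) T(1,2) by (simp add: field_sum_def m'(1))
    ultimately show ?thesis
      unfolding discrete_energy_eq G[symmetric] T(3) m'_def by simp
  qed
  have E0: "discrete_energy g f N (z, m(i := m i)) \<le> 0"
    using discrete_minimum_nonpos[OF min R] by simp
  have fi: "f (z i) \<noteq> -\<infinity>"
    using f_not_MInf zK i(1) by blast
  have N0: "real N > 0"
    using N by simp
  \<comment> \<open>The minimum is at most 0 and no summand is -\<infinity>, so no summand can be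
    \<infinity>; positivity of \<open>m i\<close> transfers this to \<open>P\<close> and
    \<open>f (z i)\<close>.\<close>
  have fin: "P \<noteq> \<infinity> \<and> A \<noteq> \<infinity> \<and> F \<noteq> \<infinity> \<and> f (z i) \<noteq> \<infinity>"
    using E0 P0 A0 F0 fi N0 i(2) unfolding energy[OF less_imp_le[OF i(2)]]
    by (cases P; cases A; cases F; cases "f (z i)") auto
  then show "\<bar>f (z i)\<bar> \<noteq> \<infinity>"
    using fi by (cases "f (z i)") auto
  obtain p a b c where pabc: "P = ereal p" "A = ereal a" "F = ereal b" "f (z i) = ereal c"
    using fin P0 A0 F0 fi by (cases P; cases A; cases F; cases "f (z i)") auto
  define s where "s = 2 * (p + real N * c)"
  have en: "discrete_energy g f N (z, m(i := x)) = ereal (x * s + (a + 2 * real N * b))" if "0 \<le> x" for x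
    unfolding energy[OF that] pabc s_def by (simp add: algebra_simps)
  have le: "m i * s \<le> x * s" if "0 \<le> x" "x \<le> R" for x
  proof -
    have "discrete_energy g f N (z, m(i := m i)) \<le> discrete_energy g f N (z, m(i := x))"
      unfolding fun_upd_triv using zK m0 mR that by (intro discrete_minimizerD(4)[OF min]) auto
    then show ?thesis
      using en[OF that(1)] en[of "m i"] i(2) by simp
  qed
  \<comment> \<open>Comparison with mass 0 excludes a positive slope, comparison with mass
    \<open>R\<close> a negative one.\<close>
  have "s = 0"
  proof (rule antisym)
    show "s \<le> 0"
      using le[of 0] i(2) R by (simp add: mult_le_0_iff)
    show "0 \<le> s"
      using le[of R] i(3) R by (simp add: mult_le_cancel_right)
  qed
  then have "p = - (real N * c)"
    by (simp add: s_def)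
  then show "(\<Sum>j\<in>{1..N} - {i}. ereal (m j) * G (z i) (z j)) = - (ereal (real N) * f (z i))"
    unfolding T_def[symmetric] P_def[symmetric] using pabc by simp
qed

end

section \<open>The seven properties for the Green function of a domain\<close>

theorem theorem2p2:
  fixes D :: "complex option set"
    and g :: "complex option \<Rightarrow> complex option \<Rightarrow> ereal"
    and K :: "complex set"
    and R :: real
    and f :: "complex \<Rightarrow> ereal"
    and \<mu> :: "complex measure"
    and v \<beta> :: ereal
    and e :: "nat \<Rightarrow> ereal"
  assumes D: "sphere_domain D"
    and g: "green_function D g"
    and K: "compact K" "Some ` K \<subseteq> D"
    and R: "R > 0"
    and f: "\<forall>z\<in>K. f z \<noteq> -\<infinity>" "lower_semicontinuous_on K f"
    and cap: "log_capacity {z \<in> K. f z < \<infinity>} > 0"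
    and \<mu>: "is_arg_min (weighted_energy g f) (\<lambda>\<nu>. \<nu> \<in> measures_upto K R) \<mu>"
    and v: "v = weighted_energy g f \<mu>"
    and \<beta>: "\<beta> = (INF z\<in>K. f z)"
    and e: "\<And>N. N \<ge> 2 \<Longrightarrow> e N = min_discrete_energy g f K R N"
  shows "(\<mu> = null_measure borel \<longleftrightarrow> quasi_everywhere_on K (\<lambda>z. f z \<ge> 0))
    \<and> (measure \<mu> K < R \<longrightarrow> v = ereal_integral \<mu> f \<and> v = - green_energy g \<mu>)
    \<and> (measure \<mu> K > 0 \<longrightarrow> v < 0)
    \<and> ((\<forall>z\<in>K. f z \<le> 0) \<longrightarrow> (\<forall>N\<ge>2. e (N + 1) \<le> e N))
    \<and> (\<forall>N\<ge>2. \<forall>z m. discrete_minimizer g f K R N z m \<longrightarrow>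
          (\<forall>i\<in>{1..N}. \<forall>j\<in>{1..N}. i \<noteq> j \<and> m i > 0 \<and> m j > 0 \<longrightarrow> z i \<noteq> z j))
    \<and> (\<forall>N\<ge>2. \<beta> < 0 \<and> e (N + 1) < e N + ereal (2 * R * real N) * \<beta> \<longrightarrow>
          (\<forall>z m. discrete_minimizer g f K R (N + 1) z m \<longrightarrow> (\<forall>j\<in>{1..N + 1}. m j > 0)))
    \<and> (\<forall>N\<ge>2. \<forall>z m. discrete_minimizer g f K R N z m \<longrightarrow>
          (\<forall>i\<in>{1..N}. 0 < m i \<and> m i < R \<longrightarrow>
             \<bar>f (z i)\<bar> \<noteq> \<infinity> \<and>
             (\<Sum>j\<in>{1..N} - {i}. ereal (m j) * g (Some (z i)) (Some (z j)))
               = - (ereal (real N) * f (z i))))"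
proof -
  define G where "G z w = g (Some z) (Some w)" for z w
  have G: "G = (\<lambda>z w. g (Some z) (Some w))"
    by (simp add: G_def[abs_def])
  interpret green_kernel K G
    unfolding G using D g K by (intro green_kernel_green_function) (auto simp: sphere_domain_def)
  interpret weighted_green_kernel K G f
    by unfold_locales (use f in auto)
  have J: "weighted_energy g f = weighted"
    unfolding weighted_energy_def green_energy_def weighted_def by (simp add: fun_eq_iff G_def)
  have \<mu>K: "\<mu> \<in> measures_upto K R" and min: "\<And>\<nu>. \<nu> \<in> measures_upto K R \<Longrightarrow> weighted \<mu> \<le> weighted \<nu>"
    using \<mu> unfolding J is_arg_min_def by (auto simp: not_less)
  have v: "v = weighted \<mu>"
    using v J by simp
  have "{z \<in> K. \<not> f z \<ge> 0} = {z \<in> K. f z < 0}"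
    by auto
  then have 1: "\<mu> = null_measure borel \<longleftrightarrow> quasi_everywhere_on K (\<lambda>z. f z \<ge> 0)"
    using minimizer_zero_iff[OF R \<mu>K min] by (simp add: quasi_everywhere_on_def)
  have "green_energy g \<mu> = enn2ereal (interaction \<mu>)"
    using interaction_eq[OF \<mu>K] by (simp add: green_energy_def G)
  then have 2: "measure \<mu> K < R \<longrightarrow> v = ereal_integral \<mu> f \<and> v = - green_energy g \<mu>"
    unfolding v using minimizer_small_mass[OF R \<mu>K min] by simp
  have 3: "measure \<mu> K > 0 \<longrightarrow> v < 0"
    unfolding v using minimum_negative[OF R \<mu>K min] by simp
  have R0: "R \<ge> 0"
    using R by simp
  have 4: "(\<forall>z\<in>K. f z \<le> 0) \<longrightarrow> (\<forall>N\<ge>2. e (N + 1) \<le> e N)"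
    using discrete_min_decreasing[OF G _ _ R0] by (simp add: e)
  have 5: "\<forall>N\<ge>2. \<forall>z m. discrete_minimizer g f K R N z m \<longrightarrow>
      (\<forall>i\<in>{1..N}. \<forall>j\<in>{1..N}. i \<noteq> j \<and> m i > 0 \<and> m j > 0 \<longrightarrow> z i \<noteq> z j)"
    using discrete_minimizer_distinct[OF G R0] by blast
  have 6: "\<forall>N\<ge>2. \<beta> < 0 \<and> e (N + 1) < e N + ereal (2 * R * real N) * \<beta> \<longrightarrow>
      (\<forall>z m. discrete_minimizer g f K R (N + 1) z m \<longrightarrow> (\<forall>j\<in>{1..N + 1}. m j > 0))"
  proof (intro allI impI ballI, elim conjE)
    fix N z m j
    assume *: "2 \<le> N" "discrete_minimizer g f K R (N + 1) z m" "j \<in> {1..N + 1}" "\<beta> < 0"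
      and gap: "e (N + 1) < e N + ereal (2 * R * real N) * \<beta>"
    show "m j > 0"
    proof (rule discrete_minimizer_all_positive[OF G R0 _ *(4) _ *(2,3)])
      show "\<beta> \<le> f z" if "z \<in> K" for z
        unfolding \<beta> using that by (rule INF_lower)
      show "min_discrete_energy g f K R (N + 1) < min_discrete_energy g f K R N + ereal (2 * R * real N) * \<beta>"
        using gap *(1) by (simp add: e)
    qed
  qed
  have 7: "\<forall>N\<ge>2. \<forall>z m. discrete_minimizer g f K R N z m \<longrightarrow>
      (\<forall>i\<in>{1..N}. 0 < m i \<and> m i < R \<longrightarrow> \<bar>f (z i)\<bar> \<noteq> \<infinity> \<and>
         (\<Sum>j\<in>{1..N} - {i}. ereal (m j) * g (Some (z i)) (Some (z j))) = - (ereal (real N) * f (z i)))"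
  proof (intro allI impI ballI, elim conjE)
    fix N z m i
    assume "2 \<le> N" and *: "discrete_minimizer g f K R N z m" "i \<in> {1..N}" "0 < m i" "m i < R"
    then have "1 \<le> N"
      by simp
    from discrete_minimizer_interior_mass[OF G R0 this *]
    show "\<bar>f (z i)\<bar> \<noteq> \<infinity> \<and>
         (\<Sum>j\<in>{1..N} - {i}. ereal (m j) * g (Some (z i)) (Some (z j))) = - (ereal (real N) * f (z i))"
      unfolding G by blast
  qed
  from 1 2 3 4 5 6 7 show ?thesis
    by (intro conjI)
qed

end
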